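(* Let $n\ge 1$, $T>0$, and let $b:\mathbb{R}\to[0,\infty)$ be a continuous $T$-periodic function, not identically zero, whose weak derivative satisfies $b'\in L^\infty$. Let $m_0\in\mathbb{R}$, $m_0\neq 0$. Then there exist constants $\delta>0$ and $C>0$, depending only on the coefficient $b$ and on $m_0$, such that the solution $u=u(t,x)$, $t\ge 0$, $x\in\mathbb{R}^n$, to the Cauchy problem $$u_{tt}-\Delta u+2b(t)u_t+m_0^2u=0,\qquad u(0,x)=u_0(x),\quad u_t(0,x)=u_1(x),$$ satisfies for all $t\ge 0$ $$\|u(t,\cdot)\|_{L^2}\le Ce^{-\delta t}\big(\|u_0\|_{L^2}+\|u_1\|_{H^{-1}}\big),$$ $$\|\nabla u(t,\cdot)\|_{L^2}\le Ce^{-\delta t}\big(\|u_0\|_{H^1}+\|u_1\|_{L^2}\big),$$ $$\|u_t(t,\cdot)\|_{L^2}\le Ce^{-\delta t}\big(\|u_0\|_{H^1}+\|u_1\|_{L^2}\big),$$ each estimate holding for all initial data $(u_0,u_1)$ for which the norms on its right-hand side are finite.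
   Context: $H^s=H^s(\mathbb{R}^n)$ are the usual inhomogeneous $L^2$-based Sobolev spaces and $L^2=L^2(\mathbb{R}^n)$. The solution is the one whose partial Fourier transform $\hat u(t,\xi)$ in $x$ solves, for each $\xi$, the ordinary differential equation $\hat u_{tt}+|\xi|^2\hat u+2b(t)\hat u_t+m_0^2\hat u=0$ with $\hat u(0,\xi)=\hat u_0(\xi)$, $\hat u_t(0,\xi)=\hat u_1(\xi)$. *)

theory Defs
  imports "HOL-Analysis.Analysis"
begin

text \<open>
  The dimension is a natural number rather than a type, so that constants can be chosen uniformly
  in it: a point of n-dimensional space is a function on \<open>{..<n}\<close> (an element of
  \<open>space (lborel_n n)\<close>, hence \<open>undefined\<close> outside \<open>{..<n}\<close>), and its Euclidean norm is
  \<open>L2_set x {..<n}\<close>.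
\<close>

abbreviation lborel_n :: "nat \<Rightarrow> (nat \<Rightarrow> real) measure" where
  "lborel_n n \<equiv> Pi\<^sub>M {..<n} (\<lambda>_. lborel)"

abbreviation points :: "nat \<Rightarrow> (nat \<Rightarrow> real) set" where
  "points n \<equiv> space (lborel_n n)"

type_synonym cfun = "(nat \<Rightarrow> real) \<Rightarrow> complex"
type_synonym distribution = "cfun \<Rightarrow> complex"

subsection \<open>Schwartz functions and tempered distributions\<close>

definition partial_deriv :: "nat \<Rightarrow> cfun \<Rightarrow> cfun" where
  "partial_deriv i f = (\<lambda>x. vector_derivative (\<lambda>s. f (x(i := s))) (at (x i)))"

text \<open>
  Continuity of the iterated partial derivatives need not be demanded: by the decay condition all
  partial derivatives of the next order are bounded.
\<close>

definition schwartz :: "nat \<Rightarrow> cfun set" where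
  "schwartz n = {\<phi>. \<forall>is \<in> lists {..<n}.
     (\<forall>x \<in> points n. \<forall>i<n.
        (\<lambda>s. foldr partial_deriv is \<phi> (x(i := s))) differentiable (at (x i))) \<and>
     (\<forall>k. \<exists>M. \<forall>x \<in> points n.
        (1 + L2_set x {..<n}) ^ k * cmod (foldr partial_deriv is \<phi> x) \<le> M)}"

definition schwartz_seminorm :: "nat \<Rightarrow> nat \<Rightarrow> cfun \<Rightarrow> real" where
  "schwartz_seminorm n k \<phi> =
     (SUP (is, x) \<in> {is \<in> lists {..<n}. length is \<le> k} \<times> points n.
        (1 + L2_set x {..<n}) ^ k * cmod (foldr partial_deriv is \<phi> x))"

text \<open>
  Distributions are total functions on \<open>cfun\<close>; only their values on \<open>schwartz n\<close> are meaningful.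
\<close>

definition tempered :: "nat \<Rightarrow> distribution set" where
  "tempered n = {u.
     (\<forall>\<phi> \<in> schwartz n. \<forall>\<psi> \<in> schwartz n. \<forall>a c.
        u (\<lambda>x. a * \<phi> x + c * \<psi> x) = a * u \<phi> + c * u \<psi>) \<and>
     (\<exists>k M. \<forall>\<phi> \<in> schwartz n. cmod (u \<phi>) \<le> M * schwartz_seminorm n k \<phi>)}"

text \<open>The distribution \<open>u\<close> is given by the function \<open>f\<close>.\<close>

definition represents :: "nat \<Rightarrow> cfun \<Rightarrow> distribution \<Rightarrow> bool" where
  "represents n f u \<longleftrightarrow>
     f \<in> borel_measurable (lborel_n n) \<and>
     (\<forall>\<phi> \<in> schwartz n. integrable (lborel_n n) (\<lambda>x. f x * \<phi> x) \<and>
        u \<phi> = (\<integral>x. f x * \<phi> x \<partial>lborel_n n))"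

definition fourier :: "nat \<Rightarrow> cfun \<Rightarrow> cfun" where
  "fourier n \<phi> = (\<lambda>\<xi>. of_real ((2 * pi) powr (- real n / 2)) *
     (\<integral>x. cis (- (\<Sum>i<n. x i * \<xi> i)) * \<phi> x \<partial>lborel_n n))"

definition fourier_dist :: "nat \<Rightarrow> distribution \<Rightarrow> distribution" where
  "fourier_dist n u = (\<lambda>\<phi>. u (fourier n \<phi>))"

definition partial_dist :: "nat \<Rightarrow> distribution \<Rightarrow> distribution" where
  "partial_dist i u = (\<lambda>\<phi>. - u (partial_deriv i \<phi>))"

text \<open>
  Derivative in time, one-sided at \<open>t = 0\<close>, in the weak topology of tempered distributions.
\<close>

definition time_deriv :: "(real \<Rightarrow> distribution) \<Rightarrow> real \<Rightarrow> distribution" where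
  "time_deriv u t = (\<lambda>\<phi>. vector_derivative (\<lambda>s. u s \<phi>) (at t within {0..}))"

subsection \<open>Function spaces\<close>

text \<open>
  The representing function chosen by \<open>SOME\<close> below is unique up to null sets.
\<close>

definition L2_space :: "nat \<Rightarrow> distribution set" where
  "L2_space n = {u \<in> tempered n.
     \<exists>g. represents n g u \<and> integrable (lborel_n n) (\<lambda>x. (cmod (g x))\<^sup>2)}"

definition L2_norm :: "nat \<Rightarrow> distribution \<Rightarrow> real" where
  "L2_norm n u = (let g = (SOME g. represents n g u)
     in sqrt (\<integral>x. (cmod (g x))\<^sup>2 \<partial>lborel_n n))"

definition sobolev :: "nat \<Rightarrow> real \<Rightarrow> distribution set" where
  "sobolev n s = {u \<in> tempered n.
     \<exists>f. represents n f (fourier_dist n u) \<and>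
       integrable (lborel_n n) (\<lambda>\<xi>. (1 + (L2_set \<xi> {..<n})\<^sup>2) powr s * (cmod (f \<xi>))\<^sup>2)}"

definition sobolev_norm :: "nat \<Rightarrow> real \<Rightarrow> distribution \<Rightarrow> real" where
  "sobolev_norm n s u = (let f = (SOME f. represents n f (fourier_dist n u))
     in sqrt (\<integral>\<xi>. (1 + (L2_set \<xi> {..<n})\<^sup>2) powr s * (cmod (f \<xi>))\<^sup>2 \<partial>lborel_n n))"

definition gradient_L2_norm :: "nat \<Rightarrow> distribution \<Rightarrow> real" where
  "gradient_L2_norm n u = sqrt (\<Sum>i<n. (L2_norm n (partial_dist i u))\<^sup>2)"

subsection \<open>Weak derivatives on the line\<close>

definition test_function :: "(real \<Rightarrow> real) \<Rightarrow> bool" where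
  "test_function \<phi> \<longleftrightarrow>
     (\<forall>k x. ((deriv ^^ k) \<phi>) differentiable (at x)) \<and>
     (\<exists>R. \<forall>x. R < \<bar>x\<bar> \<longrightarrow> \<phi> x = 0)"

definition weak_derivative :: "(real \<Rightarrow> real) \<Rightarrow> (real \<Rightarrow> real) \<Rightarrow> bool" where
  "weak_derivative g g' \<longleftrightarrow>
     (\<forall>r s. set_integrable lborel {r..s} g \<and> set_integrable lborel {r..s} g') \<and>
     (\<forall>\<phi>. test_function \<phi> \<longrightarrow>
        (\<integral>x. g x * deriv \<phi> x \<partial>lborel) = - (\<integral>x. g' x * \<phi> x \<partial>lborel))"

definition L_infinity :: "(real \<Rightarrow> real) set" where
  "L_infinity = {g \<in> borel_measurable lborel. \<exists>M. AE x in lborel. \<bar>g x\<bar> \<le> M}"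

subsection \<open>The Cauchy problem\<close>

text \<open>
  Here \<open>v t\<close> is the partial Fourier transform of \<open>u t\<close>. The initial conditions say that
  \<open>v 0\<close> and \<open>v' 0\<close> are (representatives of) the Fourier transforms of \<open>u0\<close> and \<open>u1\<close>.
\<close>

definition cauchy_solution ::
    "nat \<Rightarrow> (real \<Rightarrow> real) \<Rightarrow> real \<Rightarrow> distribution \<Rightarrow> distribution \<Rightarrow> (real \<Rightarrow> distribution) \<Rightarrow> bool" where
  "cauchy_solution n b m0 u0 u1 u \<longleftrightarrow>
     (\<forall>t\<ge>0. u t \<in> tempered n) \<and>
     (\<exists>v v' v''.
        (\<forall>t\<ge>0. represents n (v t) (fourier_dist n (u t))) \<and>
        represents n (v 0) (fourier_dist n u0) \<and>
        represents n (v' 0) (fourier_dist n u1) \<and>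
        (\<forall>\<xi> \<in> points n. \<forall>t\<ge>0.
           ((\<lambda>s. v s \<xi>) has_vector_derivative v' t \<xi>) (at t within {0..}) \<and>
           ((\<lambda>s. v' s \<xi>) has_vector_derivative v'' t \<xi>) (at t within {0..}) \<and>
           v'' t \<xi> + of_real ((L2_set \<xi> {..<n})\<^sup>2) * v t \<xi> + of_real (2 * b t) * v' t \<xi>
             + of_real (m0\<^sup>2) * v t \<xi> = 0))"

end

(*
  On the Fourier side every frequency xi solves an ordinary differential equation with
  lambda^2 = |xi|^2 + m0^2 >= m0^2 > 0 and energy E = |w'|^2 + lambda^2 |w|^2, E' = - 4 b |w'|^2.
  By continuity and periodicity, b is bounded below on translates of some interval [a, c] with
  period T.  On such an interval a multiplier argument transfers the dissipation of |w'|^2 to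
  lambda^2 |w|^2, so E(c) <= q E(a) with q < 1 independent of lambda, and E decays exponentially,
  uniformly in xi.  Plancherel's theorem turns this into the three estimates.

  Plancherel is only needed as an inequality: for f in L^2 the functional psi |-> int f F(psi) on
  Schwartz functions is bounded in the L^2 norm, and the Riesz representation theorem produces the
  function that represents it.  Two representing functions coincide almost everywhere because
  Schwartz functions separate measurable functions; no density theorem is used.
*)

theory Submission
  imports Defs "HOL-Probability.Probability" "HOL-Real_Asymp.Real_Asymp"
begin

section \<open>Schwartz functions\<close>

text \<open>The hypothesis \<open>m0 \<noteq> 0\<close> makes a uniform rate possible: as the
  squared frequency tends to 0, an overdamped mode moves ever more slowly, and dissipating |w'|^2
  costs it ever less. The three estimates share one energy bound. Dividing it by the squared
  frequency puts u1 into H^-1; multiplying v by xi, or passing to v', asks for u0 in H^1 and u1 in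
  L^2. Much of the length has another origin. The solution is a family of distributions known
  through representatives of their transforms, so u, its partial derivatives and its time derivative
  must each be shown to be functions, and data norms must be evaluated at whichever representative
  the solution carries. The time derivative is moreover a weak limit, so the frequency integral has
  to be differentiated, with a majorant supplied by energy monotonicity. Functions are total but
  constrained on \<open>points n\<close> only. Identities between Schwartz functions hold only
  there, and the continuity of a distribution is what carries them through it.\<close>

definition has_partial :: "nat \<Rightarrow> nat \<Rightarrow> cfun \<Rightarrow> cfun \<Rightarrow> bool" where
  "has_partial n i f g \<longleftrightarrow>
     (\<forall>x\<in>points n. ((\<lambda>s. f (x(i := s))) has_vector_derivative g x) (at (x i)))"

definition rapidly_decreasing :: "nat \<Rightarrow> cfun \<Rightarrow> bool" where
  "rapidly_decreasing n f \<longleftrightarrow>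
     (\<forall>k. \<exists>M. \<forall>x\<in>points n. (1 + L2_set x {..<n}) ^ k * cmod (f x) \<le> M)"

lemma points_upd: "x \<in> points n \<Longrightarrow> i < n \<Longrightarrow> x(i := s) \<in> points n"
  by (auto simp: space_PiM PiE_def extensional_def)

lemma points_nonempty: "points n \<noteq> {}"
  by (simp add: space_PiM PiE_eq_empty_iff)

lemma has_partialD:
  assumes "has_partial n i f g" "x \<in> points n" "i < n"
  shows "((\<lambda>s. f (x(i := s))) has_vector_derivative g (x(i := t))) (at t)"
  using assms(1)[unfolded has_partial_def, rule_format, OF points_upd[OF assms(2,3)], of t] by simp

lemma has_partial_cong:
  assumes "has_partial n i f g" "i < n" "\<And>x. x \<in> points n \<Longrightarrow> f x = f' x"
    "\<And>x. x \<in> points n \<Longrightarrow> g x = g' x"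
  shows "has_partial n i f' g'"
  using assms unfolding has_partial_def by (simp add: points_upd)

lemma partial_deriv_eq:
  assumes "has_partial n i f g" "x \<in> points n"
  shows "partial_deriv i f x = g x"
  using assms unfolding has_partial_def partial_deriv_def by (simp add: vector_derivative_at)

lemma schwartz_iff:
  "\<phi> \<in> schwartz n \<longleftrightarrow> (\<forall>is\<in>lists {..<n}.
     (\<forall>i<n. has_partial n i (foldr partial_deriv is \<phi>) (partial_deriv i (foldr partial_deriv is \<phi>))) \<and>
     rapidly_decreasing n (foldr partial_deriv is \<phi>))"
  unfolding schwartz_def rapidly_decreasing_def has_partial_def partial_deriv_def
  by (simp only: mem_Collect_eq vector_derivative_works[symmetric]) blast

text \<open>Replaces formulas for iterated derivatives by the choice of a suitable family
  \<open>A\<close>. Closure is phrased with \<open>has_partial\<close> because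
  \<open>partial_deriv\<close> of a member need not be a member: the two agree on
  \<open>points n\<close> only, and iterated derivatives are tracked up to equality there.\<close>

lemma schwartz_coinduct:
  assumes "f \<in> A"
    and decay: "\<And>g. g \<in> A \<Longrightarrow> rapidly_decreasing n g"
    and partial: "\<And>g i. g \<in> A \<Longrightarrow> i < n \<Longrightarrow> \<exists>h\<in>A. has_partial n i g h"
  shows "f \<in> schwartz n"
proof -
  have ex: "\<exists>h\<in>A. \<forall>x\<in>points n. foldr partial_deriv is f x = h x" if "is \<in> lists {..<n}" for "is"
    using that
  proof (induction "is")
    case Nil
    then show ?case using assms(1) by auto
  next
    case (Cons i js)
    then obtain h where h: "h \<in> A" "\<forall>x\<in>points n. foldr partial_deriv js f x = h x" by auto
    have i: "i < n" using Cons.hyps by auto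
    from partial[OF h(1) i] obtain h' where h': "h' \<in> A" "has_partial n i h h'" by blast
    have "has_partial n i (foldr partial_deriv js f) h'"
      using has_partial_cong[OF h'(2) i, of "foldr partial_deriv js f" h'] h(2) by simp
    then show ?case using h'(1) partial_deriv_eq by auto
  qed
  show ?thesis
    unfolding schwartz_iff
  proof (intro ballI conjI allI impI)
    fix "is" assume "is \<in> lists {..<n}"
    from ex[OF this] obtain h where h: "h \<in> A" "\<forall>x\<in>points n. foldr partial_deriv is f x = h x"
      by blast
    show "rapidly_decreasing n (foldr partial_deriv is f)"
      using decay[OF h(1)] h(2) unfolding rapidly_decreasing_def by simp
    fix i assume i: "i < n"
    from partial[OF h(1) i] obtain h' where h': "h' \<in> A" "has_partial n i h h'" by blast
    have hp: "has_partial n i (foldr partial_deriv is f) h'"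
      using has_partial_cong[OF h'(2) i, of "foldr partial_deriv is f" h'] h(2) by simp
    show "has_partial n i (foldr partial_deriv is f) (partial_deriv i (foldr partial_deriv is f))"
      by (rule has_partial_cong[OF hp i refl]) (simp add: partial_deriv_eq[OF hp])
  qed
qed

lemma schwartz_has_partial:
  assumes "\<phi> \<in> schwartz n" "i < n"
  shows "has_partial n i \<phi> (partial_deriv i \<phi>)"
  using assms unfolding schwartz_iff by (metis foldr.simps(1) id_apply lists.Nil)

lemma schwartz_decreasing: "\<phi> \<in> schwartz n \<Longrightarrow> rapidly_decreasing n \<phi>"
  unfolding schwartz_iff by (metis foldr.simps(1) id_apply lists.Nil)

lemma schwartz_partial_deriv:
  assumes "\<phi> \<in> schwartz n" "i < n"
  shows "partial_deriv i \<phi> \<in> schwartz n"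
  unfolding schwartz_iff
proof
  fix "is" assume "is \<in> lists {..<n}"
  \<comment> \<open>\<open>foldr\<close> applies the last entry of the list first, so derivatives of
    \<open>partial_deriv i \<phi>\<close> are those of \<open>\<phi>\<close> along lists ending in
    \<open>i\<close>.\<close>
  then have "is @ [i] \<in> lists {..<n}" using assms(2) by auto
  then show "(\<forall>j<n. has_partial n j (foldr partial_deriv is (partial_deriv i \<phi>))
        (partial_deriv j (foldr partial_deriv is (partial_deriv i \<phi>)))) \<and>
      rapidly_decreasing n (foldr partial_deriv is (partial_deriv i \<phi>))"
    using assms(1)[unfolded schwartz_iff, rule_format, of "is @ [i]"] by simp
qed

section \<open>Closure properties of the Schwartz space\<close>

lemma L2_set_pos: "0 < 1 + L2_set x A"
  using L2_set_nonneg[of x A] by linarith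

lemma rapidly_decreasing_lincomb:
  assumes "rapidly_decreasing n f" "rapidly_decreasing n g"
  shows "rapidly_decreasing n (\<lambda>x. a * f x + c * g x)"
  unfolding rapidly_decreasing_def
proof
  fix k
  obtain M N where M: "\<forall>x\<in>points n. (1 + L2_set x {..<n}) ^ k * cmod (f x) \<le> M"
    and N: "\<forall>x\<in>points n. (1 + L2_set x {..<n}) ^ k * cmod (g x) \<le> N"
    using assms unfolding rapidly_decreasing_def by meson
  show "\<exists>M. \<forall>x\<in>points n. (1 + L2_set x {..<n}) ^ k * cmod (a * f x + c * g x) \<le> M"
  proof (intro exI ballI)
    fix x assume x: "x \<in> points n"
    let ?w = "(1 + L2_set x {..<n}) ^ k"
    have "?w * cmod (a * f x + c * g x) \<le> ?w * (cmod a * cmod (f x) + cmod c * cmod (g x))"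
      using L2_set_pos[of x "{..<n}"]
      by (intro mult_left_mono order_trans[OF norm_triangle_ineq]) (auto simp: norm_mult)
    also have "\<dots> = cmod a * (?w * cmod (f x)) + cmod c * (?w * cmod (g x))"
      by (simp add: algebra_simps)
    also have "\<dots> \<le> cmod a * M + cmod c * N"
      using M N x by (intro add_mono mult_left_mono) auto
    finally show "?w * cmod (a * f x + c * g x) \<le> cmod a * M + cmod c * N" .
  qed
qed

lemma has_partial_lincomb:
  assumes "has_partial n i f f'" "has_partial n i g g'"
  shows "has_partial n i (\<lambda>x. a * f x + c * g x) (\<lambda>x. a * f' x + c * g' x)"
  using assms unfolding has_partial_def
  by (auto intro!: derivative_intros)

lemma schwartz_lincomb:
  assumes "f \<in> schwartz n" "g \<in> schwartz n"
  shows "(\<lambda>x. a * f x + c * g x) \<in> schwartz n"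
proof (rule schwartz_coinduct[of _ "{h. \<exists>f\<in>schwartz n. \<exists>g\<in>schwartz n. h = (\<lambda>x. a * f x + c * g x)}"], goal_cases)
  case 1 then show ?case using assms by auto
next
  case (2 h) then show ?case using rapidly_decreasing_lincomb schwartz_decreasing by auto
next
  case (3 h i)
  then obtain f g where fg: "f \<in> schwartz n" "g \<in> schwartz n" "h = (\<lambda>x. a * f x + c * g x)" by auto
  show ?case
    using has_partial_lincomb[OF schwartz_has_partial[OF fg(1) 3(2)] schwartz_has_partial[OF fg(2) 3(2)]]
      schwartz_partial_deriv[OF fg(1) 3(2)] schwartz_partial_deriv[OF fg(2) 3(2)] unfolding fg(3) by auto
qed

lemma schwartz_mult_const: "f \<in> schwartz n \<Longrightarrow> (\<lambda>x. a * f x) \<in> schwartz n"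
  using schwartz_lincomb[of f n f a 0] by simp

lemma abs_coord_le_L2_set:
  fixes x :: "nat \<Rightarrow> real"
  shows "i < n \<Longrightarrow> \<bar>x i\<bar> \<le> L2_set x {..<n}"
  using member_le_L2_set[OF finite_lessThan, of i n "\<lambda>i. \<bar>x i\<bar>"] unfolding L2_set_def by simp

lemma rapidly_decreasing_coord:
  assumes "rapidly_decreasing n f" "i < n"
  shows "rapidly_decreasing n (\<lambda>x. of_real (x i) * f x)"
  unfolding rapidly_decreasing_def
proof
  fix k
  obtain M where M: "\<forall>x\<in>points n. (1 + L2_set x {..<n}) ^ Suc k * cmod (f x) \<le> M"
    using assms unfolding rapidly_decreasing_def by meson
  show "\<exists>M. \<forall>x\<in>points n. (1 + L2_set x {..<n}) ^ k * cmod (of_real (x i) * f x) \<le> M"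
  proof (intro exI ballI)
    fix x assume x: "x \<in> points n"
    let ?w = "(1 + L2_set x {..<n})"
    have "?w ^ k * cmod (of_real (x i) * f x) = (?w ^ k * cmod (f x)) * \<bar>x i\<bar>"
      by (simp add: norm_mult)
    also have "\<dots> \<le> (?w ^ k * cmod (f x)) * ?w"
      using L2_set_pos[of x "{..<n}"] abs_coord_le_L2_set[OF assms(2), of x]
      by (intro mult_left_mono) auto
    also have "\<dots> \<le> M" using M x by (simp add: mult_ac)
    finally show "?w ^ k * cmod (of_real (x i) * f x) \<le> M" .
  qed
qed

text \<open>Products \<open>x i * g\<close> alone are not closed under the i-th derivative, which
  leaves an extra \<open>g\<close>; sums \<open>f + x i * g\<close> with \<open>f\<close> and
  \<open>g\<close> Schwartz are.\<close>

lemma schwartz_coord: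
  assumes "f \<in> schwartz n" "i < n"
  shows "(\<lambda>x. of_real (x i) * f x) \<in> schwartz n"
proof (rule schwartz_coinduct[of _
      "{h. \<exists>f\<in>schwartz n. \<exists>g\<in>schwartz n. h = (\<lambda>x. f x + of_real (x i) * g x)}"], goal_cases)
  case 1
  have "(\<lambda>x. 0) \<in> schwartz n" using schwartz_mult_const[OF assms(1), of 0] by simp
  then show ?case using assms by force
next
  case (2 h)
  then obtain f g where fg: "f \<in> schwartz n" "g \<in> schwartz n" "h = (\<lambda>x. f x + of_real (x i) * g x)" by auto
  show ?case
    using rapidly_decreasing_lincomb[of n f "\<lambda>x. of_real (x i) * g x" 1 1]
      rapidly_decreasing_coord[OF _ assms(2)] schwartz_decreasing fg by auto
next
  case (3 h j)
  then obtain f g where fg: "f \<in> schwartz n" "g \<in> schwartz n" "h = (\<lambda>x. f x + of_real (x i) * g x)" by auto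
  let ?d = "if i = j then 1 else 0 :: complex"
  let ?h = "\<lambda>x. (1 * partial_deriv j f x + ?d * g x) + of_real (x i) * partial_deriv j g x"
  have "has_partial n j h ?h"
    using schwartz_has_partial[OF fg(1) 3(2)] schwartz_has_partial[OF fg(2) 3(2)]
    unfolding has_partial_def fg(3)
    by (auto intro!: derivative_eq_intros)
  moreover have "(\<lambda>x. 1 * partial_deriv j f x + ?d * g x) \<in> schwartz n"
    by (intro schwartz_lincomb schwartz_partial_deriv fg 3(2))
  ultimately show ?case
    using schwartz_partial_deriv[OF fg(2) 3(2)]
    by (intro bexI[of _ ?h] CollectI bexI[of _ "\<lambda>x. 1 * partial_deriv j f x + ?d * g x"]
      bexI[of _ "partial_deriv j g"] refl)
qed

definition dot :: "nat \<Rightarrow> (nat \<Rightarrow> real) \<Rightarrow> (nat \<Rightarrow> real) \<Rightarrow> real" where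
  "dot n x y = (\<Sum>i<n. x i * y i)"

lemma dot_upd: "i < n \<Longrightarrow> dot n (x(i := s)) y = s * y i + (\<Sum>j\<in>{..<n} - {i}. x j * y j)"
  unfolding dot_def by (subst sum.remove[of _ i]) auto

lemma dot_commute: "dot n x y = dot n y x"
  by (simp add: dot_def mult.commute)

lemma has_partial_cis:
  assumes "i < n"
  shows "has_partial n i (\<lambda>x. cis (r * dot n x y)) (\<lambda>x. \<i> * of_real (r * y i) * cis (r * dot n x y))"
  unfolding has_partial_def
proof
  fix x :: "nat \<Rightarrow> real" assume x: "x \<in> points n"
  let ?c = "\<Sum>j\<in>{..<n} - {i}. x j * y j"
  have "((\<lambda>s. exp (\<i> * of_real (r * (s * y i + ?c)))) has_vector_derivative
      (\<i> * of_real (r * y i)) * exp (\<i> * of_real (r * (x i * y i + ?c)))) (at (x i))"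
    by (auto intro!: derivative_eq_intros simp: has_vector_derivative_real_field
      intro: has_vector_derivative_real_field)
  then show "((\<lambda>s. cis (r * dot n (x(i := s)) y)) has_vector_derivative
      \<i> * of_real (r * y i) * cis (r * dot n x y)) (at (x i))"
    using dot_upd[OF assms, of x "x i" y] by (simp add: cis_conv_exp dot_upd[OF assms])
qed

lemma has_partial_mult:
  assumes "has_partial n i f f'" "has_partial n i g g'"
  shows "has_partial n i (\<lambda>x. f x * g x) (\<lambda>x. f x * g' x + f' x * g x)"
  using assms unfolding has_partial_def
  by (auto intro!: derivative_eq_intros)

text \<open>Differentiating the plane wave multiplies it by the constant
  \<open>\<i> * r * y i\<close>, so it factors out of every derivative. This makes the modulated
  function admissible in \<open>integral_partial_deriv_eq_0\<close>.\<close>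

lemma schwartz_cis:
  assumes "f \<in> schwartz n"
  shows "(\<lambda>x. cis (r * dot n x y) * f x) \<in> schwartz n"
proof (rule schwartz_coinduct[of _
      "{h. \<exists>f\<in>schwartz n. h = (\<lambda>x. cis (r * dot n x y) * f x)}"], goal_cases)
  case 1
  then show ?case using assms by force
next
  case (2 h)
  then show ?case
    by (auto simp: rapidly_decreasing_def norm_mult dest!: schwartz_decreasing)
next
  case (3 h i)
  then obtain f where f: "f \<in> schwartz n" "h = (\<lambda>x. cis (r * dot n x y) * f x)" by auto
  let ?f = "\<lambda>x. 1 * partial_deriv i f x + \<i> * of_real (r * y i) * f x"
  have "has_partial n i h (\<lambda>x. cis (r * dot n x y) * ?f x)"
    using has_partial_mult[OF has_partial_cis[OF 3(2), of r y] schwartz_has_partial[OF f(1) 3(2)]]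
    unfolding f(2) by (simp add: algebra_simps)
  moreover have "?f \<in> schwartz n" by (intro schwartz_lincomb schwartz_partial_deriv f 3(2))
  ultimately show ?case
    by (intro bexI[of _ "\<lambda>x. cis (r * dot n x y) * ?f x"] CollectI bexI[of _ ?f] refl)
qed

lemma schwartz_cnj:
  assumes "f \<in> schwartz n"
  shows "(\<lambda>x. cnj (f x)) \<in> schwartz n"
proof (rule schwartz_coinduct[of _ "{h. \<exists>f\<in>schwartz n. h = (\<lambda>x. cnj (f x))}"], goal_cases)
  case 1
  then show ?case using assms by force
next
  case (2 h)
  then show ?case
    by (auto simp: rapidly_decreasing_def dest!: schwartz_decreasing)
next
  case (3 h i)
  then obtain f where f: "f \<in> schwartz n" "h = (\<lambda>x. cnj (f x))" by auto
  have "has_partial n i h (\<lambda>x. cnj (partial_deriv i f x))"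
    using schwartz_has_partial[OF f(1) 3(2)]
    unfolding f(2) has_partial_def by (auto intro!: has_vector_derivative_cnj)
  then show ?case using schwartz_partial_deriv[OF f(1) 3(2)] by blast
qed

subsection \<open>Measurability and integrability\<close>

lemma schwartz_bounded:
  assumes "\<phi> \<in> schwartz n"
  obtains M where "\<And>x. x \<in> points n \<Longrightarrow> (1 + L2_set x {..<n}) ^ k * cmod (\<phi> x) \<le> M" "M \<ge> 0"
proof -
  obtain M where M: "\<forall>x\<in>points n. (1 + L2_set x {..<n}) ^ k * cmod (\<phi> x) \<le> M"
    using schwartz_decreasing[OF assms] unfolding rapidly_decreasing_def by meson
  obtain x where "x \<in> points n" using points_nonempty[of n] by blast
  moreover have "0 \<le> (1 + L2_set x {..<n}) ^ k * cmod (\<phi> x)"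
    using L2_set_pos[of x "{..<n}"] by simp
  ultimately have "M \<ge> 0" using M order_trans by blast
  with M that show thesis by blast
qed

text \<open>Existence of partial derivatives alone gives no joint regularity; their boundedness
  does, by the mean value theorem along one coordinate at a time. The bound serves both
  measurability and the error estimate in \<open>gaussian_mollification\<close>.\<close>

lemma schwartz_lipschitz:
  assumes "\<phi> \<in> schwartz n"
  obtains L where "L \<ge> 0"
    "\<And>x y. x \<in> points n \<Longrightarrow> y \<in> points n \<Longrightarrow> cmod (\<phi> x - \<phi> y) \<le> L * (\<Sum>i<n. \<bar>x i - y i\<bar>)"
proof -
  have "\<forall>i\<in>{..<n}. \<exists>M. \<forall>x\<in>points n. cmod (partial_deriv i \<phi> x) \<le> M"
    using schwartz_bounded[OF schwartz_partial_deriv[OF assms], of _ 0] by (metis lessThan_iff mult_1 power_0)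
  then obtain M where M: "\<And>i x. i < n \<Longrightarrow> x \<in> points n \<Longrightarrow> cmod (partial_deriv i \<phi> x) \<le> M i"
    by (metis lessThan_iff)
  define L where "L = (\<Sum>i<n. \<bar>M i\<bar>)"
  have M_le: "M i \<le> L" if "i < n" for i
    using member_le_sum[of i "{..<n}" "\<lambda>i. \<bar>M i\<bar>"] that unfolding L_def by auto
  have stp: "cmod (\<phi> (x(i := s)) - \<phi> (x(i := t))) \<le> L * \<bar>s - t\<bar>"
    if "x \<in> points n" "i < n" for x i s t
  proof -
    have "norm (\<phi> (x(i := s)) - \<phi> (x(i := t))) \<le> L * norm (s - t)"
    proof (rule differentiable_bound[of UNIV "\<lambda>s. \<phi> (x(i := s))" "\<lambda>u r. r *\<^sub>R partial_deriv i \<phi> (x(i := u))"])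
      fix u :: real
      show "((\<lambda>s. \<phi> (x(i := s))) has_derivative (\<lambda>r. r *\<^sub>R partial_deriv i \<phi> (x(i := u)))) (at u within UNIV)"
        using has_partialD[OF schwartz_has_partial[OF assms that(2)] that]
        by (simp add: has_vector_derivative_def)
      have "norm (partial_deriv i \<phi> (x(i := u))) \<le> L"
        using M[OF that(2) points_upd[OF that]] M_le[OF that(2)] by (rule order_trans)
      then show "onorm (\<lambda>r. r *\<^sub>R partial_deriv i \<phi> (x(i := u))) \<le> L"
        by (intro onorm_le) (simp add: mult.commute[of L] mult_left_mono)
    qed auto
    then show ?thesis by simp
  qed
  have tele: "cmod (\<phi> x - \<phi> (\<lambda>i. if i < m then y i else x i)) \<le> L * (\<Sum>i<m. \<bar>x i - y i\<bar>)"
    if "x \<in> points n" "y \<in> points n" "m \<le> n" for x y m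
    using that(3)
  proof (induction m)
    case 0 then show ?case by simp
  next
    case (Suc m)
    let ?z = "\<lambda>i. if i < m then y i else x i"
    have z: "?z \<in> points n" using that Suc.prems by (auto simp: space_PiM PiE_def extensional_def)
    have "cmod (\<phi> (?z(m := x m)) - \<phi> (?z(m := y m))) \<le> L * \<bar>x m - y m\<bar>"
      by (rule stp[OF z]) (use Suc.prems in auto)
    moreover have "?z(m := x m) = ?z" by auto
    moreover have "?z(m := y m) = (\<lambda>i. if i < Suc m then y i else x i)" by (auto simp: less_Suc_eq)
    ultimately have "cmod (\<phi> ?z - \<phi> (\<lambda>i. if i < Suc m then y i else x i)) \<le> L * \<bar>x m - y m\<bar>" by simp
    with Suc show ?case
      using norm_triangle_ineq[of "\<phi> x - \<phi> ?z" "\<phi> ?z - \<phi> (\<lambda>i. if i < Suc m then y i else x i)"]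
      by (simp add: algebra_simps)
  qed
  show thesis
  proof (rule that[of L])
    show "L \<ge> 0" by (simp add: L_def sum_nonneg)
    fix x y assume xy: "x \<in> points n" "y \<in> points n"
    have "(\<lambda>i. if i < n then y i else x i) = y" using xy by (auto simp: space_PiM PiE_def extensional_def)
    then show "cmod (\<phi> x - \<phi> y) \<le> L * (\<Sum>i<n. \<bar>x i - y i\<bar>)" using tele[OF xy, of n] by simp
  qed
qed

lemma schwartz_measurable [measurable_dest]:
  assumes "\<phi> \<in> schwartz n"
  shows "\<phi> \<in> borel_measurable (lborel_n n)"
proof -
  obtain L where L: "L \<ge> 0"
    "\<And>x y. x \<in> points n \<Longrightarrow> y \<in> points n \<Longrightarrow> cmod (\<phi> x - \<phi> y) \<le> L * (\<Sum>i<n. \<bar>x i - y i\<bar>)"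
    using schwartz_lipschitz[OF assms] by blast
  \<comment> \<open>Restriction sends every sequence into \<open>points n\<close>, so
    \<open>\<phi>\<close> composed with \<open>r\<close> is continuous on all of
    \<open>nat \<Rightarrow> real\<close>, whose Borel sets form the product sigma-algebra.\<close>
  define r where "r x = (restrict x {..<n} :: nat \<Rightarrow> real)" for x
  have r: "r x \<in> points n" for x by (auto simp: r_def space_PiM)
  have "continuous_on UNIV (\<lambda>x. \<phi> (r x))"
    unfolding continuous_on_def
  proof
    fix x :: "nat \<Rightarrow> real"
    have "((\<lambda>y. L * (\<Sum>i<n. \<bar>y i - x i\<bar>)) \<longlongrightarrow> L * (\<Sum>i<n. \<bar>x i - x i\<bar>)) (at x within UNIV)"
      by (intro tendsto_intros) (auto intro: tendsto_within_subset
        continuous_on_product_coordinates[unfolded continuous_on_def, rule_format])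
    then have lim: "((\<lambda>y. L * (\<Sum>i<n. \<bar>y i - x i\<bar>)) \<longlongrightarrow> 0) (at x within UNIV)" by simp
    have bd: "norm (\<phi> (r y) - \<phi> (r x)) \<le> L * (\<Sum>i<n. \<bar>y i - x i\<bar>)" for y
      using L(2)[OF r r, of y x] by (simp add: r_def)
    have "((\<lambda>y. \<phi> (r y) - \<phi> (r x)) \<longlongrightarrow> 0) (at x within UNIV)"
      by (rule Lim_null_comparison[OF always_eventually[rule_format] lim]) (rule bd)
    then show "((\<lambda>y. \<phi> (r y)) \<longlongrightarrow> \<phi> (r x)) (at x within UNIV)"
      by (simp add: LIM_zero_iff)
  qed
  then have "(\<lambda>x. \<phi> (r x)) \<in> borel_measurable (borel :: (nat \<Rightarrow> real) measure)"
    by (rule borel_measurable_continuous_onI)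
  then have m: "(\<lambda>x. \<phi> (r x)) \<in> borel_measurable (Pi\<^sub>M UNIV (\<lambda>_::nat. borel :: real measure))"
    by (simp cong: measurable_cong_sets add: sets_PiM_equal_borel)
  \<comment> \<open>Padding with the constant \<open>undefined\<close> embeds
    \<open>points n\<close> measurably into the full product, and \<open>r\<close> undoes
    it.\<close>
  have "(\<lambda>x i. if i < n then x i else undefined) \<in> measurable (lborel_n n) (Pi\<^sub>M UNIV (\<lambda>_::nat. borel :: real measure))"
  proof (rule measurable_PiM_single')
    fix i
    show "(\<lambda>x. if i < n then x i else undefined) \<in> borel_measurable (lborel_n n)"
      by (cases "i < n") auto
  qed auto
  from measurable_compose[OF this m]
  have "(\<lambda>x. \<phi> (r (\<lambda>i. if i < n then x i else undefined))) \<in> borel_measurable (lborel_n n)" .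
  moreover have "r (\<lambda>i. if i < n then x i else undefined) = x" if "x \<in> points n" for x
    using that by (auto simp: r_def space_PiM PiE_def extensional_def)
  ultimately show ?thesis by (simp cong: measurable_cong)
qed

section \<open>Integrability through a product weight\<close>

interpretation lbp: product_sigma_finite "\<lambda>_::nat. lborel :: real measure"
  by standard

lemma sigma_finite_lborel_n: "sigma_finite_measure (lborel_n n)"
proof -
  interpret finite_product_sigma_finite "\<lambda>_::nat. lborel :: real measure" "{..<n}"
    by standard auto
  show ?thesis by (rule sigma_finite_measure_axioms)
qed

lemma integrable_inverse_1_square: "integrable lborel (\<lambda>x::real. inverse (1 + x\<^sup>2))"
proof -
  have "einterval (-\<infinity>) \<infinity> = UNIV" by (auto simp: einterval_def)
  then show ?thesis using integrable_inverse_1_plus_square by (simp add: set_integrable_def)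
qed

text \<open>A tensor product in place of a radial weight: its integral over the product measure
  factors into integrals on the line.\<close>

definition weight :: "nat \<Rightarrow> (nat \<Rightarrow> real) \<Rightarrow> real" where
  "weight n x = (\<Prod>i<n. inverse (1 + (x i)\<^sup>2))"

lemma weight_pos: "weight n x > 0"
  unfolding weight_def by (intro prod_pos) (simp add: add_pos_nonneg)

lemma integrable_weight: "integrable (lborel_n n) (weight n)"
  unfolding weight_def [abs_def]
  by (intro lbp.product_integrable_prod integrable_inverse_1_square) auto

text \<open>Each factor satisfies 1 + x_i^2 \<le> (1 + |x|)^2, whence the exponent 2n: that many
  orders of decay buy integrability.\<close>

lemma weight_ge: "1 \<le> (1 + L2_set x {..<n}) ^ (2 * n) * weight n x"
proof -
  have "(\<Prod>i<n. 1 + (x i)\<^sup>2) \<le> (\<Prod>i<n. (1 + L2_set x {..<n})\<^sup>2)"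
  proof (rule prod_mono, safe)
    fix i assume "i < n"
    then have "\<bar>x i\<bar>\<^sup>2 \<le> (L2_set x {..<n})\<^sup>2" by (intro power_mono abs_coord_le_L2_set) auto
    then have "(x i)\<^sup>2 \<le> (L2_set x {..<n})\<^sup>2" by (simp only: power2_abs)
    moreover have "(1 + L2_set x {..<n})\<^sup>2 = 1 + (L2_set x {..<n})\<^sup>2 + 2 * L2_set x {..<n}"
      by (simp add: power2_sum)
    ultimately show "1 + (x i)\<^sup>2 \<le> (1 + L2_set x {..<n})\<^sup>2"
      using L2_set_nonneg[of x "{..<n}"] by linarith
  qed simp
  also have "\<dots> = (1 + L2_set x {..<n}) ^ (2 * n)" by (simp add: power_mult)
  finally have "(\<Prod>i<n. 1 + (x i)\<^sup>2) * weight n x \<le> (1 + L2_set x {..<n}) ^ (2 * n) * weight n x"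
    using weight_pos[of n x] by (intro mult_right_mono) auto
  moreover have "(\<Prod>i<n. 1 + (x i)\<^sup>2) * weight n x = 1"
    unfolding weight_def prod.distrib[symmetric]
    by (intro prod.neutral ballI right_inverse) (metis add.commute add_nonneg_eq_0_iff zero_le_one zero_le_power2 zero_neq_one)
  ultimately show ?thesis by simp
qed

lemma rapidly_decreasing_weight:
  assumes "rapidly_decreasing n f"
  obtains M where "M \<ge> 0" "\<And>x. x \<in> points n \<Longrightarrow> cmod (f x) \<le> M * weight n x"
proof -
  obtain M where M: "\<forall>x\<in>points n. (1 + L2_set x {..<n}) ^ (2 * n) * cmod (f x) \<le> M"
    using assms unfolding rapidly_decreasing_def by meson
  have "cmod (f x) \<le> \<bar>M\<bar> * weight n x" if "x \<in> points n" for x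
  proof -
    have "cmod (f x) * 1 \<le> cmod (f x) * ((1 + L2_set x {..<n}) ^ (2 * n) * weight n x)"
      by (intro mult_left_mono weight_ge) auto
    also have "\<dots> = ((1 + L2_set x {..<n}) ^ (2 * n) * cmod (f x)) * weight n x" by simp
    also have "\<dots> \<le> \<bar>M\<bar> * weight n x"
      using M that weight_pos[of n x] by (intro mult_right_mono) force+
    finally show ?thesis by simp
  qed
  then show thesis by (intro that[of "\<bar>M\<bar>"]) auto
qed

lemma schwartz_integrable:
  assumes "\<phi> \<in> schwartz n"
  shows "integrable (lborel_n n) \<phi>"
proof -
  obtain M where M: "\<And>x. x \<in> points n \<Longrightarrow> cmod (\<phi> x) \<le> M * weight n x" "M \<ge> 0"
    using rapidly_decreasing_weight[OF schwartz_decreasing[OF assms]] by metis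
  show ?thesis
  proof (rule Bochner_Integration.integrable_bound)
    show "integrable (lborel_n n) (\<lambda>x. M * weight n x)" using integrable_weight by simp
    show "\<phi> \<in> borel_measurable (lborel_n n)" using assms by (rule schwartz_measurable)
    show "AE x in lborel_n n. norm (\<phi> x) \<le> norm (M * weight n x)"
      using M by (intro AE_I2) (simp add: abs_mult weight_pos less_imp_le)
  qed
qed

lemma schwartz_integrable_square:
  assumes "\<phi> \<in> schwartz n"
  shows "integrable (lborel_n n) (\<lambda>x. (cmod (\<phi> x))\<^sup>2)"
proof -
  obtain B where B: "\<And>x. x \<in> points n \<Longrightarrow> cmod (\<phi> x) \<le> B" "B \<ge> 0"
    using schwartz_bounded[OF assms, of 0] by (metis mult_1 power_0)
  show ?thesis
  proof (rule Bochner_Integration.integrable_bound)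
    show "integrable (lborel_n n) (\<lambda>x. B * cmod (\<phi> x))" using schwartz_integrable[OF assms] by simp
    show "(\<lambda>x. (cmod (\<phi> x))\<^sup>2) \<in> borel_measurable (lborel_n n)"
      using schwartz_measurable[OF assms] by measurable
    show "AE x in lborel_n n. norm ((cmod (\<phi> x))\<^sup>2) \<le> norm (B * cmod (\<phi> x))"
      using B by (intro AE_I2) (auto simp: power2_eq_square abs_mult intro!: mult_right_mono)
  qed
qed

section \<open>The Fourier transform on Schwartz functions\<close>

text \<open>The mean value inequality bounds difference quotients by \<open>w\<close>, hence the
  remainders \<open>q\<close> by \<open>2 * w\<close>, and dominated convergence applies along
  sequences. The convex set is \<open>UNIV\<close> for smoothness of the transform and
  \<open>{0..}\<close> for the time derivative, one-sided at 0.\<close>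

lemma has_vector_derivative_integral:
  fixes f f' :: "real \<Rightarrow> 'a \<Rightarrow> complex"
  assumes S: "convex S" "t \<in> S"
    and int: "\<And>s. s \<in> S \<Longrightarrow> integrable M (f s)"
    and der: "\<And>s x. s \<in> S \<Longrightarrow> x \<in> space M \<Longrightarrow>
      ((\<lambda>s. f s x) has_vector_derivative f' s x) (at s within S)"
    and bd: "\<And>s x. s \<in> S \<Longrightarrow> x \<in> space M \<Longrightarrow> norm (f' s x) \<le> w x"
    and w: "integrable M w"
    and meas: "f' t \<in> borel_measurable M"
  shows "((\<lambda>s. \<integral>x. f s x \<partial>M) has_vector_derivative (\<integral>x. f' t x \<partial>M)) (at t within S)"
proof -
  define q where "q s x = (f s x - f t x - (s - t) *\<^sub>R f' t x) /\<^sub>R norm (s - t)" for s x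
  have int': "integrable M (f' t)"
    by (rule Bochner_Integration.integrable_bound[OF w meas]) (use bd[OF S(2)] in force)
  have lip: "norm (f s x - f t x) \<le> w x * norm (s - t)" if "s \<in> S" "x \<in> space M" for s x
  proof (rule differentiable_bound[OF S(1), of "\<lambda>s. f s x" "\<lambda>u r. r *\<^sub>R f' u x"])
    fix u assume u: "u \<in> S"
    show "((\<lambda>s. f s x) has_derivative (\<lambda>r. r *\<^sub>R f' u x)) (at u within S)"
      using der[OF u that(2)] by (simp add: has_vector_derivative_def)
    show "onorm (\<lambda>r. r *\<^sub>R f' u x) \<le> w x"
      using bd[OF u that(2)] by (intro onorm_le) (simp add: mult.commute[of "w x"] mult_left_mono)
  qed (use that S in auto)
  have qbd: "norm (q s x) \<le> 2 * w x" if "s \<in> S - {t}" "x \<in> space M" for s x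
  proof -
    have "norm (f s x - f t x - (s - t) *\<^sub>R f' t x) \<le> norm (f s x - f t x) + norm ((s - t) *\<^sub>R f' t x)"
      by (rule norm_triangle_ineq4)
    also have "\<dots> \<le> w x * norm (s - t) + norm (s - t) * w x"
      using lip[of s x] bd[OF S(2) that(2)] that by (intro add_mono) (auto intro: mult_left_mono)
    finally have "norm (f s x - f t x - (s - t) *\<^sub>R f' t x) \<le> norm (s - t) * (2 * w x)"
      by (simp add: algebra_simps)
    moreover have "0 < norm (s - t)" using that by simp
    ultimately show ?thesis by (simp add: q_def divide_inverse_commute[symmetric] pos_divide_le_eq mult.commute)
  qed
  have "((\<lambda>s. ((\<integral>x. f s x \<partial>M) - (\<integral>x. f t x \<partial>M) - (s - t) *\<^sub>R (\<integral>x. f' t x \<partial>M)) /\<^sub>R norm (s - t))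
      \<longlongrightarrow> 0) (at t within S)"
    unfolding tendsto_at_iff_sequentially
  proof (intro allI impI)
    fix X assume X: "\<forall>i. X i \<in> S - {t}" "X \<longlonglongrightarrow> t"
    have "(\<lambda>i. \<integral>x. q (X i) x \<partial>M) \<longlonglongrightarrow> (\<integral>x. 0 \<partial>M)"
    proof (rule integral_dominated_convergence)
      show "integrable M (\<lambda>x. 2 * w x)" using w by simp
      show "AE x in M. norm (q (X i) x) \<le> 2 * w x" for i using qbd X by (intro AE_I2) auto
      show "q (X i) \<in> borel_measurable M" for i
        using int[of "X i"] int[OF S(2)] meas X unfolding q_def [abs_def] by auto
      show "AE x in M. (\<lambda>i. q (X i) x) \<longlonglongrightarrow> 0"
      proof (rule AE_I2)
        fix x assume "x \<in> space M"
        then have "((\<lambda>s. q s x) \<longlongrightarrow> 0) (at t within S)"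
          using der[OF S(2), of x] unfolding has_vector_derivative_def has_derivative_at_within q_def
          by blast
        then show "(\<lambda>i. q (X i) x) \<longlonglongrightarrow> 0"
          using X unfolding tendsto_at_iff_sequentially comp_def by blast
      qed
    qed simp
    moreover have "(\<integral>x. q (X i) x \<partial>M) = ((\<integral>x. f (X i) x \<partial>M) - (\<integral>x. f t x \<partial>M)
        - (X i - t) *\<^sub>R (\<integral>x. f' t x \<partial>M)) /\<^sub>R norm (X i - t)" for i
    proof -
      have "integrable M (f (X i))" using X int by auto
      then show ?thesis unfolding q_def using int[OF S(2)] int' by simp
    qed
    ultimately show "((\<lambda>s. ((\<integral>x. f s x \<partial>M) - (\<integral>x. f t x \<partial>M)
        - (s - t) *\<^sub>R (\<integral>x. f' t x \<partial>M)) /\<^sub>R norm (s - t)) \<circ> X) \<longlonglongrightarrow> 0"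
      by (simp add: comp_def)
  qed
  then show ?thesis
    unfolding has_vector_derivative_def has_derivative_at_within
    by (simp add: bounded_linear_scaleR_left)
qed

text \<open>The sign \<open>s\<close> selects the Fourier transform (\<open>s = - 1\<close>) or its inverse (\<open>s = 1\<close>).\<close>

definition FT :: "real \<Rightarrow> nat \<Rightarrow> cfun \<Rightarrow> cfun" where
  "FT s n \<phi> \<xi> = of_real ((2 * pi) powr (- real n / 2)) *
     (\<integral>x. cis (s * dot n x \<xi>) * \<phi> x \<partial>lborel_n n)"

lemma fourier_eq_FT: "fourier n = FT (- 1) n"
  by (simp add: fun_eq_iff fourier_def FT_def dot_def)

lemma dot_measurable [measurable]: "(\<lambda>x. dot n x y) \<in> borel_measurable (lborel_n n)"
  unfolding dot_def by measurable

lemma cis_eq_exp_i: "cis = (\<lambda>t. exp (\<i> * of_real t))"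
  by (simp add: fun_eq_iff cis_conv_exp)

lemma cis_measurable [measurable]: "cis \<in> borel_measurable borel"
  unfolding cis_eq_exp_i by (intro borel_measurable_continuous_onI continuous_intros)

lemma integrable_cis_mult:
  assumes "integrable (lborel_n n) \<phi>"
  shows "integrable (lborel_n n) (\<lambda>x. cis (s * dot n x \<xi>) * \<phi> x)"
  by (rule Bochner_Integration.integrable_bound[OF assms]) (use assms in \<open>auto simp: norm_mult\<close>)

section \<open>Rules linking the transform with derivatives, coordinates and decay\<close>

lemma FT_linear:
  assumes "\<phi> \<in> schwartz n" "\<psi> \<in> schwartz n"
  shows "FT s n (\<lambda>x. a * \<phi> x + c * \<psi> x) \<xi> = a * FT s n \<phi> \<xi> + c * FT s n \<psi> \<xi>"
proof -
  have "(\<integral>x. cis (s * dot n x \<xi>) * (a * \<phi> x + c * \<psi> x) \<partial>lborel_n n) =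
    (\<integral>x. a * (cis (s * dot n x \<xi>) * \<phi> x) + c * (cis (s * dot n x \<xi>) * \<psi> x) \<partial>lborel_n n)"
    by (simp add: algebra_simps)
  also have "\<dots> = a * (\<integral>x. cis (s * dot n x \<xi>) * \<phi> x \<partial>lborel_n n)
      + c * (\<integral>x. cis (s * dot n x \<xi>) * \<psi> x \<partial>lborel_n n)"
    using integrable_cis_mult[OF schwartz_integrable[OF assms(1)]]
      integrable_cis_mult[OF schwartz_integrable[OF assms(2)]] by simp
  finally show ?thesis by (simp add: FT_def algebra_simps)
qed

lemma FT_cnj: "FT s n (\<lambda>x. cnj (\<phi> x)) \<xi> = cnj (FT (- s) n \<phi> \<xi>)"
proof -
  have "(\<integral>x. cis (s * dot n x \<xi>) * cnj (\<phi> x) \<partial>lborel_n n) =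
    (\<integral>x. cnj (cis (- s * dot n x \<xi>) * \<phi> x) \<partial>lborel_n n)"
    by (simp add: cis_cnj)
  also have "\<dots> = cnj (\<integral>x. cis (- s * dot n x \<xi>) * \<phi> x \<partial>lborel_n n)" by (rule Bochner_Integration.integral_cnj)
  finally show ?thesis by (simp add: FT_def)
qed

lemma has_partial_FT:
  assumes \<phi>: "\<phi> \<in> schwartz n" and i: "i < n"
  shows "has_partial n i (FT s n \<phi>) (FT s n (\<lambda>x. \<i> * of_real s * (of_real (x i) * \<phi> x)))"
  unfolding has_partial_def
proof
  fix \<xi> assume \<xi>: "\<xi> \<in> points n"
  let ?f = "\<lambda>r x. cis (s * dot n x (\<xi>(i := r))) * \<phi> x"
  let ?f' = "\<lambda>r x. \<i> * of_real (s * x i) * cis (s * dot n x (\<xi>(i := r))) * \<phi> x"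
  have x\<phi>: "integrable (lborel_n n) (\<lambda>x. of_real (x i) * \<phi> x)"
    by (rule schwartz_integrable[OF schwartz_coord[OF \<phi> i]])
  have "((\<lambda>r. \<integral>x. ?f r x \<partial>lborel_n n) has_vector_derivative (\<integral>x. ?f' (\<xi> i) x \<partial>lborel_n n)) (at (\<xi> i) within UNIV)"
  proof (rule has_vector_derivative_integral[where w = "\<lambda>x. \<bar>s\<bar> * cmod (of_real (x i) * \<phi> x)"])
    show "integrable (lborel_n n) (?f r)" for r
      by (rule integrable_cis_mult[OF schwartz_integrable[OF \<phi>]])
    show "((\<lambda>r. ?f r x) has_vector_derivative ?f' r x) (at r within UNIV)" for r x
      using has_partialD[OF has_partial_cis[OF i, of s x] \<xi> i, of r]
      by (auto intro!: derivative_eq_intros simp: dot_commute[of n x])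
    show "norm (?f' r x) \<le> \<bar>s\<bar> * cmod (of_real (x i) * \<phi> x)" for r x
      by (simp add: norm_mult abs_mult)
    show "integrable (lborel_n n) (\<lambda>x. \<bar>s\<bar> * cmod (of_real (x i) * \<phi> x))" using x\<phi> by simp
    show "?f' (\<xi> i) \<in> borel_measurable (lborel_n n)"
    proof -
      have "(\<lambda>x. \<i> * of_real s * (cis (s * dot n x \<xi>) * (of_real (x i) * \<phi> x))) \<in> borel_measurable (lborel_n n)"
        by (rule borel_measurable_times[OF borel_measurable_const
            borel_measurable_integrable[OF integrable_cis_mult[OF x\<phi>]]])
      then show ?thesis by (simp add: mult_ac)
    qed
  qed auto
  moreover have "(\<integral>x. ?f' (\<xi> i) x \<partial>lborel_n n)
      = (\<integral>x. cis (s * dot n x \<xi>) * (\<i> * of_real s * (of_real (x i) * \<phi> x)) \<partial>lborel_n n)"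
    by (simp add: mult_ac)
  ultimately show "((\<lambda>r. FT s n \<phi> (\<xi>(i := r))) has_vector_derivative
      FT s n (\<lambda>x. \<i> * of_real s * (of_real (x i) * \<phi> x)) \<xi>) (at (\<xi> i))"
    unfolding FT_def by (auto intro!: derivative_eq_intros)
qed

lemma tendsto_zero_of_decay:
  fixes F :: "real \<Rightarrow> complex"
  assumes "\<And>y. (1 + \<bar>y\<bar>) * cmod (F y) \<le> M"
  shows "(F \<longlongrightarrow> 0) at_top" "(F \<longlongrightarrow> 0) at_bot"
proof -
  have bd: "norm (F y) \<le> M / (1 + \<bar>y\<bar>)" for y
    using assms[of y] by (simp add: field_simps add_pos_nonneg)
  have "((\<lambda>y::real. M / (1 + \<bar>y\<bar>)) \<longlongrightarrow> 0) at_top" by real_asymp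
  from Lim_null_comparison[OF always_eventually[rule_format] this] bd
  show "(F \<longlongrightarrow> 0) at_top" by blast
  have "((\<lambda>y::real. M / (1 + \<bar>y\<bar>)) \<longlongrightarrow> 0) at_bot" by real_asymp
  from Lim_null_comparison[OF always_eventually[rule_format] this] bd
  show "(F \<longlongrightarrow> 0) at_bot" by blast
qed

text \<open>Fubini with the i-th coordinate integrated first: the inner integral is a difference of
  boundary values at plus and minus infinity, which vanish by decay.\<close>

lemma integral_partial_deriv_eq_0:
  assumes \<phi>: "\<phi> \<in> schwartz n" and i: "i < n"
  shows "(\<integral>x. partial_deriv i \<phi> x \<partial>lborel_n n) = 0"
proof -
  let ?I = "{..<n} - {i}"
  let ?D = "partial_deriv i \<phi>"
  have D: "?D \<in> schwartz n" by (rule schwartz_partial_deriv[OF \<phi> i])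
  have I: "insert i ?I = {..<n}" using i by auto
  have "(\<integral>x. ?D x \<partial>Pi\<^sub>M (insert i ?I) (\<lambda>_. lborel)) =
      (\<integral>x. (\<integral>y. ?D (x(i := y)) \<partial>lborel) \<partial>Pi\<^sub>M ?I (\<lambda>_. lborel))"
    by (rule lbp.product_integral_insert) (use schwartz_integrable[OF D] in \<open>simp_all only: I, auto\<close>)
  also have "\<dots> = (\<integral>x. 0 \<partial>Pi\<^sub>M ?I (\<lambda>_. lborel :: real measure))"
  proof (rule Bochner_Integration.integral_cong[OF refl])
    fix x :: "nat \<Rightarrow> real" assume x: "x \<in> space (Pi\<^sub>M ?I (\<lambda>_. lborel :: real measure))"
    \<comment> \<open>Points of the product over \<open>{..<n} - {i}\<close> are
      \<open>undefined\<close> at \<open>i\<close>; the value 0 there gives an element of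
      \<open>points n\<close> on the same coordinate line.\<close>
    define p where "p = x(i := 0)"
    have p: "p \<in> points n" using x i by (auto simp: p_def space_PiM PiE_def extensional_def)
    have eq: "x(i := y) = p(i := y)" for y by (simp add: p_def)
    have der: "((\<lambda>s. \<phi> (p(i := s))) has_vector_derivative ?D (p(i := y))) (at y)" for y
      by (rule has_partialD[OF schwartz_has_partial[OF \<phi> i] p i])
    have cont: "isCont (\<lambda>s. ?D (p(i := s))) y" for y
      using has_partialD[OF schwartz_has_partial[OF D i] p i] has_vector_derivative_continuous by blast
    have yi: "\<bar>y\<bar> \<le> L2_set (p(i := y)) {..<n}" for y
      using abs_coord_le_L2_set[OF i, of "p(i := y)"] by simp
    obtain M where M: "\<And>x. x \<in> points n \<Longrightarrow> (1 + L2_set x {..<n}) ^ 2 * cmod (?D x) \<le> M" "M \<ge> 0"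
      using schwartz_bounded[OF D, of 2] by metis
    have M': "cmod (?D (p(i := y))) \<le> M * inverse (1 + y\<^sup>2)" for y
    proof -
      have "1 + y\<^sup>2 \<le> (1 + \<bar>y\<bar>)\<^sup>2" by (simp add: power2_sum)
      also have "\<dots> \<le> (1 + L2_set (p(i := y)) {..<n})\<^sup>2" using yi[of y] by (intro power_mono) auto
      finally have "(1 + y\<^sup>2) * cmod (?D (p(i := y))) \<le> (1 + L2_set (p(i := y)) {..<n})\<^sup>2 * cmod (?D (p(i := y)))"
        by (rule mult_right_mono) simp
      also have "\<dots> \<le> M" by (rule M(1)[OF points_upd[OF p i]])
      finally show ?thesis by (simp add: field_simps add_pos_nonneg)
    qed
    have int: "integrable lborel (\<lambda>y. ?D (p(i := y)))"
    proof (rule Bochner_Integration.integrable_bound)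
      show "integrable lborel (\<lambda>y. M * inverse (1 + y\<^sup>2))" using integrable_inverse_1_square by simp
      show "(\<lambda>y. ?D (p(i := y))) \<in> borel_measurable lborel"
        using cont by (simp add: borel_measurable_continuous_onI continuous_at_imp_continuous_on)
      show "AE y in lborel. norm (?D (p(i := y))) \<le> norm (M * inverse (1 + y\<^sup>2))"
        using M' M(2) by (auto simp: abs_mult)
    qed
    obtain N where N: "\<And>x. x \<in> points n \<Longrightarrow> (1 + L2_set x {..<n}) ^ 1 * cmod (\<phi> x) \<le> N" "N \<ge> 0"
      using schwartz_bounded[OF \<phi>, of 1] by metis
    have N': "(1 + \<bar>y\<bar>) * cmod (\<phi> (p(i := y))) \<le> N" for y
    proof -
      have "(1 + \<bar>y\<bar>) * cmod (\<phi> (p(i := y))) \<le> (1 + L2_set (p(i := y)) {..<n}) * cmod (\<phi> (p(i := y)))"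
        using yi[of y] by (intro mult_right_mono) auto
      also have "\<dots> \<le> N" using N(1)[OF points_upd[OF p i]] by simp
      finally show ?thesis .
    qed
    have "(LBINT y=-\<infinity>..\<infinity>. ?D (p(i := y))) = 0 - 0"
    proof (rule interval_integral_FTC_integrable)
      show "(((\<lambda>s. \<phi> (p(i := s))) \<circ> real_of_ereal) \<longlongrightarrow> 0) (at_right (- \<infinity>))"
        "(((\<lambda>s. \<phi> (p(i := s))) \<circ> real_of_ereal) \<longlongrightarrow> 0) (at_left \<infinity>)"
        unfolding ereal_tendsto_simps using tendsto_zero_of_decay[OF N'] by auto
    qed (use der cont int in \<open>auto simp: set_integrable_def\<close>)
    then show "(\<integral>y. ?D (x(i := y)) \<partial>lborel) = 0"
      by (simp add: eq interval_lebesgue_integral_def set_lebesgue_integral_def)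
  qed
  finally show ?thesis unfolding I by simp
qed

text \<open>Integration by parts without boundary terms: the derivative of the product of the plane
  wave and \<open>\<phi>\<close> has integral zero.\<close>

lemma FT_partial_deriv:
  assumes \<phi>: "\<phi> \<in> schwartz n" and i: "i < n"
  shows "FT s n (partial_deriv i \<phi>) \<xi> = - (\<i> * of_real (s * \<xi> i) * FT s n \<phi> \<xi>)"
proof -
  let ?e = "\<lambda>x. cis (s * dot n x \<xi>)"
  let ?D = "partial_deriv i \<phi>"
  have "has_partial n i (\<lambda>x. ?e x * \<phi> x) (\<lambda>x. ?e x * ?D x + (\<i> * of_real (s * \<xi> i) * ?e x) * \<phi> x)"
    by (intro has_partial_mult has_partial_cis schwartz_has_partial \<phi> i)
  from partial_deriv_eq[OF this]
  have "(\<integral>x. ?e x * ?D x + (\<i> * of_real (s * \<xi> i) * ?e x) * \<phi> x \<partial>lborel_n n)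
      = (\<integral>x. partial_deriv i (\<lambda>x. ?e x * \<phi> x) x \<partial>lborel_n n)"
    by (intro Bochner_Integration.integral_cong) auto
  also have "\<dots> = 0" by (intro integral_partial_deriv_eq_0 schwartz_cis \<phi> i)
  finally have "(\<integral>x. ?e x * ?D x + (\<i> * of_real (s * \<xi> i)) * (?e x * \<phi> x) \<partial>lborel_n n) = 0"
    by (simp add: mult_ac)
  moreover have "(\<integral>x. ?e x * ?D x + (\<i> * of_real (s * \<xi> i)) * (?e x * \<phi> x) \<partial>lborel_n n)
    = (\<integral>x. ?e x * ?D x \<partial>lborel_n n) + (\<i> * of_real (s * \<xi> i)) * (\<integral>x. ?e x * \<phi> x \<partial>lborel_n n)"
    using integrable_cis_mult[OF schwartz_integrable[OF \<phi>]]
      integrable_cis_mult[OF schwartz_integrable[OF schwartz_partial_deriv[OF \<phi> i]]] by simp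
  ultimately have "(\<integral>x. ?e x * ?D x \<partial>lborel_n n) = - ((\<i> * of_real (s * \<xi> i)) * (\<integral>x. ?e x * \<phi> x \<partial>lborel_n n))"
    by (simp add: eq_neg_iff_add_eq_0)
  then show ?thesis by (simp add: FT_def mult_ac)
qed

text \<open>The weight is a sum of |\<xi>_i| because one more factor of it splits into coordinates,
  and |\<xi>_i| times the modulus of the transform is the modulus for the i-th derivative. Each
  order of decay costs one derivative, so the induction runs over all Schwartz functions at
  once.\<close>

lemma FT_bounded:
  assumes "\<phi> \<in> schwartz n" and s: "\<bar>s\<bar> = 1"
  shows "\<exists>M. \<forall>\<xi>. (1 + (\<Sum>i<n. \<bar>\<xi> i\<bar>)) ^ k * cmod (FT s n \<phi> \<xi>) \<le> M"
  using assms(1)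
proof (induction k arbitrary: \<phi>)
  case 0
  let ?c = "(2 * pi) powr (- real n / 2)"
  have "cmod (FT s n \<phi> \<xi>) \<le> ?c * (\<integral>x. cmod (\<phi> x) \<partial>lborel_n n)" for \<xi>
  proof -
    have "cmod (\<integral>x. cis (s * dot n x \<xi>) * \<phi> x \<partial>lborel_n n) \<le> (\<integral>x. cmod (cis (s * dot n x \<xi>) * \<phi> x) \<partial>lborel_n n)"
      by (rule integral_norm_bound)
    then show ?thesis by (simp add: FT_def norm_mult mult_left_mono)
  qed
  then show ?case by auto
next
  case (Suc k)
  let ?w = "\<lambda>\<xi>. 1 + (\<Sum>i<n. \<bar>\<xi> i\<bar>)"
  obtain M where M: "\<And>\<xi>. ?w \<xi> ^ k * cmod (FT s n \<phi> \<xi>) \<le> M" using Suc by blast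
  have "\<forall>i\<in>{..<n}. \<exists>M. \<forall>\<xi>. ?w \<xi> ^ k * cmod (FT s n (partial_deriv i \<phi>) \<xi>) \<le> M"
    using Suc schwartz_partial_deriv by blast
  then obtain N where N: "\<And>i \<xi>. i < n \<Longrightarrow> ?w \<xi> ^ k * cmod (FT s n (partial_deriv i \<phi>) \<xi>) \<le> N i"
    by (metis lessThan_iff)
  have "?w \<xi> ^ Suc k * cmod (FT s n \<phi> \<xi>) \<le> M + (\<Sum>i<n. N i)" for \<xi>
  proof -
    have "?w \<xi> ^ Suc k * cmod (FT s n \<phi> \<xi>) = ?w \<xi> ^ k * cmod (FT s n \<phi> \<xi>)
        + (\<Sum>i<n. ?w \<xi> ^ k * (\<bar>\<xi> i\<bar> * cmod (FT s n \<phi> \<xi>)))"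
      by (simp add: algebra_simps sum_distrib_left sum_distrib_right)
    also have "(\<Sum>i<n. ?w \<xi> ^ k * (\<bar>\<xi> i\<bar> * cmod (FT s n \<phi> \<xi>)))
        = (\<Sum>i<n. ?w \<xi> ^ k * cmod (FT s n (partial_deriv i \<phi>) \<xi>))"
      using s by (intro sum.cong refl) (simp add: FT_partial_deriv[OF Suc.prems] norm_mult abs_mult)
    also have "\<dots> \<le> (\<Sum>i<n. N i)" by (intro sum_mono N) auto
    finally show ?thesis using M[of \<xi>] by linarith
  qed
  then show ?case by blast
qed

lemma FT_schwartz:
  assumes "\<phi> \<in> schwartz n" and s: "\<bar>s\<bar> = 1"
  shows "FT s n \<phi> \<in> schwartz n"
proof (rule schwartz_coinduct[of _ "FT s n ` schwartz n"], goal_cases)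
  case 1
  then show ?case using assms by blast
next
  case (2 g)
  then obtain \<psi> where \<psi>: "\<psi> \<in> schwartz n" "g = FT s n \<psi>" by blast
  show ?case
    unfolding rapidly_decreasing_def
  proof
    fix k
    obtain M where M: "\<And>\<xi>. (1 + (\<Sum>i<n. \<bar>\<xi> i\<bar>)) ^ k * cmod (FT s n \<psi> \<xi>) \<le> M"
      using FT_bounded[OF \<psi>(1) s] by blast
    have "(1 + L2_set \<xi> {..<n}) ^ k * cmod (g \<xi>) \<le> M" for \<xi>
    proof -
      have "(1 + L2_set \<xi> {..<n}) ^ k * cmod (g \<xi>) \<le> (1 + (\<Sum>i<n. \<bar>\<xi> i\<bar>)) ^ k * cmod (g \<xi>)"
        using L2_set_pos[of \<xi> "{..<n}"] L2_set_le_sum_abs[of \<xi> "{..<n}"]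
        by (intro mult_right_mono power_mono) auto
      also have "\<dots> \<le> M" using M \<psi>(2) by simp
      finally show ?thesis .
    qed
    then show "\<exists>M. \<forall>x\<in>points n. (1 + L2_set x {..<n}) ^ k * cmod (g x) \<le> M" by blast
  qed
next
  case (3 g i)
  then obtain \<psi> where \<psi>: "\<psi> \<in> schwartz n" "g = FT s n \<psi>" by blast
  have "(\<lambda>x. \<i> * of_real s * (of_real (x i) * \<psi> x)) \<in> schwartz n"
    by (intro schwartz_mult_const schwartz_coord \<psi> 3)
  with has_partial_FT[OF \<psi>(1) 3(2), of s] show ?case unfolding \<psi>(2) by blast
qed

lemma pair_sigma_finite_lborel_n: "pair_sigma_finite (lborel_n n) (lborel_n m)"
  unfolding pair_sigma_finite_def by (simp add: sigma_finite_lborel_n)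

text \<open>Fubini and the symmetry of \<open>dot\<close>. Integrability is the form of hypothesis
  that suits the modulated Gaussian in \<open>FT_inversion\<close>.\<close>

lemma FT_multiplication_formula:
  assumes \<phi>: "integrable (lborel_n n) \<phi>" and \<psi>: "integrable (lborel_n n) \<psi>"
  shows "(\<integral>\<xi>. FT s n \<phi> \<xi> * \<psi> \<xi> \<partial>lborel_n n) = (\<integral>x. \<phi> x * FT s n \<psi> x \<partial>lborel_n n)"
proof -
  interpret P: pair_sigma_finite "lborel_n n" "lborel_n n" by (rule pair_sigma_finite_lborel_n)
  note [measurable] = borel_measurable_integrable[OF \<phi>] borel_measurable_integrable[OF \<psi>]
  let ?c = "complex_of_real ((2 * pi) powr (- real n / 2))"
  let ?F = "\<lambda>x y. cis (s * dot n x y) * \<phi> x * \<psi> y"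
  have [measurable]: "(\<lambda>z. dot n (fst z) (snd z)) \<in> borel_measurable (lborel_n n \<Otimes>\<^sub>M lborel_n n)"
    unfolding dot_def by measurable
  have "integrable (lborel_n n \<Otimes>\<^sub>M lborel_n n) (\<lambda>(x, y). ?F x y)"
  proof (rule P.Fubini_integrable)
    show "(\<lambda>(x, y). ?F x y) \<in> borel_measurable (lborel_n n \<Otimes>\<^sub>M lborel_n n)"
      unfolding split_beta' by measurable
    show "integrable (lborel_n n) (\<lambda>x. \<integral>y. norm (case (x, y) of (x, y) \<Rightarrow> ?F x y) \<partial>lborel_n n)"
      using \<phi> \<psi> by (simp add: norm_mult)
    show "AE x in lborel_n n. integrable (lborel_n n) (\<lambda>y. case (x, y) of (x, y) \<Rightarrow> ?F x y)"
    proof (rule AE_I2)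
      fix x
      have "integrable (lborel_n n) (\<lambda>y. \<phi> x * (cis (s * dot n y x) * \<psi> y))"
        using integrable_cis_mult[OF \<psi>] by simp
      then show "integrable (lborel_n n) (\<lambda>y. case (x, y) of (x, y) \<Rightarrow> ?F x y)"
        by (simp add: dot_commute[of n _ x] mult_ac)
    qed
  qed
  from P.Fubini_integral[OF this]
  have "(\<integral>y. (\<integral>x. ?F x y \<partial>lborel_n n) \<partial>lborel_n n) = (\<integral>x. (\<integral>y. ?F x y \<partial>lborel_n n) \<partial>lborel_n n)" .
  moreover have "(\<integral>x. ?F x y \<partial>lborel_n n) = (\<integral>x. cis (s * dot n x y) * \<phi> x \<partial>lborel_n n) * \<psi> y" for y
    by simp
  moreover have "(\<integral>y. ?F x y \<partial>lborel_n n) = \<phi> x * (\<integral>y. cis (s * dot n y x) * \<psi> y \<partial>lborel_n n)" for x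
    by (simp add: dot_commute[of n x] mult.assoc mult.left_commute[of _ "\<phi> x"])
  ultimately have eq: "(\<integral>y. (\<integral>x. cis (s * dot n x y) * \<phi> x \<partial>lborel_n n) * \<psi> y \<partial>lborel_n n)
      = (\<integral>x. \<phi> x * (\<integral>y. cis (s * dot n y x) * \<psi> y \<partial>lborel_n n) \<partial>lborel_n n)" by simp
  have "(\<integral>\<xi>. FT s n \<phi> \<xi> * \<psi> \<xi> \<partial>lborel_n n)
      = ?c * (\<integral>y. (\<integral>x. cis (s * dot n x y) * \<phi> x \<partial>lborel_n n) * \<psi> y \<partial>lborel_n n)"
    by (simp only: FT_def mult.assoc integral_mult_right_zero)
  also have "\<dots> = (\<integral>x. \<phi> x * FT s n \<psi> x \<partial>lborel_n n)"
    by (simp only: eq FT_def mult.left_commute[of _ ?c] integral_mult_right_zero)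
  finally show ?thesis .
qed

subsection \<open>Inversion and Plancherel\<close>

text \<open>The value comes from the characteristic function of the standard normal distribution,
  after the substitution of \<open>\<epsilon> * t\<close> for the variable.\<close>

lemma gaussian_integral:
  assumes "\<epsilon> > 0"
  shows "integrable lborel (\<lambda>t. cis (z * t) * of_real (exp (- (\<epsilon> * t)\<^sup>2 / 2)))"
    and "(\<integral>t. cis (z * t) * of_real (exp (- (\<epsilon> * t)\<^sup>2 / 2)) \<partial>lborel)
      = of_real (sqrt (2 * pi) / \<epsilon> * exp (- (z / \<epsilon>)\<^sup>2 / 2))"
proof -
  let ?g = "\<lambda>t. cis (z / \<epsilon> * t) * of_real (exp (- t\<^sup>2 / 2))"
  have dens: "std_normal_density t *\<^sub>R exp (\<i> * of_real (z / \<epsilon> * t)) = of_real (1 / sqrt (2 * pi)) * ?g t" for t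
    by (simp add: std_normal_density_def scaleR_conv_of_real cis_conv_exp mult_ac)
  have int: "integrable lborel ?g"
  proof (rule Bochner_Integration.integrable_bound)
    show "integrable lborel (\<lambda>t. sqrt (2 * pi) * std_normal_density t)" by simp
  qed (auto simp: norm_mult std_normal_density_def abs_mult)
  have "(\<integral>t. std_normal_density t *\<^sub>R exp (\<i> * of_real (z / \<epsilon> * t)) \<partial>lborel) = of_real (exp (- (z / \<epsilon>)\<^sup>2 / 2))"
    using fun_cong[OF char_std_normal_distribution, of "z / \<epsilon>"]
    unfolding char_def by (subst (asm) integral_density) auto
  then have "of_real (1 / sqrt (2 * pi)) * (\<integral>t. ?g t \<partial>lborel) = of_real (exp (- (z / \<epsilon>)\<^sup>2 / 2))"
    unfolding dens by simp
  then have val: "(\<integral>t. ?g t \<partial>lborel) = of_real (sqrt (2 * pi) * exp (- (z / \<epsilon>)\<^sup>2 / 2))"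
    by (simp add: field_simps)
  have shift: "?g (0 + \<epsilon> * t) = cis (z * t) * of_real (exp (- (\<epsilon> * t)\<^sup>2 / 2))" for t
    using assms by simp
  show "integrable lborel (\<lambda>t. cis (z * t) * of_real (exp (- (\<epsilon> * t)\<^sup>2 / 2)))"
    using lborel_integrable_real_affine[OF int, of \<epsilon> 0] assms unfolding shift by simp
  show "(\<integral>t. cis (z * t) * of_real (exp (- (\<epsilon> * t)\<^sup>2 / 2)) \<partial>lborel)
      = of_real (sqrt (2 * pi) / \<epsilon> * exp (- (z / \<epsilon>)\<^sup>2 / 2))"
    using lborel_integral_real_affine[of \<epsilon> ?g 0] assms unfolding shift val
    by (simp add: scaleR_conv_of_real field_simps)
qed

lemma cis_sum: "cis (\<Sum>i\<in>A. f i) = (\<Prod>i\<in>A. cis (f i))"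
  by (induction A rule: infinite_finite_induct) (simp_all flip: cis_mult)

text \<open>Modulation by \<open>x\<close> centres the transformed Gaussian at \<open>x\<close>. The
  factor in front is the normalisation of the outer transform in the inversion formula; the two
  normalisations cancel the (2 pi)^n of the one-dimensional integrals and leave a probability
  density.\<close>

lemma FT_gaussian:
  fixes x y :: "nat \<Rightarrow> real" and n :: nat
  assumes s: "\<bar>s\<bar> = 1" and "\<epsilon> > 0"
  defines "\<rho> \<equiv> \<lambda>\<xi>. cis (s * dot n \<xi> x) * (\<Prod>i<n. of_real (exp (- (\<epsilon> * \<xi> i)\<^sup>2 / 2)))"
  shows "integrable (lborel_n n) \<rho>"
    and "of_real ((2 * pi) powr (- real n / 2)) * FT (- s) n \<rho> y = of_real (\<Prod>i<n. normal_density (x i) \<epsilon> (y i))"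
proof -
  have s2: "s\<^sup>2 = 1" using s by (metis one_power2 power2_abs)
  have \<rho>: "\<rho> = (\<lambda>\<xi>. \<Prod>i<n. cis (s * x i * \<xi> i) * of_real (exp (- (\<epsilon> * \<xi> i)\<^sup>2 / 2)))"
    unfolding \<rho>_def dot_def prod.distrib cis_sum[symmetric] by (simp add: sum_distrib_left mult_ac)
  show "integrable (lborel_n n) \<rho>"
    unfolding \<rho> by (intro lbp.product_integrable_prod gaussian_integral assms) auto
  have "cis (- s * dot n \<xi> y) * \<rho> \<xi> = (\<Prod>i<n. cis (s * (x i - y i) * \<xi> i) * of_real (exp (- (\<epsilon> * \<xi> i)\<^sup>2 / 2)))" for \<xi>
    unfolding \<rho>_def dot_def prod.distrib cis_sum[symmetric] mult.assoc[symmetric] cis_mult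
    by (simp add: sum_distrib_left sum_subtractf sum_negf algebra_simps)
  then have "(\<integral>\<xi>. cis (- s * dot n \<xi> y) * \<rho> \<xi> \<partial>lborel_n n)
      = (\<integral>\<xi>. (\<Prod>i<n. cis (s * (x i - y i) * \<xi> i) * of_real (exp (- (\<epsilon> * \<xi> i)\<^sup>2 / 2))) \<partial>lborel_n n)"
    by simp
  also have "\<dots> = (\<Prod>i<n. of_real (sqrt (2 * pi) / \<epsilon> * exp (- (s * (x i - y i) / \<epsilon>)\<^sup>2 / 2)))"
    by (subst lbp.product_integral_prod) (use gaussian_integral[OF assms(2)] in auto)
  also have "\<dots> = (\<Prod>i<n. of_real (2 * pi * normal_density (x i) \<epsilon> (y i)))"
  proof (intro prod.cong refl)
    fix i
    have "(s * (x i - y i) / \<epsilon>)\<^sup>2 / 2 = (y i - x i)\<^sup>2 / (2 * \<epsilon>\<^sup>2)"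
      using s2 by (simp add: power_divide power_mult_distrib power2_commute)
    moreover have "sqrt (2 * pi) / \<epsilon> = 2 * pi * (1 / sqrt (2 * pi * \<epsilon>\<^sup>2))"
      using assms(2) by (simp add: real_sqrt_mult field_simps)
    ultimately show "complex_of_real (sqrt (2 * pi) / \<epsilon> * exp (- (s * (x i - y i) / \<epsilon>)\<^sup>2 / 2)) = of_real (2 * pi * normal_density (x i) \<epsilon> (y i))"
      unfolding normal_density_def by (simp add: mult.assoc)
  qed
  also have "\<dots> = of_real ((2 * pi) ^ n * (\<Prod>i<n. normal_density (x i) \<epsilon> (y i)))"
    by (simp add: prod.distrib)
  finally have eq: "(\<integral>\<xi>. cis (- s * dot n \<xi> y) * \<rho> \<xi> \<partial>lborel_n n) = of_real ((2 * pi) ^ n * (\<Prod>i<n. normal_density (x i) \<epsilon> (y i)))" .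
  have c: "(2 * pi) powr (- real n / 2) * ((2 * pi) powr (- real n / 2) * (2 * pi) ^ n) = 1"
  proof -
    have "(2 * pi) ^ n = (2 * pi) powr real n" by (simp add: powr_realpow)
    then show ?thesis by (simp only: powr_add[symmetric]) simp
  qed
  have "of_real ((2 * pi) powr (- real n / 2)) * FT (- s) n \<rho> y
    = of_real (((2 * pi) powr (- real n / 2) * ((2 * pi) powr (- real n / 2) * (2 * pi) ^ n)) * (\<Prod>i<n. normal_density (x i) \<epsilon> (y i)))"
    unfolding FT_def eq by (simp only: of_real_mult mult.assoc)
  then show "of_real ((2 * pi) powr (- real n / 2)) * FT (- s) n \<rho> y = of_real (\<Prod>i<n. normal_density (x i) \<epsilon> (y i))"
    unfolding c by simp
qed

lemma normal_density_product:
  assumes "\<epsilon> > 0"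
  shows "integrable (lborel_n n) (\<lambda>y. \<Prod>i<n. normal_density (x i) \<epsilon> (y i))"
    and "(\<integral>y. (\<Prod>i<n. normal_density (x i) \<epsilon> (y i)) \<partial>lborel_n n) = 1"
    and "i < n \<Longrightarrow> integrable (lborel_n n) (\<lambda>y. \<bar>y i - x i\<bar> * (\<Prod>i<n. normal_density (x i) \<epsilon> (y i)))"
    and "i < n \<Longrightarrow> (\<integral>y. \<bar>y i - x i\<bar> * (\<Prod>i<n. normal_density (x i) \<epsilon> (y i)) \<partial>lborel_n n) = \<epsilon> * sqrt (2 / pi)"
proof -
  show "integrable (lborel_n n) (\<lambda>y. \<Prod>i<n. normal_density (x i) \<epsilon> (y i))"
    using assms by (intro lbp.product_integrable_prod) auto
  show "(\<integral>y. (\<Prod>i<n. normal_density (x i) \<epsilon> (y i)) \<partial>lborel_n n) = 1"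
    using assms by (subst lbp.product_integral_prod) auto
  assume i: "i < n"
  \<comment> \<open>The factor |y_i - x_i| is absorbed into the i-th density, which keeps the
    integrand a product of one-variable functions.\<close>
  let ?f = "\<lambda>j t. if j = i then normal_density (x j) \<epsilon> t * \<bar>t - x j\<bar> else normal_density (x j) \<epsilon> t"
  have eq: "\<bar>y i - x i\<bar> * (\<Prod>i<n. normal_density (x i) \<epsilon> (y i)) = (\<Prod>j<n. ?f j (y j))" for y :: "nat \<Rightarrow> real"
  proof -
    have "(\<Prod>j<n. ?f j (y j)) = ?f i (y i) * (\<Prod>j\<in>{..<n} - {i}. ?f j (y j))"
      using i by (intro prod.remove) auto
    also have "(\<Prod>j\<in>{..<n} - {i}. ?f j (y j)) = (\<Prod>j\<in>{..<n} - {i}. normal_density (x j) \<epsilon> (y j))"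
      by (intro prod.cong) auto
    finally show ?thesis using i prod.remove[of "{..<n}" i "\<lambda>i. normal_density (x i) \<epsilon> (y i)"] by simp
  qed
  have m: "integrable lborel (\<lambda>t. normal_density (x i) \<epsilon> t * \<bar>t - x i\<bar>)"
    "(\<integral>t. normal_density (x i) \<epsilon> t * \<bar>t - x i\<bar> \<partial>lborel) = \<epsilon> * sqrt (2 / pi)"
    using integrable_normal_moment_abs[OF assms, of "x i" 1] integral_normal_moment_abs_odd[OF assms, of "x i" 0]
    by auto
  have int: "integrable lborel (?f j)" for j using m(1) assms by (cases "j = i") auto
  show "integrable (lborel_n n) (\<lambda>y. \<bar>y i - x i\<bar> * (\<Prod>i<n. normal_density (x i) \<epsilon> (y i)))"
    unfolding eq by (intro lbp.product_integrable_prod int) auto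
  have "(\<integral>y. (\<Prod>j<n. ?f j (y j)) \<partial>lborel_n n) = (\<Prod>j<n. \<integral>t. ?f j t \<partial>lborel)"
    by (intro lbp.product_integral_prod int) auto
  also have "\<dots> = (\<Prod>j<n. if j = i then \<epsilon> * sqrt (2 / pi) else 1)"
    using m(2) assms by (intro prod.cong refl) auto
  also have "\<dots> = \<epsilon> * sqrt (2 / pi)" using i by (subst prod.delta) auto
  finally show "(\<integral>y. \<bar>y i - x i\<bar> * (\<Prod>i<n. normal_density (x i) \<epsilon> (y i)) \<partial>lborel_n n) = \<epsilon> * sqrt (2 / pi)"
    unfolding eq .
qed

text \<open>The density has mass 1 and first absolute moment
  \<open>\<epsilon> k * sqrt (2 / pi)\<close> in each coordinate, so the Lipschitz bound makes the
  error at most a multiple of \<open>\<epsilon> k\<close>.\<close>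

lemma gaussian_mollification:
  assumes \<phi>: "\<phi> \<in> schwartz n" and x: "x \<in> points n"
    and \<epsilon>: "\<And>k. \<epsilon> k > 0" "\<epsilon> \<longlonglongrightarrow> 0"
  shows "(\<lambda>k. \<integral>y. \<phi> y * of_real (\<Prod>i<n. normal_density (x i) (\<epsilon> k) (y i)) \<partial>lborel_n n) \<longlonglongrightarrow> \<phi> x"
proof -
  let ?N = "\<lambda>k y. \<Prod>i<n. normal_density (x i) (\<epsilon> k) (y i)"
  obtain L where L: "L \<ge> 0"
    "\<And>x y. x \<in> points n \<Longrightarrow> y \<in> points n \<Longrightarrow> cmod (\<phi> x - \<phi> y) \<le> L * (\<Sum>i<n. \<bar>x i - y i\<bar>)"
    using schwartz_lipschitz[OF \<phi>] by blast
  obtain B where B: "\<And>x. x \<in> points n \<Longrightarrow> cmod (\<phi> x) \<le> B" "B \<ge> 0"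
    using schwartz_bounded[OF \<phi>, of 0] by (metis mult_1 power_0)
  note [measurable] = schwartz_measurable[OF \<phi>]
  have N: "0 \<le> ?N k y" for k y by (intro prod_nonneg) auto
  have int: "integrable (lborel_n n) (\<lambda>y. \<phi> y * of_real (?N k y))" for k
  proof (rule Bochner_Integration.integrable_bound)
    show "integrable (lborel_n n) (\<lambda>y. B * ?N k y)" using normal_density_product(1)[OF \<epsilon>(1)] by simp
    show "AE y in lborel_n n. norm (\<phi> y * of_real (?N k y)) \<le> norm (B * ?N k y)"
      using B N by (intro AE_I2) (auto simp: norm_mult abs_mult simp del: of_real_prod intro!: mult_right_mono)
  qed measurable
  have bd: "norm ((\<integral>y. \<phi> y * of_real (?N k y) \<partial>lborel_n n) - \<phi> x) \<le> L * (real n * (\<epsilon> k * sqrt (2 / pi)))" for k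
  proof -
    have "(\<integral>y. \<phi> x * of_real (?N k y) \<partial>lborel_n n) = \<phi> x"
      using normal_density_product(2)[OF \<epsilon>(1), of n x k] by (simp del: of_real_prod)
    then have "(\<integral>y. \<phi> y * of_real (?N k y) \<partial>lborel_n n) - \<phi> x
        = (\<integral>y. \<phi> y * of_real (?N k y) - \<phi> x * of_real (?N k y) \<partial>lborel_n n)"
      using int normal_density_product(1)[OF \<epsilon>(1), of n x k]
      by (simp del: of_real_prod)
    also have "norm \<dots> \<le> (\<integral>y. norm (\<phi> y * of_real (?N k y) - \<phi> x * of_real (?N k y)) \<partial>lborel_n n)"
      by (rule integral_norm_bound)
    also have "\<dots> \<le> (\<integral>y. L * (\<Sum>i<n. \<bar>y i - x i\<bar> * ?N k y) \<partial>lborel_n n)"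
    proof (rule Bochner_Integration.integral_mono)
      show "integrable (lborel_n n) (\<lambda>y. norm (\<phi> y * of_real (?N k y) - \<phi> x * of_real (?N k y)))"
        using int normal_density_product(1)[OF \<epsilon>(1), of n x k] by (simp del: of_real_prod)
      show "integrable (lborel_n n) (\<lambda>y. L * (\<Sum>i<n. \<bar>y i - x i\<bar> * ?N k y))"
        using normal_density_product(3)[OF \<epsilon>(1)] by (intro integrable_mult_right Bochner_Integration.integrable_sum) auto
      fix y assume y: "y \<in> points n"
      have "norm (\<phi> y * of_real (?N k y) - \<phi> x * of_real (?N k y)) = cmod (\<phi> y - \<phi> x) * ?N k y"
        using N[of k y] unfolding left_diff_distrib[symmetric] norm_mult by (simp del: of_real_prod)
      also have "\<dots> \<le> L * (\<Sum>i<n. \<bar>y i - x i\<bar>) * ?N k y"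
        by (intro mult_right_mono L y x N)
      also have "\<dots> = L * (\<Sum>i<n. \<bar>y i - x i\<bar> * ?N k y)" by (simp add: sum_distrib_right mult.assoc)
      finally show "norm (\<phi> y * of_real (?N k y) - \<phi> x * of_real (?N k y)) \<le> L * (\<Sum>i<n. \<bar>y i - x i\<bar> * ?N k y)" .
    qed
    also have "\<dots> = L * (\<Sum>i<n. \<integral>y. \<bar>y i - x i\<bar> * ?N k y \<partial>lborel_n n)"
      using normal_density_product(3)[OF \<epsilon>(1)] by (subst integral_mult_right_zero, subst Bochner_Integration.integral_sum) auto
    also have "\<dots> = L * (real n * (\<epsilon> k * sqrt (2 / pi)))"
      using normal_density_product(4)[OF \<epsilon>(1)] by simp
    finally show ?thesis .
  qed
  have "(\<lambda>k. L * (real n * (\<epsilon> k * sqrt (2 / pi)))) \<longlonglongrightarrow> L * (real n * (0 * sqrt (2 / pi)))"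
    by (intro tendsto_intros \<epsilon>)
  then have "(\<lambda>k. L * (real n * (\<epsilon> k * sqrt (2 / pi)))) \<longlonglongrightarrow> 0" by simp
  then have "(\<lambda>k. (\<integral>y. \<phi> y * of_real (?N k y) \<partial>lborel_n n) - \<phi> x) \<longlonglongrightarrow> 0"
    by (rule Lim_null_comparison[OF always_eventually[rule_format], rotated]) (rule bd)
  then show ?thesis by (simp add: LIM_zero_iff)
qed

text \<open>The inversion integral is regularised by a Gaussian \<open>?G k\<close> tending to 1.
  The multiplication formula moves the transform onto the Gaussian, which becomes an approximate
  identity at \<open>x\<close>; the two sides then tend to the inversion integral and to
  \<open>\<phi> x\<close>.\<close>

theorem FT_inversion:
  assumes \<phi>: "\<phi> \<in> schwartz n" and s: "\<bar>s\<bar> = 1" and x: "x \<in> points n"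
  shows "FT s n (FT (- s) n \<phi>) x = \<phi> x"
proof -
  let ?c = "complex_of_real ((2 * pi) powr (- real n / 2))"
  let ?\<epsilon> = "\<lambda>k. 1 / real (Suc k)"
  let ?\<psi> = "FT (- s) n \<phi>"
  let ?G = "\<lambda>k \<xi>. \<Prod>i<n. complex_of_real (exp (- (?\<epsilon> k * \<xi> i)\<^sup>2 / 2))"
  let ?\<rho> = "\<lambda>k \<xi>. cis (s * dot n \<xi> x) * ?G k \<xi>"
  have \<epsilon>: "?\<epsilon> k > 0" for k by simp
  have \<psi>: "?\<psi> \<in> schwartz n" using s by (intro FT_schwartz \<phi>) simp
  note [measurable] = schwartz_measurable[OF \<psi>]
  have "?c * (\<integral>\<xi>. ?\<psi> \<xi> * ?\<rho> k \<xi> \<partial>lborel_n n) = ?c * (\<integral>y. \<phi> y * FT (- s) n (?\<rho> k) y \<partial>lborel_n n)" for k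
    by (intro arg_cong[where f = "(*) ?c"] FT_multiplication_formula schwartz_integrable \<phi> FT_gaussian s \<epsilon>)
  also have "?c * (\<integral>y. \<phi> y * FT (- s) n (?\<rho> k) y \<partial>lborel_n n)
      = (\<integral>y. \<phi> y * (?c * FT (- s) n (?\<rho> k) y) \<partial>lborel_n n)" for k
    unfolding mult.left_commute[of _ ?c] by (rule integral_mult_right_zero[symmetric])
  also have "(\<integral>y. \<phi> y * (?c * FT (- s) n (?\<rho> k) y) \<partial>lborel_n n)
      = (\<integral>y. \<phi> y * of_real (\<Prod>i<n. normal_density (x i) (?\<epsilon> k) (y i)) \<partial>lborel_n n)" for k
    unfolding FT_gaussian(2)[OF s \<epsilon>] ..
  finally have eq: "?c * (\<integral>\<xi>. ?\<psi> \<xi> * ?\<rho> k \<xi> \<partial>lborel_n n)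
      = (\<integral>y. \<phi> y * of_real (\<Prod>i<n. normal_density (x i) (?\<epsilon> k) (y i)) \<partial>lborel_n n)" for k .
  have "(\<lambda>k. ?c * (\<integral>\<xi>. ?\<psi> \<xi> * ?\<rho> k \<xi> \<partial>lborel_n n)) \<longlonglongrightarrow> \<phi> x"
    unfolding eq by (rule gaussian_mollification[OF \<phi> x \<epsilon>]) (rule LIMSEQ_Suc, rule lim_1_over_n)
  moreover have "(\<lambda>k. ?c * (\<integral>\<xi>. ?\<psi> \<xi> * ?\<rho> k \<xi> \<partial>lborel_n n)) \<longlonglongrightarrow> ?c * (\<integral>\<xi>. cis (s * dot n \<xi> x) * ?\<psi> \<xi> \<partial>lborel_n n)"
  proof (intro tendsto_mult_left integral_dominated_convergence)
    show "integrable (lborel_n n) (\<lambda>\<xi>. norm (?\<psi> \<xi>))" using schwartz_integrable[OF \<psi>] by simp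
    show "AE \<xi> in lborel_n n. (\<lambda>k. ?\<psi> \<xi> * ?\<rho> k \<xi>) \<longlonglongrightarrow> cis (s * dot n \<xi> x) * ?\<psi> \<xi>"
    proof (rule AE_I2)
      fix \<xi>
      have "(\<lambda>k. ?\<psi> \<xi> * ?\<rho> k \<xi>) \<longlonglongrightarrow> ?\<psi> \<xi> * (cis (s * dot n \<xi> x) * (\<Prod>i<n. complex_of_real (exp (- (0 * \<xi> i)\<^sup>2 / 2))))"
        by (intro tendsto_intros LIMSEQ_Suc[OF lim_1_over_n]) auto
      then show "(\<lambda>k. ?\<psi> \<xi> * ?\<rho> k \<xi>) \<longlonglongrightarrow> cis (s * dot n \<xi> x) * ?\<psi> \<xi>" by (simp add: mult.commute)
    qed
    show "AE \<xi> in lborel_n n. norm (?\<psi> \<xi> * ?\<rho> k \<xi>) \<le> norm (?\<psi> \<xi>)" for k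
    proof (rule AE_I2)
      fix \<xi>
      have "norm (?G k \<xi>) \<le> 1" unfolding prod_norm[symmetric] by (intro prod_le_1) auto
      then show "norm (?\<psi> \<xi> * ?\<rho> k \<xi>) \<le> norm (?\<psi> \<xi>)" by (simp add: norm_mult mult_left_le)
    qed
  qed measurable
  ultimately show ?thesis using LIMSEQ_unique unfolding FT_def[of s] by blast
qed

lemma FT_FT_minus:
  assumes "\<phi> \<in> schwartz n" "\<bar>s\<bar> = 1" "x \<in> points n"
  shows "FT (- s) n (FT s n \<phi>) x = \<phi> x"
  using FT_inversion[of \<phi> n "- s" x] assms by simp

text \<open>In the multiplication formula for the conjugated transform, conjugation reverses the
  sign of the exponent, so the second transform inverts the first.\<close>

theorem FT_plancherel:
  assumes \<phi>: "\<phi> \<in> schwartz n" and s: "\<bar>s\<bar> = 1"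
  shows "(\<integral>\<xi>. (cmod (FT s n \<phi> \<xi>))\<^sup>2 \<partial>lborel_n n) = (\<integral>x. (cmod (\<phi> x))\<^sup>2 \<partial>lborel_n n)"
proof -
  let ?\<psi> = "\<lambda>\<xi>. cnj (FT s n \<phi> \<xi>)"
  have F: "FT s n \<phi> \<in> schwartz n" by (rule FT_schwartz[OF \<phi> s])
  have "(\<integral>\<xi>. FT s n \<phi> \<xi> * ?\<psi> \<xi> \<partial>lborel_n n) = (\<integral>x. \<phi> x * FT s n ?\<psi> x \<partial>lborel_n n)"
    by (intro FT_multiplication_formula schwartz_integrable schwartz_cnj \<phi> F)
  also have "\<dots> = (\<integral>x. \<phi> x * cnj (\<phi> x) \<partial>lborel_n n)"
    by (intro Bochner_Integration.integral_cong refl) (simp add: FT_cnj FT_FT_minus[OF \<phi> s])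
  finally have "complex_of_real (\<integral>\<xi>. (cmod (FT s n \<phi> \<xi>))\<^sup>2 \<partial>lborel_n n) = of_real (\<integral>x. (cmod (\<phi> x))\<^sup>2 \<partial>lborel_n n)"
    by (simp only: complex_norm_square integral_complex_of_real[symmetric])
  then show ?thesis by (simp only: of_real_eq_iff)
qed

section \<open>Square-integrable functions\<close>

definition square_integrable :: "'a measure \<Rightarrow> ('a \<Rightarrow> complex) \<Rightarrow> bool" where
  "square_integrable M f \<longleftrightarrow> f \<in> borel_measurable M \<and> integrable M (\<lambda>x. (cmod (f x))\<^sup>2)"

lemma square_integrable_measurable [measurable_dest]:
  "square_integrable M f \<Longrightarrow> f \<in> borel_measurable M"
  by (simp add: square_integrable_def)

lemma square_integrable_lincomb:
  assumes "square_integrable M f" "square_integrable M g"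
  shows "square_integrable M (\<lambda>x. a * f x + c * g x)"
proof -
  note [measurable] = assms[THEN square_integrable_measurable]
  have "integrable M (\<lambda>x. (cmod (a * f x + c * g x))\<^sup>2)"
  proof (rule Bochner_Integration.integrable_bound)
    show "integrable M (\<lambda>x. 2 * (cmod a)\<^sup>2 * (cmod (f x))\<^sup>2 + 2 * (cmod c)\<^sup>2 * (cmod (g x))\<^sup>2)"
      using assms by (simp add: square_integrable_def)
    have "(cmod (a * f x + c * g x))\<^sup>2 \<le> 2 * (cmod a)\<^sup>2 * (cmod (f x))\<^sup>2 + 2 * (cmod c)\<^sup>2 * (cmod (g x))\<^sup>2" for x
    proof -
      have "(cmod (a * f x + c * g x))\<^sup>2 \<le> (cmod (a * f x) + cmod (c * g x))\<^sup>2"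
        by (intro power_mono norm_triangle_ineq) simp
      also have "\<dots> \<le> 2 * (cmod (a * f x))\<^sup>2 + 2 * (cmod (c * g x))\<^sup>2"
        using sum_squares_bound[of "cmod (a * f x)" "cmod (c * g x)"] by (simp add: power2_sum)
      finally show ?thesis by (simp add: norm_mult power_mult_distrib)
    qed
    then show "AE x in M. norm ((cmod (a * f x + c * g x))\<^sup>2)
        \<le> norm (2 * (cmod a)\<^sup>2 * (cmod (f x))\<^sup>2 + 2 * (cmod c)\<^sup>2 * (cmod (g x))\<^sup>2)"
      by (intro AE_I2) (simp add: order_trans[OF _ abs_ge_self])
  qed measurable
  then show ?thesis by (simp add: square_integrable_def)
qed

lemma square_integrable_diff:
  "square_integrable M f \<Longrightarrow> square_integrable M g \<Longrightarrow> square_integrable M (\<lambda>x. f x - g x)"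
  using square_integrable_lincomb[of M f g 1 "- 1"] by simp

lemma square_integrable_cnj: "square_integrable M f \<Longrightarrow> square_integrable M (\<lambda>x. cnj (f x))"
  using measurable_compose[OF _ borel_measurable_continuous_onI[OF continuous_on_cnj[OF continuous_on_id]], of f M]
  by (simp add: square_integrable_def)

lemma integrable_mult_square_integrable:
  assumes "square_integrable M f" "square_integrable M g"
  shows "integrable M (\<lambda>x. f x * g x)"
proof (rule Bochner_Integration.integrable_bound)
  note [measurable] = assms[THEN square_integrable_measurable]
  show "(\<lambda>x. f x * g x) \<in> borel_measurable M" by measurable
  show "integrable M (\<lambda>x. (cmod (f x))\<^sup>2 + (cmod (g x))\<^sup>2)"
    using assms by (simp add: square_integrable_def)
  have "cmod (f x * g x) \<le> (cmod (f x))\<^sup>2 + (cmod (g x))\<^sup>2" for x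
  proof -
    have "0 \<le> cmod (f x) * cmod (g x)" by simp
    with sum_squares_bound[of "cmod (f x)" "cmod (g x)"] show ?thesis
      unfolding norm_mult mult.assoc by linarith
  qed
  then show "AE x in M. norm (f x * g x) \<le> norm ((cmod (f x))\<^sup>2 + (cmod (g x))\<^sup>2)" by simp
qed

lemma integral_Cauchy_Schwarz:
  assumes f: "square_integrable M f" and g: "square_integrable M g"
  shows "(cmod (\<integral>x. f x * g x \<partial>M))\<^sup>2 \<le> (\<integral>x. (cmod (f x))\<^sup>2 \<partial>M) * (\<integral>x. (cmod (g x))\<^sup>2 \<partial>M)"
proof -
  define P where "P = (\<integral>x. cmod (f x * g x) \<partial>M)"
  define A where "A = (\<integral>x. (cmod (f x))\<^sup>2 \<partial>M)"
  define B where "B = (\<integral>x. (cmod (g x))\<^sup>2 \<partial>M)"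
  have int: "integrable M (\<lambda>x. cmod (f x * g x))" "integrable M (\<lambda>x. (cmod (f x))\<^sup>2)"
    "integrable M (\<lambda>x. (cmod (g x))\<^sup>2)"
    using integrable_mult_square_integrable[OF f g] f g unfolding square_integrable_def by auto
  have quad: "0 \<le> t\<^sup>2 * A - 2 * t * P + B" for t
  proof -
    have "0 \<le> (\<integral>x. (t * cmod (f x) - cmod (g x))\<^sup>2 \<partial>M)" by simp
    also have "\<dots> = (\<integral>x. t\<^sup>2 * (cmod (f x))\<^sup>2 - 2 * t * cmod (f x * g x) + (cmod (g x))\<^sup>2 \<partial>M)"
      by (simp add: power2_diff power_mult_distrib norm_mult algebra_simps)
    also have "\<dots> = t\<^sup>2 * A - 2 * t * P + B" unfolding A_def B_def P_def using int by simp
    finally show ?thesis .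
  qed
  have A0: "A \<ge> 0" unfolding A_def by simp
  have P: "P\<^sup>2 \<le> A * B"
  proof (cases "A = 0")
    case True
    have "P = 0"
    proof (rule ccontr)
      assume "P \<noteq> 0"
      \<comment> \<open>With \<open>A = 0\<close> the quadratic is affine in \<open>t\<close> and
        takes the value -1 at this point.\<close>
      with quad[of "(B + 1) / (2 * P)"] True show False by simp
    qed
    then show ?thesis using True by simp
  next
    case False
    with A0 have "A > 0" by simp
    have "A * ((P / A)\<^sup>2 * A - 2 * (P / A) * P + B) \<ge> 0" using quad[of "P / A"] A0 by simp
    moreover have "A * ((P / A)\<^sup>2 * A - 2 * (P / A) * P + B) = A * B - P\<^sup>2"
      using False by (simp add: field_simps power2_eq_square)
    ultimately show ?thesis by simp
  qed
  have "cmod (\<integral>x. f x * g x \<partial>M) \<le> P" unfolding P_def by (rule integral_norm_bound)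
  then have "(cmod (\<integral>x. f x * g x \<partial>M))\<^sup>2 \<le> P\<^sup>2" by (intro power_mono) auto
  with P show ?thesis unfolding A_def B_def by simp
qed

section \<open>Expansion of the L2 norm, completeness and representation of functionals\<close>

lemma integral_norm_square_add:
  assumes f: "square_integrable M f" and g: "square_integrable M g"
  shows "(\<integral>x. (cmod (f x + of_real t * g x))\<^sup>2 \<partial>M) = (\<integral>x. (cmod (f x))\<^sup>2 \<partial>M)
    + 2 * t * Re (\<integral>x. cnj (f x) * g x \<partial>M) + t\<^sup>2 * (\<integral>x. (cmod (g x))\<^sup>2 \<partial>M)"
proof -
  have i: "integrable M (\<lambda>x. cnj (f x) * g x)"
    by (intro integrable_mult_square_integrable square_integrable_cnj f g)
  have "(cmod (f x + of_real t * g x))\<^sup>2 = (cmod (f x))\<^sup>2 + 2 * t * Re (cnj (f x) * g x) + t\<^sup>2 * (cmod (g x))\<^sup>2" for x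
    unfolding cmod_power2 by (simp add: power2_eq_square algebra_simps)
  then have "(\<integral>x. (cmod (f x + of_real t * g x))\<^sup>2 \<partial>M)
    = (\<integral>x. (cmod (f x))\<^sup>2 + 2 * t * Re (cnj (f x) * g x) + t\<^sup>2 * (cmod (g x))\<^sup>2 \<partial>M)" by simp
  also have "\<dots> = (\<integral>x. (cmod (f x))\<^sup>2 \<partial>M) + 2 * t * (\<integral>x. Re (cnj (f x) * g x) \<partial>M) + t\<^sup>2 * (\<integral>x. (cmod (g x))\<^sup>2 \<partial>M)"
    using f g integrable_Re[OF i] unfolding square_integrable_def by simp
  also have "(\<integral>x. Re (cnj (f x) * g x) \<partial>M) = Re (\<integral>x. cnj (f x) * g x \<partial>M)"
    by (rule integral_Re[OF i])
  finally show ?thesis .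
qed

lemma integral_parallelogram:
  assumes f: "square_integrable M f" and g: "square_integrable M g"
  shows "4 * (\<integral>x. (cmod (1/2 * f x + 1/2 * g x))\<^sup>2 \<partial>M) = 2 * (\<integral>x. (cmod (f x))\<^sup>2 \<partial>M)
    + 2 * (\<integral>x. (cmod (g x))\<^sup>2 \<partial>M) - (\<integral>x. (cmod (f x - g x))\<^sup>2 \<partial>M)"
proof -
  have "4 * (cmod (1/2 * f x + 1/2 * g x))\<^sup>2 = 2 * (cmod (f x))\<^sup>2 + 2 * (cmod (g x))\<^sup>2 - (cmod (f x - g x))\<^sup>2" for x
    unfolding cmod_power2 by (simp add: power2_eq_square field_simps)
  then have "4 * (\<integral>x. (cmod (1/2 * f x + 1/2 * g x))\<^sup>2 \<partial>M)
    = (\<integral>x. 2 * (cmod (f x))\<^sup>2 + 2 * (cmod (g x))\<^sup>2 - (cmod (f x - g x))\<^sup>2 \<partial>M)"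
    by (simp flip: integral_mult_right_zero)
  then show ?thesis
    using f g square_integrable_diff[OF f g] unfolding square_integrable_def by simp
qed

text \<open>
  By the weighted AM-GM inequality
  \<open>\<bar>d\<^sub>k\<bar> \<le> 2 ^ k * \<bar>d\<^sub>k\<bar>\<^sup>2 + (1/2) ^ k\<close>, so almost everywhere convergence follows from a single
  monotone convergence argument.
\<close>

lemma square_integrable_complete:
  fixes f :: "nat \<Rightarrow> 'a \<Rightarrow> complex"
  assumes f: "\<And>k. square_integrable M (f k)"
    and cauchy: "\<And>j k. k \<le> j \<Longrightarrow> (\<integral>x. (cmod (f j x - f k x))\<^sup>2 \<partial>M) \<le> (1/8) ^ k"
  obtains g where "square_integrable M g" "\<And>k. (\<integral>x. (cmod (f k x - g x))\<^sup>2 \<partial>M) \<le> (1/8) ^ k"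
proof -
  note [measurable] = f[THEN square_integrable_measurable]
  have si: "integrable M (\<lambda>x. (cmod (f j x - f k x))\<^sup>2)" for j k
    using square_integrable_diff[OF f f] unfolding square_integrable_def by blast
  have nn: "(\<integral>\<^sup>+x. ennreal ((cmod (f j x - f k x))\<^sup>2) \<partial>M) \<le> ennreal ((1/8) ^ k)" if "k \<le> j" for j k
    using cauchy[OF that] by (subst nn_integral_eq_integral[OF si]) (auto simp: ennreal_leI)
  \<comment> \<open>The Cauchy rate (1/8)^k pays for the weight 2^k: the k-th integral is at most
    (1/4)^k, which is summable.\<close>
  define w where "w k x = ennreal (2 ^ k * (cmod (f (Suc k) x - f k x))\<^sup>2)" for k x
  have wm [measurable]: "w k \<in> borel_measurable M" for k unfolding w_def [abs_def] by measurable
  have "(\<integral>\<^sup>+x. w k x \<partial>M) \<le> ennreal ((1/4) ^ k)" for k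
  proof -
    have "(\<integral>\<^sup>+x. w k x \<partial>M) = ennreal (2 ^ k) * (\<integral>\<^sup>+x. ennreal ((cmod (f (Suc k) x - f k x))\<^sup>2) \<partial>M)"
      unfolding w_def by (simp add: ennreal_mult nn_integral_cmult)
    also have "\<dots> \<le> ennreal (2 ^ k) * ennreal ((1/8) ^ k)" by (intro mult_left_mono nn) auto
    also have "\<dots> = ennreal ((1/4) ^ k)" by (simp add: ennreal_mult[symmetric] power_mult_distrib[symmetric])
    finally show ?thesis .
  qed
  then have "(\<Sum>k. \<integral>\<^sup>+x. w k x \<partial>M) \<le> (\<Sum>k. ennreal ((1/4) ^ k))" by (intro suminf_le) auto
  also have "\<dots> < \<infinity>" by (subst suminf_ennreal2) (auto simp: summable_geometric)
  finally have "(\<integral>\<^sup>+x. (\<Sum>k. w k x) \<partial>M) \<noteq> \<infinity>" by (subst nn_integral_suminf) auto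
  then have ae: "AE x in M. (\<Sum>k. w k x) \<noteq> \<infinity>" by (rule nn_integral_PInf_AE[rotated]) measurable
  have conv: "convergent (\<lambda>k. f k x)" if x: "(\<Sum>k. w k x) \<noteq> \<infinity>" for x
  proof -
    have "summable (\<lambda>k. 2 ^ k * (cmod (f (Suc k) x - f k x))\<^sup>2)"
      using x unfolding w_def by (intro summable_suminf_not_top) auto
    then have "summable (\<lambda>k. 2 ^ k * (cmod (f (Suc k) x - f k x))\<^sup>2 + (1/2::real) ^ k)"
      by (intro summable_add) (auto simp: summable_geometric)
    then have "summable (\<lambda>k. f (Suc k) x - f k x)"
    proof (rule summable_comparison_test'[where N = 0])
      fix k
      let ?a = "cmod (f (Suc k) x - f k x)"
      have "2 ^ k * ?a\<^sup>2 + (1/2) ^ k - 2 * ?a = 2 ^ k * (?a - (1/2) ^ k)\<^sup>2"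
        by (simp add: power2_diff algebra_simps power2_eq_square flip: power_mult_distrib)
      moreover have "0 \<le> 2 ^ k * (?a - (1/2) ^ k)\<^sup>2" by simp
      ultimately have "2 * ?a \<le> 2 ^ k * ?a\<^sup>2 + (1/2) ^ k" by linarith
      moreover have "?a \<ge> 0" by simp
      ultimately show "norm (f (Suc k) x - f k x) \<le> 2 ^ k * ?a\<^sup>2 + (1/2) ^ k" by linarith
    qed
    then have "convergent (\<lambda>k. \<Sum>i<k. f (Suc i) x - f i x)" by (simp add: summable_iff_convergent)
    then have "convergent (\<lambda>k. f k x - f 0 x)" by (simp only: sum_lessThan_telescope[of "\<lambda>i. f i x"])
    then obtain l where "(\<lambda>k. f k x - f 0 x) \<longlonglongrightarrow> l" by (auto simp: convergent_def)
    from tendsto_add[OF this tendsto_const[of "f 0 x"]] show ?thesis by (auto simp: convergent_def)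
  qed
  define g where "g x = lim (\<lambda>k. f k x)" for x
  have [measurable]: "g \<in> borel_measurable M" unfolding g_def [abs_def] by measurable
  have lim: "AE x in M. (\<lambda>k. f k x) \<longlonglongrightarrow> g x"
    using ae by eventually_elim (use conv in \<open>auto simp: g_def convergent_LIMSEQ_iff\<close>)
  \<comment> \<open>Fatou's lemma carries the Cauchy bound over to the limit.\<close>
  have nng: "(\<integral>\<^sup>+x. ennreal ((cmod (f k x - g x))\<^sup>2) \<partial>M) \<le> ennreal ((1/8) ^ k)" for k
  proof -
    have "(\<integral>\<^sup>+x. ennreal ((cmod (f k x - g x))\<^sup>2) \<partial>M)
        = (\<integral>\<^sup>+x. liminf (\<lambda>j. ennreal ((cmod (f j x - f k x))\<^sup>2)) \<partial>M)"
    proof (rule nn_integral_cong_AE)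
      show "AE x in M. ennreal ((cmod (f k x - g x))\<^sup>2) = liminf (\<lambda>j. ennreal ((cmod (f j x - f k x))\<^sup>2))"
        using lim
      proof eventually_elim
        case (elim x)
        then have "(\<lambda>j. ennreal ((cmod (f j x - f k x))\<^sup>2)) \<longlonglongrightarrow> ennreal ((cmod (g x - f k x))\<^sup>2)"
          by (intro tendsto_intros)
        then show ?case
          by (simp only: norm_minus_commute[of "f k x"] lim_imp_Liminf[OF sequentially_bot])
      qed
    qed
    also have "\<dots> \<le> liminf (\<lambda>j. \<integral>\<^sup>+x. ennreal ((cmod (f j x - f k x))\<^sup>2) \<partial>M)"
      by (rule nn_integral_liminf) measurable
    also have "\<dots> \<le> liminf (\<lambda>j. ennreal ((1/8) ^ k))"
      by (intro Liminf_mono eventually_sequentiallyI[of k] nn)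
    finally show ?thesis by (simp add: Liminf_const)
  qed
  have int: "integrable M (\<lambda>x. (cmod (f k x - g x))\<^sup>2)" for k
    using nng[of k] by (intro integrableI_bounded) (auto simp: order_le_less_trans)
  have "square_integrable M (\<lambda>x. f 0 x - g x)" using int[of 0] unfolding square_integrable_def by auto
  from square_integrable_diff[OF f[of 0] this] have "square_integrable M g" by simp
  moreover have "(\<integral>x. (cmod (f k x - g x))\<^sup>2 \<partial>M) \<le> (1/8) ^ k" for k
    using nng[of k] by (subst (asm) nn_integral_eq_integral[OF int]) auto
  ultimately show thesis by (rule that)
qed

text \<open>
  \<open>S\<close> need be neither closed nor dense: the representing function is the \<open>L\<^sup>2\<close> limit of a minimising sequence of
  \<open>\<phi> \<mapsto> \<parallel>\<phi>\<parallel>\<^sup>2 - 2 Re (l \<phi>)\<close>.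
\<close>

lemma square_integrable_riesz:
  fixes l :: "('a \<Rightarrow> complex) \<Rightarrow> complex"
  assumes S: "S \<noteq> {}" "\<And>\<phi>. \<phi> \<in> S \<Longrightarrow> square_integrable M \<phi>"
      "\<And>\<phi> \<psi> a c. \<phi> \<in> S \<Longrightarrow> \<psi> \<in> S \<Longrightarrow> (\<lambda>x. a * \<phi> x + c * \<psi> x) \<in> S"
    and lin: "\<And>\<phi> \<psi> a c. \<phi> \<in> S \<Longrightarrow> \<psi> \<in> S \<Longrightarrow> l (\<lambda>x. a * \<phi> x + c * \<psi> x) = a * l \<phi> + c * l \<psi>"
    and bd: "\<And>\<phi>. \<phi> \<in> S \<Longrightarrow> (cmod (l \<phi>))\<^sup>2 \<le> A * (\<integral>x. (cmod (\<phi> x))\<^sup>2 \<partial>M)" and A: "A \<ge> 0"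
  obtains g where "square_integrable M g" "(\<integral>x. (cmod (g x))\<^sup>2 \<partial>M) \<le> A"
    "\<And>\<phi>. \<phi> \<in> S \<Longrightarrow> (\<integral>x. g x * \<phi> x \<partial>M) = l \<phi>"
proof -
  define N where "N f = (\<integral>x. (cmod (f x))\<^sup>2 \<partial>M)" for f :: "'a \<Rightarrow> complex"
  define J where "J \<phi> = N \<phi> - 2 * Re (l \<phi>)" for \<phi>
  have N0: "N f \<ge> 0" for f by (simp add: N_def)
  \<comment> \<open>|Re (l \<phi>)| is at most the geometric mean of \<open>A\<close> and
    \<open>N \<phi>\<close>, hence at most \<open>(A + N \<phi>) / 2\<close>.\<close>
  have "- A \<le> J \<phi>" if "\<phi> \<in> S" for \<phi>
  proof -
    have "(Re (l \<phi>))\<^sup>2 \<le> (cmod (l \<phi>))\<^sup>2"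
      using abs_Re_le_cmod[of "l \<phi>"] by (metis abs_ge_zero power2_abs power_mono)
    then have "(Re (l \<phi>))\<^sup>2 \<le> A * N \<phi>" using bd[OF that] by (simp add: N_def)
    also have "A * N \<phi> \<le> ((A + N \<phi>) / 2)\<^sup>2"
      using sum_squares_bound[of A "N \<phi>"] by (simp add: power2_eq_square field_simps)
    finally have "\<bar>Re (l \<phi>)\<bar> \<le> \<bar>(A + N \<phi>) / 2\<bar>" by (simp only: abs_le_square_iff)
    then have "\<bar>Re (l \<phi>)\<bar> \<le> (A + N \<phi>) / 2" using A N0[of \<phi>] by simp
    then show ?thesis unfolding J_def by (simp add: abs_le_iff)
  qed
  then have bdd: "bdd_below (J ` S)" by (auto intro!: bdd_belowI)
  define d where "d = Inf (J ` S)"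
  have d: "d \<le> J \<phi>" if "\<phi> \<in> S" for \<phi> unfolding d_def using bdd that by (intro cInf_lower) auto
  \<comment> \<open>The parallelogram law will bound squared distances by
    \<open>4 * \<epsilon> k\<close>; the factor 1/4 turns this into the rate that
    \<open>square_integrable_complete\<close> requires.\<close>
  define \<epsilon> where "\<epsilon> k = (1/4) * (1/8 :: real) ^ k" for k :: nat
  have "\<exists>\<phi>\<in>S. J \<phi> < d + \<epsilon> k" for k
    using cInf_lessD[of "J ` S" "d + \<epsilon> k"] S(1) by (auto simp: d_def \<epsilon>_def)
  then obtain \<phi> where \<phi>: "\<And>k. \<phi> k \<in> S" "\<And>k. J (\<phi> k) < d + \<epsilon> k" by metis
  have cauchy: "N (\<lambda>x. \<phi> j x - \<phi> k x) \<le> (1/8) ^ k" if "k \<le> j" for j k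
  proof -
    let ?m = "\<lambda>x. 1/2 * \<phi> j x + 1/2 * \<phi> k x"
    have "d \<le> J ?m" by (intro d S \<phi>)
    moreover have "4 * J ?m = 2 * J (\<phi> j) + 2 * J (\<phi> k) - N (\<lambda>x. \<phi> j x - \<phi> k x)"
      using integral_parallelogram[OF S(2)[OF \<phi>(1)] S(2)[OF \<phi>(1)], of j k] lin[OF \<phi>(1) \<phi>(1), of "1/2" j "1/2" k]
      unfolding J_def N_def by (simp add: algebra_simps)
    ultimately have "N (\<lambda>x. \<phi> j x - \<phi> k x) \<le> 2 * \<epsilon> j + 2 * \<epsilon> k" using \<phi>(2)[of j] \<phi>(2)[of k] by linarith
    moreover have "\<epsilon> j \<le> \<epsilon> k" unfolding \<epsilon>_def using that by (intro mult_left_mono power_decreasing) auto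
    ultimately have "N (\<lambda>x. \<phi> j x - \<phi> k x) \<le> 4 * \<epsilon> k" by linarith
    then show ?thesis by (simp add: \<epsilon>_def)
  qed
  obtain h where h: "square_integrable M h" "\<And>k. N (\<lambda>x. \<phi> k x - h x) \<le> (1/8) ^ k"
  proof (rule square_integrable_complete[OF S(2)[OF \<phi>(1)] cauchy[unfolded N_def]])
    fix g
    assume "square_integrable M g" "\<And>k. (\<integral>x. (cmod (\<phi> k x - g x))\<^sup>2 \<partial>M) \<le> (1/8) ^ k"
    then show thesis using that[of g] by (simp add: N_def)
  qed
  have N_lim: "(\<lambda>k. N (\<lambda>x. \<phi> k x - h x)) \<longlonglongrightarrow> 0"
  proof (rule Lim_null_comparison[OF always_eventually[rule_format]])
    show "norm (N (\<lambda>x. \<phi> k x - h x)) \<le> (1/8) ^ k" for k using h(2)[of k] N0 by simp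
    show "(\<lambda>k. (1/8 :: real) ^ k) \<longlonglongrightarrow> 0" by (rule LIMSEQ_realpow_zero) auto
  qed
  have inner_lim: "(\<lambda>k. \<integral>x. \<psi> x * (\<phi> k x - h x) \<partial>M) \<longlonglongrightarrow> 0" if "square_integrable M \<psi>" for \<psi>
  proof -
    have "(\<lambda>k. sqrt (N \<psi> * N (\<lambda>x. \<phi> k x - h x))) \<longlonglongrightarrow> sqrt (N \<psi> * 0)"
      by (intro tendsto_intros N_lim)
    then have "(\<lambda>k. sqrt (N \<psi> * N (\<lambda>x. \<phi> k x - h x))) \<longlonglongrightarrow> 0" by simp
    moreover have "cmod (\<integral>x. \<psi> x * (\<phi> k x - h x) \<partial>M) \<le> sqrt (N \<psi> * N (\<lambda>x. \<phi> k x - h x))" for k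
      using integral_Cauchy_Schwarz[OF that square_integrable_diff[OF S(2)[OF \<phi>(1)] h(1)], of k]
      unfolding N_def by (intro real_le_rsqrt)
    ultimately show ?thesis by (rule Lim_null_comparison[OF always_eventually[rule_format], rotated])
  qed
  \<comment> \<open>First variation: moving \<open>\<phi> k\<close> by a multiple \<open>t\<close>
    of \<open>\<psi>\<close> cannot lower \<open>J\<close> by more than \<open>\<epsilon> k\<close>.
    In the limit a quadratic in \<open>t\<close> without constant term is nonnegative, so its linear
    coefficient vanishes.\<close>
  have Re_eq: "Re (\<integral>x. cnj (h x) * \<psi> x \<partial>M) = Re (l \<psi>)" if \<psi>: "\<psi> \<in> S" for \<psi>
  proof -
    define R where "R k = Re (\<integral>x. cnj (\<phi> k x) * \<psi> x \<partial>M) - Re (l \<psi>)" for k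
    define R' where "R' = Re (\<integral>x. cnj (h x) * \<psi> x \<partial>M) - Re (l \<psi>)"
    have diff: "cnj (\<integral>x. cnj (\<psi> x) * (\<phi> k x - h x) \<partial>M) = (\<integral>x. cnj (\<phi> k x) * \<psi> x \<partial>M) - (\<integral>x. cnj (h x) * \<psi> x \<partial>M)" for k
    proof -
      have "cnj (\<integral>x. cnj (\<psi> x) * (\<phi> k x - h x) \<partial>M) = (\<integral>x. cnj (cnj (\<psi> x) * (\<phi> k x - h x)) \<partial>M)"
        by (rule Bochner_Integration.integral_cnj[symmetric])
      also have "\<dots> = (\<integral>x. cnj (\<phi> k x) * \<psi> x - cnj (h x) * \<psi> x \<partial>M)"
        by (simp add: algebra_simps)
      also have "\<dots> = (\<integral>x. cnj (\<phi> k x) * \<psi> x \<partial>M) - (\<integral>x. cnj (h x) * \<psi> x \<partial>M)"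
        by (intro Bochner_Integration.integral_diff integrable_mult_square_integrable square_integrable_cnj S(2) \<phi> \<psi> h)
      finally show ?thesis .
    qed
    have "(\<lambda>k. cnj (\<integral>x. cnj (\<psi> x) * (\<phi> k x - h x) \<partial>M)) \<longlonglongrightarrow> cnj 0"
      by (intro tendsto_cnj inner_lim square_integrable_cnj S(2) \<psi>)
    then have "(\<lambda>k. (\<integral>x. cnj (\<phi> k x) * \<psi> x \<partial>M) - (\<integral>x. cnj (h x) * \<psi> x \<partial>M)) \<longlonglongrightarrow> 0"
      unfolding diff by simp
    then have "(\<lambda>k. \<integral>x. cnj (\<phi> k x) * \<psi> x \<partial>M) \<longlonglongrightarrow> (\<integral>x. cnj (h x) * \<psi> x \<partial>M)"
      by (simp add: LIM_zero_iff)
    then have R_lim: "R \<longlonglongrightarrow> R'" unfolding R_def [abs_def] R'_def by (intro tendsto_intros)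
    have ineq: "0 \<le> 2 * t * R' + t\<^sup>2 * N \<psi>" for t
    proof -
      have "0 \<le> \<epsilon> k + (2 * t * R k + t\<^sup>2 * N \<psi>)" for k
      proof -
        have "d \<le> J (\<lambda>x. 1 * \<phi> k x + of_real t * \<psi> x)" by (intro d S \<phi> \<psi>)
        also have "\<dots> = J (\<phi> k) + (2 * t * R k + t\<^sup>2 * N \<psi>)"
          using integral_norm_square_add[OF S(2)[OF \<phi>(1)] S(2)[OF \<psi>], of k t] lin[OF \<phi>(1) \<psi>, of 1 k "of_real t"]
          unfolding J_def N_def R_def by (simp add: algebra_simps)
        finally show ?thesis using \<phi>(2)[of k] by linarith
      qed
      moreover have "(\<lambda>k. \<epsilon> k + (2 * t * R k + t\<^sup>2 * N \<psi>)) \<longlonglongrightarrow> (1/4) * 0 + (2 * t * R' + t\<^sup>2 * N \<psi>)"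
        unfolding \<epsilon>_def by (intro tendsto_intros R_lim LIMSEQ_realpow_zero) auto
      ultimately show ?thesis by (intro LIMSEQ_le_const) auto
    qed
    have "R' = 0"
    proof (rule ccontr)
      assume R': "R' \<noteq> 0"
      \<comment> \<open>Adding 1 keeps the step well defined when \<open>N \<psi> = 0\<close>; the
        quadratic is still negative there.\<close>
      let ?t = "- R' / (N \<psi> + 1)"
      have "2 * ?t * R' + ?t\<^sup>2 * N \<psi> = - (R'\<^sup>2 * (N \<psi> + 2)) / (N \<psi> + 1)\<^sup>2"
        using N0[of \<psi>] by (simp add: divide_simps power2_eq_square) (simp add: algebra_simps)
      also have "\<dots> < 0" using R' N0[of \<psi>] by (intro divide_neg_pos) (auto simp: add_nonneg_pos zero_less_power2)
      finally show False using ineq[of ?t] by linarith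
    qed
    then show ?thesis by (simp add: R'_def)
  qed
  have eq: "(\<integral>x. cnj (h x) * \<psi> x \<partial>M) = l \<psi>" if \<psi>: "\<psi> \<in> S" for \<psi>
  proof (rule complex_eqI)
    show "Re (\<integral>x. cnj (h x) * \<psi> x \<partial>M) = Re (l \<psi>)" by (rule Re_eq[OF \<psi>])
    \<comment> \<open>Real parts at \<open>\<i> * \<psi>\<close> are negative imaginary parts at
      \<open>\<psi>\<close>; the summand \<open>0 * \<psi> x\<close> fits the closure
      hypothesis.\<close>
    have S': "(\<lambda>x. \<i> * \<psi> x + 0 * \<psi> x) \<in> S" by (intro S \<psi>)
    have "(\<integral>x. cnj (h x) * (\<i> * \<psi> x + 0 * \<psi> x) \<partial>M) = (\<integral>x. \<i> * (cnj (h x) * \<psi> x) \<partial>M)"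
      by (simp add: mult_ac)
    then have "(\<integral>x. cnj (h x) * (\<i> * \<psi> x + 0 * \<psi> x) \<partial>M) = \<i> * (\<integral>x. cnj (h x) * \<psi> x \<partial>M)" by simp
    then show "Im (\<integral>x. cnj (h x) * \<psi> x \<partial>M) = Im (l \<psi>)"
      using Re_eq[OF S'] lin[OF \<psi> \<psi>, of \<i> 0] by simp
  qed
  \<comment> \<open>For the norm bound: \<open>l (\<phi> k)\<close> and \<open>N (\<phi> k)\<close>
    both tend to \<open>N h\<close>, so the bound on \<open>l\<close> becomes N(h)^2 \<le> A
    N(h).\<close>
  have "(\<lambda>k. \<integral>x. cnj (h x) * (\<phi> k x - h x) \<partial>M) \<longlonglongrightarrow> 0"
    by (intro inner_lim square_integrable_cnj h)
  then have X: "(\<lambda>k. (\<integral>x. cnj (h x) * (\<phi> k x - h x) \<partial>M) + of_real (N h)) \<longlonglongrightarrow> 0 + of_real (N h)"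
    by (intro tendsto_intros)
  have "(\<integral>x. cnj (h x) * (\<phi> k x - h x) \<partial>M) + of_real (N h) = l (\<phi> k)" for k
  proof -
    have "of_real (N h) = (\<integral>x. cnj (h x) * h x \<partial>M)"
      unfolding N_def by (simp only: integral_complex_of_real[symmetric] complex_norm_square mult.commute)
    moreover have "(\<integral>x. cnj (h x) * (\<phi> k x - h x) \<partial>M) = (\<integral>x. cnj (h x) * \<phi> k x \<partial>M) - (\<integral>x. cnj (h x) * h x \<partial>M)"
      unfolding right_diff_distrib
      by (intro Bochner_Integration.integral_diff integrable_mult_square_integrable square_integrable_cnj S(2) \<phi> h)
    ultimately show ?thesis using eq[OF \<phi>(1)] by simp
  qed
  with X have l_lim: "(\<lambda>k. l (\<phi> k)) \<longlonglongrightarrow> of_real (N h)" by simp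
  have N\<phi>: "N (\<phi> k) = N h + 2 * Re (\<integral>x. cnj (h x) * (\<phi> k x - h x) \<partial>M) + N (\<lambda>x. \<phi> k x - h x)" for k
    using integral_norm_square_add[OF h(1) square_integrable_diff[OF S(2)[OF \<phi>(1)] h(1)], of 1 k]
    unfolding N_def by simp
  have "(\<lambda>k. N (\<phi> k)) \<longlonglongrightarrow> N h + 2 * Re 0 + 0"
    unfolding N\<phi> by (intro tendsto_intros inner_lim square_integrable_cnj h N_lim)
  then have lim_A: "(\<lambda>k. A * N (\<phi> k)) \<longlonglongrightarrow> A * N h" by (intro tendsto_intros) simp
  have "(\<lambda>k. (cmod (l (\<phi> k)))\<^sup>2) \<longlonglongrightarrow> (cmod (of_real (N h)))\<^sup>2" by (intro tendsto_intros l_lim)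
  then have "(cmod (of_real (N h)))\<^sup>2 \<le> A * N h"
    by (rule LIMSEQ_le[OF _ lim_A]) (use bd[OF \<phi>(1)] in \<open>auto simp: N_def\<close>)
  then have "N h * N h \<le> A * N h" by (simp add: power2_eq_square)
  then have "N h \<le> A" using N0[of h] A by (cases "N h = 0") auto
  then have "N (\<lambda>x. cnj (h x)) \<le> A" by (simp add: N_def)
  with eq show thesis using that[OF square_integrable_cnj[OF h(1)]] by (simp add: N_def)
qed

text \<open>Used with \<open>s = 1\<close> to return from frequency to space and with
  \<open>s = - 1\<close> to transform L2 data. The constant 1 in the norm bound comes from
  Cauchy-Schwarz combined with Plancherel on Schwartz functions.\<close>

theorem FT_square_integrable:
  assumes f: "square_integrable (lborel_n n) f" and s: "\<bar>s\<bar> = 1"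
  shows "\<exists>g. square_integrable (lborel_n n) g \<and>
    (\<integral>x. (cmod (g x))\<^sup>2 \<partial>lborel_n n) \<le> (\<integral>x. (cmod (f x))\<^sup>2 \<partial>lborel_n n) \<and>
    (\<forall>\<psi>\<in>schwartz n. (\<integral>x. g x * \<psi> x \<partial>lborel_n n) = (\<integral>\<xi>. f \<xi> * FT s n \<psi> \<xi> \<partial>lborel_n n))"
proof -
  let ?M = "lborel_n n"
  have sq: "square_integrable ?M \<psi>" if "\<psi> \<in> schwartz n" for \<psi>
    using schwartz_measurable[OF that] schwartz_integrable_square[OF that] by (simp add: square_integrable_def)
  have F: "square_integrable ?M (FT s n \<psi>)" if "\<psi> \<in> schwartz n" for \<psi>
    by (intro sq FT_schwartz that s)
  have lin: "(\<integral>\<xi>. f \<xi> * FT s n (\<lambda>x. a * \<phi> x + c * \<psi> x) \<xi> \<partial>?M)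
      = a * (\<integral>\<xi>. f \<xi> * FT s n \<phi> \<xi> \<partial>?M) + c * (\<integral>\<xi>. f \<xi> * FT s n \<psi> \<xi> \<partial>?M)"
    if "\<phi> \<in> schwartz n" "\<psi> \<in> schwartz n" for \<phi> \<psi> a c
  proof -
    have "(\<integral>\<xi>. f \<xi> * FT s n (\<lambda>x. a * \<phi> x + c * \<psi> x) \<xi> \<partial>?M)
      = (\<integral>\<xi>. a * (f \<xi> * FT s n \<phi> \<xi>) + c * (f \<xi> * FT s n \<psi> \<xi>) \<partial>?M)"
      by (simp add: FT_linear[OF that] algebra_simps)
    then show ?thesis
      using integrable_mult_square_integrable[OF f F[OF that(1)]] integrable_mult_square_integrable[OF f F[OF that(2)]]
      by simp
  qed
  have bd: "(cmod (\<integral>\<xi>. f \<xi> * FT s n \<psi> \<xi> \<partial>?M))\<^sup>2 \<le> (\<integral>x. (cmod (f x))\<^sup>2 \<partial>?M) * (\<integral>x. (cmod (\<psi> x))\<^sup>2 \<partial>?M)"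
    if "\<psi> \<in> schwartz n" for \<psi>
    using integral_Cauchy_Schwarz[OF f F[OF that]] unfolding FT_plancherel[OF that s] .
  have zero: "(\<lambda>x. 0) \<in> schwartz n"
    by (rule schwartz_coinduct[of _ "{\<lambda>x. 0}"]) (auto simp: rapidly_decreasing_def has_partial_def)
  show ?thesis
  proof (rule square_integrable_riesz[of "schwartz n" ?M "\<lambda>\<psi>. \<integral>\<xi>. f \<xi> * FT s n \<psi> \<xi> \<partial>?M"
        "\<integral>x. (cmod (f x))\<^sup>2 \<partial>?M"])
    show "schwartz n \<noteq> {}" using zero by blast
  qed (use sq schwartz_lincomb lin bd in auto)
qed

section \<open>Schwartz functions separate measurable functions\<close>

text \<open>For a fixed \<open>q\<close> with values at least 1 this class is closed under
  differentiation, with \<open>j\<close> rising by one, and contains both the Gaussian and its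
  product with the cut-off 1/q.\<close>

definition gauss_quotients :: "real poly \<Rightarrow> (real \<Rightarrow> real) set" where
  "gauss_quotients q = {f. \<exists>p j. f = (\<lambda>x. poly p x / poly q x ^ j * exp (- x\<^sup>2))}"

text \<open>Follows from (1 + x^2/k)^k \<le> exp (x^2) and 1 + |x| \<le> (2k + 1)(1 + x^2/k); the
  latter rests on |x| \<le> 1 + x^2.\<close>

lemma power_exp_bounded: "(1 + \<bar>x\<bar>) ^ k * exp (- x\<^sup>2) \<le> (2 * real k + 1) ^ k" for x :: real
proof (cases "k = 0")
  case False
  have x: "\<bar>x\<bar> \<le> 1 + x\<^sup>2"
    using power2_diff[of "\<bar>x\<bar>" 1] zero_le_power2[of "\<bar>x\<bar> - 1"] by simp
  have "1 + \<bar>x\<bar> \<le> (2 * real k + 1) * (1 + x\<^sup>2 / real k)"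
  proof -
    have "(2 * real k + 1) * (1 + x\<^sup>2 / real k) = 2 * real k + 1 + 2 * x\<^sup>2 + x\<^sup>2 / real k"
      using False by (simp add: field_simps)
    moreover have "0 \<le> x\<^sup>2 / real k" "1 \<le> real k" "0 \<le> x\<^sup>2" using False by auto
    ultimately show ?thesis using x by linarith
  qed
  then have "(1 + \<bar>x\<bar>) ^ k \<le> ((2 * real k + 1) * (1 + x\<^sup>2 / real k)) ^ k" by (intro power_mono) auto
  also have "\<dots> = (2 * real k + 1) ^ k * (1 + x\<^sup>2 / real k) ^ k" by (rule power_mult_distrib)
  also have "\<dots> \<le> (2 * real k + 1) ^ k * exp (x\<^sup>2)"
    using False by (intro mult_left_mono exp_ge_one_plus_x_over_n_power_n) (auto intro: order_trans[of _ 0])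
  finally show ?thesis by (simp add: exp_minus field_simps)
qed simp

lemma poly_exp_bounded: "\<exists>M. \<forall>x::real. (1 + \<bar>x\<bar>) ^ k * (\<bar>poly p x\<bar> * exp (- x\<^sup>2)) \<le> M"
proof (induction p arbitrary: k)
  case 0
  then show ?case by auto
next
  case (pCons a p)
  obtain M where M: "\<And>x. (1 + \<bar>x\<bar>) ^ Suc k * (\<bar>poly p x\<bar> * exp (- x\<^sup>2)) \<le> M" using pCons(2) by blast
  have "(1 + \<bar>x\<bar>) ^ k * (\<bar>poly (pCons a p) x\<bar> * exp (- x\<^sup>2)) \<le> \<bar>a\<bar> * (2 * real k + 1) ^ k + M" for x
  proof -
    have "\<bar>poly (pCons a p) x\<bar> \<le> \<bar>a\<bar> + \<bar>x\<bar> * \<bar>poly p x\<bar>"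
      by (simp add: abs_mult[symmetric] abs_triangle_ineq)
    also have "\<dots> \<le> \<bar>a\<bar> + (1 + \<bar>x\<bar>) * \<bar>poly p x\<bar>" by (intro add_left_mono mult_right_mono) auto
    finally have "(1 + \<bar>x\<bar>) ^ k * (\<bar>poly (pCons a p) x\<bar> * exp (- x\<^sup>2))
        \<le> (1 + \<bar>x\<bar>) ^ k * ((\<bar>a\<bar> + (1 + \<bar>x\<bar>) * \<bar>poly p x\<bar>) * exp (- x\<^sup>2))"
      by (intro mult_left_mono mult_right_mono) auto
    also have "\<dots> = \<bar>a\<bar> * ((1 + \<bar>x\<bar>) ^ k * exp (- x\<^sup>2)) + (1 + \<bar>x\<bar>) ^ Suc k * (\<bar>poly p x\<bar> * exp (- x\<^sup>2))"
      by (simp add: algebra_simps)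
    also have "\<dots> \<le> \<bar>a\<bar> * (2 * real k + 1) ^ k + M"
      by (intro add_mono mult_left_mono power_exp_bounded M) auto
    finally show ?thesis .
  qed
  then show ?case by blast
qed

lemma gauss_quotients_bounded:
  assumes f: "f \<in> gauss_quotients q" and q: "\<And>x. poly q x \<ge> 1"
  shows "\<exists>M. \<forall>x. (1 + \<bar>x\<bar>) ^ k * \<bar>f x\<bar> \<le> M"
proof -
  obtain p j where f: "f = (\<lambda>x. poly p x / poly q x ^ j * exp (- x\<^sup>2))"
    using f by (auto simp: gauss_quotients_def)
  obtain M where M: "\<And>x. (1 + \<bar>x\<bar>) ^ k * (\<bar>poly p x\<bar> * exp (- x\<^sup>2)) \<le> M" using poly_exp_bounded by blast
  have "(1 + \<bar>x\<bar>) ^ k * \<bar>f x\<bar> \<le> M" for x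
  proof -
    have q1: "1 \<le> poly q x ^ j" using q[of x] by (rule one_le_power)
    have "\<bar>poly p x / poly q x ^ j\<bar> \<le> \<bar>poly p x\<bar> / 1"
      unfolding abs_divide using q1 by (intro frac_le) auto
    then have "\<bar>f x\<bar> \<le> \<bar>poly p x\<bar> * exp (- x\<^sup>2)"
      by (simp only: f abs_mult abs_exp_cancel div_by_1 mult_right_mono exp_ge_zero)
    then have "(1 + \<bar>x\<bar>) ^ k * \<bar>f x\<bar> \<le> (1 + \<bar>x\<bar>) ^ k * (\<bar>poly p x\<bar> * exp (- x\<^sup>2))"
      by (intro mult_left_mono) auto
    also have "\<dots> \<le> M" by (rule M)
    finally show ?thesis .
  qed
  then show ?thesis by blast
qed

lemma gauss_quotient_deriv_eq:
  fixes P P' Q Q' x e :: real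
  assumes "Q \<noteq> 0"
  shows "(P' * Q ^ j - P * (real j * (Q' * Q ^ (j - Suc 0)))) / (Q ^ j * Q ^ j) * e + e * (- 2 * x) * (P / Q ^ j)
    = (P' * Q - real j * (P * Q') - 2 * x * P * Q) / Q ^ Suc j * e"
proof -
  define c where "c = Q ^ j"
  have c: "c \<noteq> 0" using assms by (simp add: c_def)
  \<comment> \<open>For \<open>j = 0\<close> the truncated exponent is harmless, since the factor
    \<open>real j\<close> makes both sides vanish.\<close>
  have j: "real j * (Q' * Q ^ (j - Suc 0)) = real j * Q' * c / Q"
    using assms by (cases j) (simp_all add: c_def)
  show ?thesis using c assms unfolding j power_Suc c_def[symmetric]
    by (simp add: field_simps)
qed

lemma gauss_quotients_deriv:
  assumes f: "f \<in> gauss_quotients q" and q: "\<And>x. poly q x \<ge> 1"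
  shows "\<exists>g\<in>gauss_quotients q. \<forall>x. (f has_real_derivative g x) (at x)"
proof -
  obtain p j where f: "f = (\<lambda>x. poly p x / poly q x ^ j * exp (- x\<^sup>2))"
    using f by (auto simp: gauss_quotients_def)
  define r where "r = pderiv p * q - smult (of_nat j) (p * pderiv q) - [:0, 2:] * p * q"
  have "(f has_real_derivative poly r x / poly q x ^ Suc j * exp (- x\<^sup>2)) (at x)" for x
  proof -
    have q0: "poly q x \<noteq> 0" using q[of x] by auto
    have D1: "((\<lambda>x. poly q x ^ j) has_real_derivative of_nat j * (poly (pderiv q) x * poly q x ^ (j - Suc 0))) (at x)"
      by (rule DERIV_power[OF poly_DERIV])
    have D2: "((\<lambda>x. exp (- x\<^sup>2)) has_real_derivative exp (- x\<^sup>2) * (- 2 * x)) (at x)"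
      by (auto intro!: derivative_eq_intros)
    have q1: "poly q x ^ j \<noteq> 0" using q0 by simp
    have r: "poly r x = poly (pderiv p) x * poly q x - real j * (poly p x * poly (pderiv q) x)
        - 2 * x * poly p x * poly q x" by (simp add: r_def)
    show ?thesis
      using DERIV_mult[OF DERIV_divide[OF poly_DERIV[of p x] D1 q1] D2]
      unfolding f r gauss_quotient_deriv_eq[OF q0] .
  qed
  then show ?thesis
    unfolding gauss_quotients_def
    by (intro bexI[of _ "\<lambda>x. poly r x / poly q x ^ Suc j * exp (- x\<^sup>2)"] CollectI exI[of _ r]
      exI[of _ "Suc j"] allI refl)
qed

lemma one_plus_sum_le_prod:
  fixes x :: "'a \<Rightarrow> real"
  assumes "finite A"
  shows "1 + (\<Sum>i\<in>A. \<bar>x i\<bar>) \<le> (\<Prod>i\<in>A. 1 + \<bar>x i\<bar>)"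
  using assms
proof (induction A rule: finite_induct)
  case (insert a A)
  have P: "1 \<le> (\<Prod>i\<in>A. 1 + \<bar>x i\<bar>)" by (intro prod_ge_1) auto
  have "\<bar>x a\<bar> * 1 \<le> \<bar>x a\<bar> * (\<Prod>i\<in>A. 1 + \<bar>x i\<bar>)" by (intro mult_left_mono P) auto
  with insert show ?case by (simp add: algebra_simps)
qed simp

text \<open>A partial derivative in direction \<open>j\<close> replaces the j-th factor only, so
  tensor products form a closed family. Decay reduces to one variable because 1 + |x| is at most the
  product of the 1 + |x_i|.\<close>

lemma schwartz_gauss_quotients:
  assumes f: "\<And>i. f i \<in> gauss_quotients (q i)" and q: "\<And>i x. poly (q i) x \<ge> 1"
  shows "(\<lambda>x. of_real (\<Prod>i<n. f i (x i))) \<in> schwartz n"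
proof (rule schwartz_coinduct[of _
      "{\<lambda>x. of_real (\<Prod>i<n. f i (x i)) | f. \<forall>i. f i \<in> gauss_quotients (q i)}"], goal_cases)
  case 1
  then show ?case using f by blast
next
  case (2 g)
  then obtain f where g: "g = (\<lambda>x. of_real (\<Prod>i<n. f i (x i)))" and f: "\<And>i. f i \<in> gauss_quotients (q i)" by blast
  show ?case
    unfolding rapidly_decreasing_def
  proof
    fix k
    have "\<exists>M. \<forall>x. (1 + \<bar>x\<bar>) ^ k * \<bar>f i x\<bar> \<le> M" for i by (rule gauss_quotients_bounded[OF f q])
    then obtain M where M: "\<And>i x. (1 + \<bar>x\<bar>) ^ k * \<bar>f i x\<bar> \<le> M i" by metis
    have "(1 + L2_set x {..<n}) ^ k * cmod (g x) \<le> (\<Prod>i<n. M i)" for x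
    proof -
      have "1 + L2_set x {..<n} \<le> (\<Prod>i<n. 1 + \<bar>x i\<bar>)"
        using L2_set_le_sum_abs[of x "{..<n}"] one_plus_sum_le_prod[of "{..<n}" x] by simp
      then have "(1 + L2_set x {..<n}) ^ k * cmod (g x) \<le> (\<Prod>i<n. 1 + \<bar>x i\<bar>) ^ k * cmod (g x)"
        using L2_set_pos[of x "{..<n}"] by (intro mult_right_mono power_mono) auto
      also have "\<dots> = (\<Prod>i<n. (1 + \<bar>x i\<bar>) ^ k * \<bar>f i (x i)\<bar>)"
        unfolding g norm_of_real by (simp add: prod.distrib abs_prod prod_power_distrib)
      also have "\<dots> \<le> (\<Prod>i<n. M i)" using M by (intro prod_mono) auto
      finally show ?thesis .
    qed
    then show "\<exists>M. \<forall>x\<in>points n. (1 + L2_set x {..<n}) ^ k * cmod (g x) \<le> M" by blast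
  qed
next
  case (3 g j)
  then obtain f where g: "g = (\<lambda>x. of_real (\<Prod>i<n. f i (x i)))" and f: "\<And>i. f i \<in> gauss_quotients (q i)" by blast
  obtain f' where f': "f' \<in> gauss_quotients (q j)" "\<And>x. (f j has_real_derivative f' x) (at x)"
    using gauss_quotients_deriv[OF f q] by blast
  have split: "(\<Prod>i<n. h i (x i)) = h j (x j) * (\<Prod>i\<in>{..<n} - {j}. h i (x i))" for h :: "nat \<Rightarrow> real \<Rightarrow> real" and x
    using 3(2) by (intro prod.remove) auto
  have "has_partial n j g (\<lambda>x. of_real (\<Prod>i<n. (f(j := f')) i (x i)))"
    unfolding has_partial_def
  proof
    fix x :: "nat \<Rightarrow> real"
    let ?c = "\<Prod>i\<in>{..<n} - {j}. f i (x i)"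
    have "((\<lambda>s. f j s * ?c) has_real_derivative f' (x j) * ?c) (at (x j))"
      by (rule DERIV_cmult_right[OF f'(2)])
    then have "((\<lambda>s. complex_of_real (f j s * ?c)) has_vector_derivative of_real (f' (x j) * ?c)) (at (x j))"
      by (intro has_vector_derivative_of_real) (simp add: has_real_derivative_iff_has_vector_derivative)
    moreover have "(\<Prod>i\<in>{..<n} - {j}. f i ((x(j := s)) i)) = ?c" for s by (intro prod.cong) auto
    moreover have "(\<Prod>i\<in>{..<n} - {j}. (f(j := f')) i (x i)) = ?c" by (intro prod.cong) auto
    ultimately show "((\<lambda>s. g (x(j := s))) has_vector_derivative of_real (\<Prod>i<n. (f(j := f')) i (x i))) (at (x j))"
      unfolding g split[of f] split[of "f(j := f')"] by simp
  qed
  moreover have "\<forall>i. (f(j := f')) i \<in> gauss_quotients (q i)" using f f' by auto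
  ultimately show ?case by blast
qed

section \<open>Boxes as generators and rational cut-offs\<close>

lemma AE_coordinate_neq:
  assumes "i < n"
  shows "AE x in lborel_n n. x i \<noteq> a"
proof (rule AE_I[where N = "Pi\<^sub>E {..<n} (\<lambda>j. if j = i then {a} else UNIV)"])
  have "emeasure (lborel_n n) (Pi\<^sub>E {..<n} (\<lambda>j. if j = i then {a} else UNIV))
      = (\<Prod>j<n. emeasure lborel (if j = i then {a} else UNIV))"
    by (intro lbp.emeasure_PiM) auto
  \<comment> \<open>The one-point factor has measure 0, which annihilates any infinite
    factors.\<close>
  also have "\<dots> = 0" using assms by (intro prod_zero bexI[of _ i]) auto
  finally show "emeasure (lborel_n n) (Pi\<^sub>E {..<n} (\<lambda>j. if j = i then {a} else UNIV)) = 0" .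
  show "Pi\<^sub>E {..<n} (\<lambda>j. if j = i then {a} else UNIV) \<in> sets (lborel_n n)"
    by (rule sets_PiM_I_finite) auto
  show "{x \<in> points n. \<not> x i \<noteq> a} \<subseteq> Pi\<^sub>E {..<n} (\<lambda>j. if j = i then {a} else UNIV)"
    by (auto simp: space_PiM PiE_def)
qed

text \<open>The even exponent makes the expression a function of \<open>t\<^sup>2\<close>. At |t| =
  1 its value is 1/2 for every \<open>k\<close>, so the faces of a box have to be removed as a null
  set.\<close>

lemma cutoff_tendsto:
  fixes t :: real
  assumes "\<bar>t\<bar> \<noteq> 1"
  shows "(\<lambda>k. 1 / (1 + t ^ (2 * k))) \<longlonglongrightarrow> (if \<bar>t\<bar> < 1 then 1 else 0)"
proof (cases "\<bar>t\<bar> < 1")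
  case True
  then have "t\<^sup>2 < 1" by (simp only: abs_square_less_1)
  then have "(\<lambda>k. (t\<^sup>2) ^ k) \<longlonglongrightarrow> 0" using LIMSEQ_realpow_zero[of "t\<^sup>2"] by simp
  from tendsto_divide[OF tendsto_const tendsto_add[OF tendsto_const this], of 1 1]
  have "(\<lambda>k. 1 / (1 + (t\<^sup>2) ^ k)) \<longlonglongrightarrow> 1 / (1 + 0)" by simp
  then show ?thesis using True by (simp add: power_mult)
next
  case False
  with assms have "1 < \<bar>t\<bar>" by simp
  then have "1 < t\<^sup>2" using one_less_power[of "\<bar>t\<bar>" 2] by simp
  then have lim: "(\<lambda>k. inverse ((t\<^sup>2) ^ k)) \<longlonglongrightarrow> 0" by (rule LIMSEQ_inverse_realpow_zero)
  have "norm (1 / (1 + (t\<^sup>2) ^ k)) \<le> inverse ((t\<^sup>2) ^ k)" for k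
  proof -
    have "0 < (t\<^sup>2) ^ k" using \<open>1 < t\<^sup>2\<close> by (intro zero_less_power[of "t\<^sup>2"]) linarith
    then show ?thesis by (simp add: field_simps)
  qed
  then have "(\<lambda>k. 1 / (1 + (t\<^sup>2) ^ k)) \<longlonglongrightarrow> 0"
    by (rule Lim_null_comparison[OF always_eventually[rule_format] lim])
  then show ?thesis using False by (simp add: power_mult)
qed

text \<open>Supplies the generator for a Dynkin argument; with arbitrary endpoints, empty
  intersections are again boxes.\<close>

lemma sets_lborel_n_boxes:
  "sets (lborel_n n) = sigma_sets (points n) {Pi\<^sub>E {..<n} (\<lambda>i. {a i<..<b i}) | a b. True}"
proof -
  let ?E = "range (\<lambda>(a, b). {a<..<b}) :: real set set"
  let ?P = "{{f \<in> (\<Pi>\<^sub>E i\<in>{..<n}. UNIV). \<forall>i\<in>j. f i \<in> A i} | A j. j \<in> {{..<n}} \<and> A \<in> Pi j (\<lambda>_. ?E)}"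
  have "sets (lborel_n n) = sets (Pi\<^sub>M {..<n} (\<lambda>_. sigma UNIV ?E))"
    using borel_eq_box[where 'a = real] by (intro sets_PiM_cong) (auto simp: box_real)
  also have "\<dots> = sets (sigma (\<Pi>\<^sub>E i\<in>{..<n}. UNIV) ?P)"
  proof (rule sets_PiM_sigma)
    fix i
    have "(UNIV :: real set) = (\<Union>k::nat. {- real k<..<real k})"
    proof safe
      fix x :: real
      obtain k :: nat where "\<bar>x\<bar> < real k" using reals_Archimedean2 by blast
      then show "x \<in> (\<Union>k::nat. {- real k<..<real k})" by (intro UN_I[of k]) auto
    qed auto
    then show "\<exists>S\<subseteq>?E. countable S \<and> UNIV = \<Union>S"
      by (intro exI[of _ "range (\<lambda>k::nat. {- real k<..<real k})"]) auto
  qed auto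
  also have "?P = {Pi\<^sub>E {..<n} (\<lambda>i. {a i<..<b i}) | a b. True}"
  proof (intro set_eqI iffI)
    fix X :: "(nat \<Rightarrow> real) set" assume "X \<in> ?P"
    then obtain A where X: "X = {f \<in> (\<Pi>\<^sub>E i\<in>{..<n}. UNIV). \<forall>i\<in>{..<n}. f i \<in> A i}" and A: "A \<in> {..<n} \<rightarrow> ?E" by auto
    have "\<forall>i\<in>{..<n}. \<exists>a b. A i = {a<..<b}" using A by fastforce
    then obtain a b where ab: "\<And>i. i < n \<Longrightarrow> A i = {a i<..<b i}" by (metis lessThan_iff)
    have "X = Pi\<^sub>E {..<n} (\<lambda>i. {a i<..<b i})" unfolding X using ab by (auto simp: PiE_def Pi_def)
    then show "X \<in> {Pi\<^sub>E {..<n} (\<lambda>i. {a i<..<b i}) | a b. True}" by blast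
  next
    fix X :: "(nat \<Rightarrow> real) set" assume "X \<in> {Pi\<^sub>E {..<n} (\<lambda>i. {a i<..<b i}) | a b. True}"
    then obtain a b where X: "X = Pi\<^sub>E {..<n} (\<lambda>i. {a i<..<b i})" by blast
    have "X = {f \<in> (\<Pi>\<^sub>E i\<in>{..<n}. UNIV). \<forall>i\<in>{..<n}. f i \<in> {a i<..<b i}}"
      unfolding X by (auto simp: PiE_def Pi_def)
    then show "X \<in> ?P" by (intro CollectI exI[of _ "\<lambda>i. {a i<..<b i}"] exI[of _ "{..<n}"]) auto
  qed
  finally show ?thesis
    by (simp add: space_PiM) (subst sets_measure_of, auto)
qed

text \<open>Dynkin argument: the sets over which \<open>f\<close> integrates to 0 include the boxes
  and are closed under complements and countable disjoint unions. Real and imaginary parts then have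
  zero integral over every measurable set and vanish almost everywhere.\<close>

lemma AE_eq_0_of_box_integrals:
  fixes f :: "(nat \<Rightarrow> real) \<Rightarrow> complex"
  assumes int: "integrable (lborel_n n) f"
    and box: "\<And>a b. (\<integral>x. indicator (Pi\<^sub>E {..<n} (\<lambda>i. {a i<..<b i})) x *\<^sub>R f x \<partial>lborel_n n) = 0"
  shows "AE x in lborel_n n. f x = 0"
proof -
  let ?M = "lborel_n n"
  let ?G = "{Pi\<^sub>E {..<n} (\<lambda>i. {a i<..<b i}) | a b. True} :: (nat \<Rightarrow> real) set set"
  have set_int: "set_integrable ?M A f" if "A \<in> sets ?M" for A
    using int that unfolding set_integrable_def by (rule integrable_mult_indicator[rotated])
  \<comment> \<open>The complement step needs the integral over the whole space, obtained by
    exhausting it with growing cubes.\<close>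
  have total: "(\<integral>x. f x \<partial>?M) = 0"
  proof -
    let ?B = "\<lambda>k::nat. Pi\<^sub>E {..<n} (\<lambda>_. {- real k<..<real k})"
    have "(\<lambda>k. \<integral>x. indicator (?B k) x *\<^sub>R f x \<partial>?M) \<longlonglongrightarrow> (\<integral>x. f x \<partial>?M)"
    proof (rule integral_dominated_convergence[where w = "\<lambda>x. cmod (f x)"])
      have [measurable]: "?B k \<in> sets ?M" for k by (intro sets_PiM_I_finite) auto
      show "(\<lambda>x. indicator (?B k) x *\<^sub>R f x) \<in> borel_measurable ?M" for k using int by measurable
      show "AE x in ?M. (\<lambda>k. indicator (?B k) x *\<^sub>R f x) \<longlonglongrightarrow> f x"
      proof (rule AE_I2)
        fix x assume x: "x \<in> points n"
        obtain K :: nat where K: "(\<Sum>i<n. \<bar>x i\<bar>) < real K" using reals_Archimedean2 by blast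
        have "x \<in> ?B k" if "K \<le> k" for k
        proof -
          have "\<bar>x i\<bar> < real k" if "i < n" for i
            using member_le_sum[of i "{..<n}" "\<lambda>i. \<bar>x i\<bar>"] that K \<open>K \<le> k\<close> by force
          then show ?thesis using x by (force simp: space_PiM PiE_def Pi_def abs_less_iff)
        qed
        then have "eventually (\<lambda>k. indicator (?B k) x *\<^sub>R f x = f x) sequentially"
          by (intro eventually_sequentiallyI[of K]) simp
        then show "(\<lambda>k. indicator (?B k) x *\<^sub>R f x) \<longlonglongrightarrow> f x" by (rule tendsto_eventually)
      qed
    qed (use int in \<open>auto simp: indicator_def\<close>)
    then show ?thesis unfolding box by (metis LIMSEQ_unique tendsto_const)
  qed
  have "(LINT x:A|?M. f x) = 0" if "A \<in> sets ?M" for A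
  proof -
    have stable: "Int_stable ?G"
    proof (rule Int_stableI)
      fix X Y assume "X \<in> ?G" "Y \<in> ?G"
      then obtain a b c d where X: "X = Pi\<^sub>E {..<n} (\<lambda>i. {a i<..<b i})" and Y: "Y = Pi\<^sub>E {..<n} (\<lambda>i. {c i<..<d i})"
        by blast
      have "X \<inter> Y = Pi\<^sub>E {..<n} (\<lambda>i. {max (a i) (c i)<..<min (b i) (d i)})"
        unfolding X Y by (auto simp: PiE_def Pi_def)
      then show "X \<inter> Y \<in> ?G" by (intro CollectI exI[of _ "\<lambda>i. max (a i) (c i)"] exI[of _ "\<lambda>i. min (b i) (d i)"]) simp
    qed
    have "?G \<subseteq> Pow (points n)" by (auto simp: space_PiM PiE_def)
    from stable this that[unfolded sets_lborel_n_boxes] show ?thesis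
    proof (induction rule: sigma_sets_induct_disjoint)
      case (basic A)
      then show ?case using box by (auto simp: set_lebesgue_integral_def)
    next
      case empty
      then show ?case by (simp add: set_lebesgue_integral_def)
    next
      case (compl A)
      then have A: "A \<in> sets ?M" by (simp add: sets_lborel_n_boxes)
      have "(LINT x:points n|?M. f x) = (LINT x:(points n - A) \<union> A|?M. f x)"
        using sets.sets_into_space[OF A] by (intro arg_cong[where f = "\<lambda>A. set_lebesgue_integral ?M A f"]) auto
      also have "\<dots> = (LINT x:points n - A|?M. f x) + (LINT x:A|?M. f x)"
        using A by (intro set_integral_Un set_int) auto
      finally show ?case
        using compl total by (simp add: set_integral_space int)
    next
      case (union A)
      then have "\<And>i. A i \<in> sets ?M" by (auto simp: sets_lborel_n_boxes)
      then have "(LINT x:(\<Union>i. A i)|?M. f x) = (\<Sum>i. (LINT x:(A i)|?M. f x))"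
        using union(1) by (intro lebesgue_integral_countable_add set_int) (auto simp: disjoint_family_on_def)
      then show ?case using union by simp
    qed
  qed
  note zero = this
  have "(LINT x:A|?M. Re (f x)) = (LINT x:A|?M. 0)" "(LINT x:A|?M. Im (f x)) = (LINT x:A|?M. 0)" if "A \<in> sets ?M" for A
    using zero[OF that] set_int[OF that] integral_Re[of ?M "\<lambda>x. indicator A x *\<^sub>R f x"]
      integral_Im[of ?M "\<lambda>x. indicator A x *\<^sub>R f x"]
    unfolding set_lebesgue_integral_def set_integrable_def by simp_all
  then have "AE x in ?M. Re (f x) = 0" "AE x in ?M. Im (f x) = 0"
    using int by (auto intro!: density_unique_real integrable_Re integrable_Im)
  then show ?thesis by eventually_elim (simp add: complex_eq_iff)
qed

text \<open>
  The rational cut-offs \<open>1 / (1 + ((x - c) / r) ^ (2 * k))\<close> are bounded by 1 and converge to the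
  indicator of an interval, and remain Schwartz after multiplication by a Gaussian.
\<close>

theorem schwartz_separating:
  fixes h :: "(nat \<Rightarrow> real) \<Rightarrow> complex"
  assumes [measurable]: "h \<in> borel_measurable (lborel_n n)"
    and int: "\<And>\<phi>. \<phi> \<in> schwartz n \<Longrightarrow> integrable (lborel_n n) (\<lambda>x. h x * \<phi> x)"
    and zero: "\<And>\<phi>. \<phi> \<in> schwartz n \<Longrightarrow> (\<integral>x. h x * \<phi> x \<partial>lborel_n n) = 0"
  shows "AE x in lborel_n n. h x = 0"
proof -
  let ?M = "lborel_n n"
  \<comment> \<open>The Gaussian turns \<open>h\<close> into the integrable function
    \<open>h * G\<close> and never vanishes, so it can be divided out at the end.\<close>
  define G where "G x = complex_of_real (\<Prod>i<n. exp (- (x i)\<^sup>2))" for x :: "nat \<Rightarrow> real"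
  have "(\<lambda>x. exp (- x\<^sup>2)) \<in> gauss_quotients 1"
    unfolding gauss_quotients_def by (intro CollectI exI[of _ 1] exI[of _ 0]) simp
  then have "G \<in> schwartz n"
    unfolding G_def [abs_def] by (intro schwartz_gauss_quotients[of "\<lambda>_ x. exp (- x\<^sup>2)" "\<lambda>_. 1"]) auto
  then have intG: "integrable ?M (\<lambda>x. h x * G x)" by (rule int)
  have "AE x in ?M. h x * G x = 0"
  proof (rule AE_eq_0_of_box_integrals[OF intG])
    fix a b :: "nat \<Rightarrow> real"
    let ?B = "Pi\<^sub>E {..<n} (\<lambda>i. {a i<..<b i})"
    show "(\<integral>x. indicator ?B x *\<^sub>R (h x * G x) \<partial>?M) = 0"
    proof (cases "\<forall>i<n. a i < b i")
      case False
      then have "?B = {}" by (auto simp: PiE_eq_empty_iff not_less)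
      then show ?thesis by simp
    next
      case True
      define c where "c i = (a i + b i) / 2" for i
      \<comment> \<open>The value 1 from \<open>n\<close> on keeps \<open>r i\<close> positive for
        all \<open>i\<close>, because \<open>schwartz_gauss_quotients\<close> asks for a polynomial
        at every index.\<close>
      define r where "r i = (if i < n then (b i - a i) / 2 else 1)" for i
      have r: "r i > 0" for i using True by (auto simp: r_def)
      let ?t = "\<lambda>i x. (x - c i) / r i"
      let ?k = "\<lambda>k x. \<Prod>i<n. 1 / (1 + ?t i (x i) ^ (2 * k))"
      define q where "q k i = 1 + [:- c i / r i, 1 / r i:] ^ (2 * k)" for k i
      have q: "poly (q k i) x = 1 + ?t i x ^ (2 * k)" for k i x
        using r[of i] unfolding q_def by (simp add: diff_divide_distrib poly_power)
      have "(\<lambda>x. 1 / (1 + ?t i x ^ (2 * k)) * exp (- x\<^sup>2)) \<in> gauss_quotients (q k i)" for k i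
        unfolding gauss_quotients_def by (intro CollectI exI[of _ 1] exI[of _ "Suc 0"]) (simp add: q)
      then have S: "(\<lambda>x. complex_of_real (\<Prod>i<n. 1 / (1 + ?t i (x i) ^ (2 * k)) * exp (- (x i)\<^sup>2))) \<in> schwartz n" for k
        by (rule schwartz_gauss_quotients[of "\<lambda>i x. 1 / (1 + ?t i x ^ (2 * k)) * exp (- x\<^sup>2)" "q k"]) (simp add: q)
      have eq: "h x * G x * of_real (?k k x) = h x * complex_of_real (\<Prod>i<n. 1 / (1 + ?t i (x i) ^ (2 * k)) * exp (- (x i)\<^sup>2))" for k x
        unfolding G_def prod.distrib by (simp add: mult_ac)
      have "(\<integral>x. h x * G x * of_real (?k k x) \<partial>?M) = 0" for k unfolding eq by (rule zero[OF S])
      moreover have "(\<lambda>k. \<integral>x. h x * G x * of_real (?k k x) \<partial>?M) \<longlonglongrightarrow> (\<integral>x. indicator ?B x *\<^sub>R (h x * G x) \<partial>?M)"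
      proof (rule integral_dominated_convergence[where w = "\<lambda>x. cmod (h x * G x)"])
        show "integrable ?M (\<lambda>x. cmod (h x * G x))" using intG by simp
        have "?B \<in> sets ?M" by (intro sets_PiM_I_finite) auto
        then show "(\<lambda>x. indicator ?B x *\<^sub>R (h x * G x)) \<in> borel_measurable ?M" using intG by measurable
        show "(\<lambda>x. h x * G x * of_real (?k k x)) \<in> borel_measurable ?M" for k
          unfolding eq by (rule borel_measurable_integrable[OF int[OF S]])
        show "AE x in ?M. norm (h x * G x * of_real (?k k x)) \<le> cmod (h x * G x)" for k
        proof (rule AE_I2)
          fix x
          have "0 \<le> 1 / (1 + ?t i (x i) ^ (2 * k)) \<and> 1 / (1 + ?t i (x i) ^ (2 * k)) \<le> 1" for i
            using zero_le_even_power[of "2 * k" "?t i (x i)"] by (simp add: divide_le_eq_1 add_pos_nonneg)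
          then have "0 \<le> ?k k x" "?k k x \<le> 1" by (auto intro!: prod_nonneg prod_le_1)
          then show "norm (h x * G x * of_real (?k k x)) \<le> cmod (h x * G x)"
            unfolding norm_mult[of "h x * G x"] norm_of_real by (intro mult_left_le) auto
        qed
        have "AE x in ?M. \<forall>i\<in>{..<n}. x i \<noteq> a i \<and> x i \<noteq> b i"
          by (intro AE_finite_allI AE_conjI AE_coordinate_neq) auto
        then show "AE x in ?M. (\<lambda>k. h x * G x * of_real (?k k x)) \<longlonglongrightarrow> indicator ?B x *\<^sub>R (h x * G x)"
          using AE_space
        proof eventually_elim
          case (elim x)
          have lim1: "(\<lambda>k. 1 / (1 + ?t i (x i) ^ (2 * k))) \<longlonglongrightarrow> (if x i \<in> {a i<..<b i} then 1 else 0)" if "i < n" for i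
          proof -
            have iff: "\<bar>?t i (x i)\<bar> < 1 \<longleftrightarrow> x i \<in> {a i<..<b i}" "\<bar>?t i (x i)\<bar> = 1 \<longleftrightarrow> x i = a i \<or> x i = b i"
              using True that unfolding c_def r_def abs_if by (auto simp: field_simps split: if_splits)
            with elim(1) that have "\<bar>?t i (x i)\<bar> \<noteq> 1" by blast
            from cutoff_tendsto[OF this] show ?thesis unfolding iff .
          qed
          have "(\<lambda>k. ?k k x) \<longlonglongrightarrow> (\<Prod>i<n. if x i \<in> {a i<..<b i} then 1 else 0)"
            by (intro tendsto_prod lim1) auto
          also have "(\<Prod>i<n. if x i \<in> {a i<..<b i} then 1 else 0) = (indicator ?B x :: real)"
          proof (cases "x \<in> ?B")
            case True
            have "(\<Prod>i<n. if x i \<in> {a i<..<b i} then 1 else 0 :: real) = (\<Prod>i<n. 1)"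
              using PiE_mem[OF True] by (intro prod.cong refl) auto
            then show ?thesis using True by (simp only: prod.neutral_const indicator_simps)
          next
            case False
            then obtain i where "i < n" "x i \<notin> {a i<..<b i}" using elim(2) by (auto simp: space_PiM PiE_def Pi_def)
            then have "(\<Prod>i<n. if x i \<in> {a i<..<b i} then 1 else 0 :: real) = 0"
              by (intro prod_zero bexI[of _ i]) auto
            then show ?thesis using False by (simp only: indicator_simps not_False_eq_True)
          qed
          finally have "(\<lambda>k. h x * G x * of_real (?k k x)) \<longlonglongrightarrow> h x * G x * of_real (indicator ?B x)"
            by (intro tendsto_intros)
          then show ?case by (simp only: scaleR_conv_of_real mult.commute[of "complex_of_real (indicator ?B x)"])
        qed
      qed
      ultimately show ?thesis by (simp add: LIMSEQ_const_iff)
    qed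
  qed
  then show ?thesis
  proof eventually_elim
    case (elim x)
    have "(\<Prod>i<n. exp (- (x i)\<^sup>2)) \<noteq> (0::real)" by simp
    then show ?case using elim by (simp add: G_def)
  qed
qed

section \<open>Exponential decay of the energy of a single mode\<close>

definition wave_mode :: "(real \<Rightarrow> real) \<Rightarrow> real \<Rightarrow> (real \<Rightarrow> complex) \<Rightarrow> (real \<Rightarrow> complex) \<Rightarrow> bool" where
  "wave_mode b L w w' \<longleftrightarrow> (\<forall>t\<ge>0. (w has_vector_derivative w' t) (at t within {0..}) \<and>
     (w' has_vector_derivative - (of_real L * w t + of_real (2 * b t) * w' t)) (at t within {0..}))"

definition energy :: "real \<Rightarrow> (real \<Rightarrow> complex) \<Rightarrow> (real \<Rightarrow> complex) \<Rightarrow> real \<Rightarrow> real" where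
  "energy L w w' t = (cmod (w' t))\<^sup>2 + L * (cmod (w t))\<^sup>2"

text \<open>The energy loses only |w'|^2. The mixed term exchanges |w'|^2 against L |w|^2 and serves
  as the multiplier that spreads the loss over the whole energy.\<close>

lemma
  assumes "wave_mode b L w w'" "t \<ge> 0"
  shows energy_deriv: "(energy L w w' has_real_derivative - 4 * b t * (cmod (w' t))\<^sup>2) (at t within {0..})"
    and mixed_deriv: "((\<lambda>t. Re (w' t * cnj (w t))) has_real_derivative
      (cmod (w' t))\<^sup>2 - L * (cmod (w t))\<^sup>2 - 2 * b t * Re (w' t * cnj (w t))) (at t within {0..})"
proof -
  let ?F = "at t within {0..}"
  note w = assms(1)[unfolded wave_mode_def, rule_format, OF assms(2)]
  have x: "((\<lambda>t. Re (w t)) has_real_derivative Re (w' t)) ?F"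
    and y: "((\<lambda>t. Im (w t)) has_real_derivative Im (w' t)) ?F"
    using w by (auto simp: has_real_derivative_iff_has_vector_derivative
        intro: bounded_linear.has_vector_derivative[OF bounded_linear_Re]
          bounded_linear.has_vector_derivative[OF bounded_linear_Im])
  have x': "((\<lambda>t. Re (w' t)) has_real_derivative - (L * Re (w t) + 2 * b t * Re (w' t))) ?F"
    and y': "((\<lambda>t. Im (w' t)) has_real_derivative - (L * Im (w t) + 2 * b t * Im (w' t))) ?F"
    using bounded_linear.has_vector_derivative[OF bounded_linear_Re conjunct2[OF w]]
      bounded_linear.has_vector_derivative[OF bounded_linear_Im conjunct2[OF w]]
    by (simp_all add: has_real_derivative_iff_has_vector_derivative)
  show "(energy L w w' has_real_derivative - 4 * b t * (cmod (w' t))\<^sup>2) ?F"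
    unfolding energy_def [abs_def] cmod_power2
    by (rule derivative_eq_intros x y x' y' refl)+ (simp add: power2_eq_square algebra_simps)
  show "((\<lambda>t. Re (w' t * cnj (w t))) has_real_derivative
      (cmod (w' t))\<^sup>2 - L * (cmod (w t))\<^sup>2 - 2 * b t * Re (w' t * cnj (w t))) ?F"
    unfolding cmod_power2 times_complex.sel cnj.sel
    by (rule derivative_eq_intros x y x' y' refl)+ (simp add: power2_eq_square algebra_simps)
qed

lemma nonincreasing_of_deriv:
  fixes f :: "real \<Rightarrow> real"
  assumes "0 \<le> a" "a \<le> c"
    and der: "\<And>t. a \<le> t \<Longrightarrow> t \<le> c \<Longrightarrow> (f has_real_derivative f' t) (at t within {0..})"
    and nonpos: "\<And>t. a \<le> t \<Longrightarrow> t \<le> c \<Longrightarrow> f' t \<le> 0"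
  shows "f c \<le> f a"
proof (rule DERIV_nonpos_imp_decreasing_open[OF assms(2)])
  fix t assume t: "a < t" "t < c"
  then have "t \<in> interior {0..}" using assms(1) by (simp add: interior_real_atLeast)
  then have "at t within {0..} = at t" by (rule at_within_interior)
  then show "\<exists>y. (f has_real_derivative y) (at t) \<and> y \<le> 0"
    using der[of t] nonpos[of t] t by auto
next
  show "continuous_on {a..c} f"
    unfolding continuous_on_eq_continuous_within
  proof
    fix t assume "t \<in> {a..c}"
    then have "continuous (at t within {0..}) f" using der by (auto intro: DERIV_continuous)
    then show "continuous (at t within {a..c}) f" by (rule continuous_within_subset) (use assms(1) in auto)
  qed
qed

lemma energy_nonneg: "L \<ge> 0 \<Longrightarrow> 0 \<le> energy L w w' t"
  by (simp add: energy_def)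

lemma energy_antimono:
  assumes "wave_mode b L w w'" "\<And>t. b t \<ge> 0" "0 \<le> s" "s \<le> t"
  shows "energy L w w' t \<le> energy L w w' s"
  by (rule nonincreasing_of_deriv[OF assms(3,4) energy_deriv[OF assms(1)]]) (use assms in auto)

text \<open>
  Where the damping is effective, \<open>K E + \<chi> Re (w' \<cdot> cnj w) + E(c) X / 2\<close> is nonincreasing for
  the cut-off \<open>\<chi> = ((t - a) (c - t))\<^sup>2\<close> with primitive \<open>X\<close>. The middle term transfers the dissipation
  of \<open>w'\<close> to \<open>w\<close>; since \<open>\<chi>'\<close> is of the order of \<open>\<chi>\<close> to the power \<open>1/2\<close>, its derivative is absorbed by AM-GM.
  The bound is uniform in the frequency because only a lower bound on \<open>L\<close> enters.
\<close>

lemma energy_contraction: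
  assumes w: "wave_mode b L w w'" and b: "\<And>t. b t \<ge> 0"
    and ac: "0 \<le> a" "a < c" and l: "l = c - a"
    and low: "\<And>t. a \<le> t \<Longrightarrow> t \<le> c \<Longrightarrow> \<beta> \<le> b t" and up: "\<And>t. a \<le> t \<Longrightarrow> t \<le> c \<Longrightarrow> b t \<le> B"
    and L: "\<mu> \<le> L" "0 < \<mu>"
    and K: "3 / 2 * l ^ 4 + (2 * l + 2 * B * l\<^sup>2)\<^sup>2 / (2 * \<mu>) \<le> 4 * K * \<beta>" and K0: "0 \<le> K"
  shows "(K + l ^ 5 / 60) * energy L w w' c \<le> K * energy L w w' a"
proof -
  define E where "E = energy L w w'"
  define p where "p t = Re (w' t * cnj (w t))" for t
  define \<eta> where "\<eta> t = (t - a) * (c - t)" for t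
  define \<eta>' where "\<eta>' t = (c - t) - (t - a)" for t
  \<comment> \<open>With s = t - a this is the primitive of s^2 (l - s)^2 vanishing at
    \<open>a\<close>. At \<open>c\<close> it equals l^5 (1/3 - 1/2 + 1/5) = l^5/30; halved, this is
    the l^5/60 of the conclusion.\<close>
  define X where "X t = l\<^sup>2 * (t - a) ^ 3 / 3 - l * (t - a) ^ 4 / 2 + (t - a) ^ 5 / 5" for t
  define G where "G t = K * E t + (\<eta> t)\<^sup>2 * p t + E c / 2 * X t" for t
  \<comment> \<open>Bounds |2 \<eta>' - 2 b \<eta>| through |\<eta>'| \<le> l, \<eta> \<le> l^2 and
    b \<le> B.\<close>
  define N where "N = 2 * l + 2 * B * l\<^sup>2"
  let ?G' = "\<lambda>t. K * (- 4 * b t * (cmod (w' t))\<^sup>2) + (2 * \<eta> t * \<eta>' t * p t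
    + (\<eta> t)\<^sup>2 * ((cmod (w' t))\<^sup>2 - L * (cmod (w t))\<^sup>2 - 2 * b t * p t)) + E c / 2 * (\<eta> t)\<^sup>2"
  have "G c \<le> G a"
  proof (rule nonincreasing_of_deriv[of a c G ?G'])
    show "0 \<le> a" "a \<le> c" using ac by auto
    fix t assume t: "a \<le> t" "t \<le> c"
    then have t0: "0 \<le> t" using ac by simp
    have dE: "(E has_real_derivative - 4 * b t * (cmod (w' t))\<^sup>2) (at t within {0..})"
      unfolding E_def by (rule energy_deriv[OF w t0])
    have dp: "(p has_real_derivative (cmod (w' t))\<^sup>2 - L * (cmod (w t))\<^sup>2 - 2 * b t * p t) (at t within {0..})"
      using mixed_deriv[OF w t0] unfolding p_def [abs_def] .
    have d\<eta>: "((\<lambda>t. (\<eta> t)\<^sup>2) has_real_derivative 2 * \<eta> t * \<eta>' t) (at t within {0..})"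
      unfolding \<eta>_def \<eta>'_def by (auto intro!: derivative_eq_intros simp: algebra_simps)
    have dX: "(X has_real_derivative (\<eta> t)\<^sup>2) (at t within {0..})"
    proof -
      have "(X has_real_derivative l\<^sup>2 * (t - a)\<^sup>2 - 2 * l * (t - a) ^ 3 + (t - a) ^ 4) (at t within {0..})"
        unfolding X_def [abs_def] by (auto intro!: derivative_eq_intros)
      moreover have sq: "(l * s - s\<^sup>2)\<^sup>2 = l\<^sup>2 * s\<^sup>2 - 2 * l * s ^ 3 + s ^ 4" for s
        by (simp add: power2_eq_square power3_eq_cube power4_eq_xxxx algebra_simps)
      moreover have "\<eta> t = l * (t - a) - (t - a)\<^sup>2"
        by (simp add: \<eta>_def l power2_eq_square algebra_simps)
      then have "(\<eta> t)\<^sup>2 = l\<^sup>2 * (t - a)\<^sup>2 - 2 * l * (t - a) ^ 3 + (t - a) ^ 4"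
        using sq[of "t - a"] by simp
      ultimately show ?thesis by simp
    qed
    show "(G has_real_derivative ?G' t) (at t within {0..})"
      unfolding G_def [abs_def]
      by (rule derivative_eq_intros dE dp d\<eta> dX refl)+ simp
    define u where "u = cmod (w' t)"
    define v where "v = cmod (w t)"
    have uv: "0 \<le> u" "0 \<le> v" by (simp_all add: u_def v_def)
    have p: "\<bar>p t\<bar> \<le> u * v"
      using abs_Re_le_cmod[of "w' t * cnj (w t)"] by (simp add: p_def u_def v_def norm_mult)
    have \<eta>0: "0 \<le> \<eta> t" using t by (simp add: \<eta>_def)
    have \<eta>l: "\<eta> t \<le> l * l" unfolding \<eta>_def using t l by (intro mult_mono) auto
    have \<eta>'l: "\<bar>\<eta>' t\<bar> \<le> l" unfolding \<eta>'_def l using t by auto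
    have bt: "0 \<le> b t" "\<beta> \<le> b t" "b t \<le> B" using b low up t by auto
    have l0: "0 < l" using ac l by simp
    \<comment> \<open>Monotonicity replaces the later energy by the current one, whose potential
      half is paid by \<open>- L * v\<^sup>2 * (\<eta> t)\<^sup>2\<close>.\<close>
    have "E c \<le> E t" unfolding E_def using energy_antimono[OF w b t0 t(2)] .
    then have Ec: "E c / 2 * (\<eta> t)\<^sup>2 \<le> (u\<^sup>2 + L * v\<^sup>2) / 2 * (\<eta> t)\<^sup>2"
      by (intro mult_right_mono) (simp_all add: E_def energy_def u_def v_def)
    have cross: "2 * \<eta> t * \<eta>' t * p t - (\<eta> t)\<^sup>2 * (2 * b t * p t) \<le> N * \<eta> t * (u * v)"
    proof -
      have "2 * \<eta> t * \<eta>' t * p t - (\<eta> t)\<^sup>2 * (2 * b t * p t) = \<eta> t * ((2 * \<eta>' t - 2 * b t * \<eta> t) * p t)"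
        by (simp add: power2_eq_square algebra_simps)
      also have "\<dots> \<le> \<eta> t * (N * (u * v))"
      proof (rule mult_left_mono[OF _ \<eta>0])
        have "b t * \<eta> t \<le> B * (l * l)" using bt \<eta>0 \<eta>l by (intro mult_mono) auto
        moreover have "0 \<le> b t * \<eta> t" using bt \<eta>0 by simp
        ultimately have "\<bar>2 * \<eta>' t - 2 * b t * \<eta> t\<bar> \<le> N" using \<eta>'l unfolding N_def power2_eq_square by (simp add: abs_le_iff)
        then have "\<bar>2 * \<eta>' t - 2 * b t * \<eta> t\<bar> * \<bar>p t\<bar> \<le> N * (u * v)" using p by (intro mult_mono) auto
        then show "(2 * \<eta>' t - 2 * b t * \<eta> t) * p t \<le> N * (u * v)"
          unfolding abs_mult[symmetric] by linarith
      qed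
      finally show ?thesis by (simp add: mult_ac)
    qed
    have amgm: "N * \<eta> t * (u * v) \<le> L * v\<^sup>2 / 2 * (\<eta> t)\<^sup>2 + N\<^sup>2 / (2 * \<mu>) * u\<^sup>2"
    proof -
      have "0 \<le> (\<mu> * (\<eta> t * v) - N * u)\<^sup>2" by simp
      then have "2 * \<mu> * (N * \<eta> t * (u * v)) \<le> \<mu>\<^sup>2 * (\<eta> t)\<^sup>2 * v\<^sup>2 + N\<^sup>2 * u\<^sup>2"
        by (simp add: power2_diff power_mult_distrib mult_ac)
      then have "N * \<eta> t * (u * v) \<le> (\<mu>\<^sup>2 * (\<eta> t)\<^sup>2 * v\<^sup>2 + N\<^sup>2 * u\<^sup>2) / (2 * \<mu>)"
        using L by (simp add: pos_le_divide_eq mult_ac)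
      also have "\<dots> = \<mu> * (v\<^sup>2 / 2 * (\<eta> t)\<^sup>2) + N\<^sup>2 / (2 * \<mu>) * u\<^sup>2"
        using L by (simp add: field_simps power2_eq_square)
      also have "\<mu> * (v\<^sup>2 / 2 * (\<eta> t)\<^sup>2) \<le> L * (v\<^sup>2 / 2 * (\<eta> t)\<^sup>2)" using L by (intro mult_right_mono) auto
      finally show ?thesis by simp
    qed
    have "(\<eta> t)\<^sup>2 \<le> (l * l)\<^sup>2" using \<eta>0 \<eta>l by (intro power_mono) auto
    then have \<eta>4: "3 / 2 * (\<eta> t)\<^sup>2 \<le> 3 / 2 * l ^ 4" by (simp add: power2_eq_square power4_eq_xxxx)
    have "4 * K * \<beta> \<le> 4 * K * b t" using K0 bt by (intro mult_left_mono) auto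
    with K \<eta>4 have "3 / 2 * (\<eta> t)\<^sup>2 + N\<^sup>2 / (2 * \<mu>) \<le> 4 * K * b t" by (simp add: N_def)
    then have "(3 / 2 * (\<eta> t)\<^sup>2 + N\<^sup>2 / (2 * \<mu>)) * u\<^sup>2 \<le> 4 * K * b t * u\<^sup>2" by (intro mult_right_mono) auto
    then have main: "3 / 2 * (\<eta> t)\<^sup>2 * u\<^sup>2 + N\<^sup>2 / (2 * \<mu>) * u\<^sup>2 \<le> 4 * K * b t * u\<^sup>2" by (simp add: algebra_simps)
    \<comment> \<open>The potential terms cancel: -1 from the multiplier, 1/2 from AM-GM, 1/2 from
      \<open>E c\<close>. The kinetic coefficient 1 + 1/2 is the 3/2 in the hypothesis on
      \<open>K\<close>.\<close>
    have "?G' t = - (4 * K * b t * u\<^sup>2) + (2 * \<eta> t * \<eta>' t * p t - (\<eta> t)\<^sup>2 * (2 * b t * p t))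
        + (\<eta> t)\<^sup>2 * u\<^sup>2 - L * v\<^sup>2 * (\<eta> t)\<^sup>2 + E c / 2 * (\<eta> t)\<^sup>2"
      unfolding u_def[symmetric] v_def[symmetric] by (simp add: algebra_simps)
    also have "\<dots> \<le> - (4 * K * b t * u\<^sup>2) + (L * v\<^sup>2 / 2 * (\<eta> t)\<^sup>2 + N\<^sup>2 / (2 * \<mu>) * u\<^sup>2)
        + (\<eta> t)\<^sup>2 * u\<^sup>2 - L * v\<^sup>2 * (\<eta> t)\<^sup>2 + (u\<^sup>2 + L * v\<^sup>2) / 2 * (\<eta> t)\<^sup>2"
      using cross amgm Ec by linarith
    also have "\<dots> = 3 / 2 * (\<eta> t)\<^sup>2 * u\<^sup>2 + N\<^sup>2 / (2 * \<mu>) * u\<^sup>2 - 4 * K * b t * u\<^sup>2"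
      by (simp add: algebra_simps add_divide_distrib)
    finally show "?G' t \<le> 0" using main by linarith
  qed
  moreover have "X a = 0" by (simp add: X_def)
  moreover have "X c = l ^ 5 / 30"
    by (simp add: X_def l[symmetric]) (simp add: power2_eq_square power3_eq_cube power4_eq_xxxx eval_nat_numeral)
  \<comment> \<open>The cut-off vanishes at \<open>a\<close> and \<open>c\<close>, so the mixed term
    drops out of \<open>G a\<close> and \<open>G c\<close>.\<close>
  ultimately show ?thesis unfolding G_def \<eta>_def E_def by (simp add: algebra_simps)
qed

section \<open>From one damped interval to exponential decay\<close>

lemma periodic_nat:
  fixes b :: "real \<Rightarrow> real"
  assumes "\<forall>t. b (t + T) = b t"
  shows "b (t + real k * T) = b t"
proof (induction k)
  case (Suc k)
  have "b (t + real (Suc k) * T) = b ((t + real k * T) + T)" by (simp add: algebra_simps)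
  then show ?case using assms Suc by simp
qed simp

lemma periodic_interval_pos:
  fixes b :: "real \<Rightarrow> real"
  assumes T: "T > 0" and cont: "continuous_on UNIV b" and nonneg: "\<forall>t. b t \<ge> 0"
    and per: "\<forall>t. b (t + T) = b t" and nz: "\<exists>t. b t \<noteq> 0"
  obtains a c \<beta> B where "0 \<le> a" "a < c" "c \<le> a + T" "0 < \<beta>"
    "\<And>t. a \<le> t \<Longrightarrow> t \<le> c \<Longrightarrow> \<beta> \<le> b t \<and> b t \<le> B"
proof -
  obtain t0 where t0: "b t0 \<noteq> 0" using nz by blast
  \<comment> \<open>Shifting by whole periods moves the interval into nonnegative times, where the
    mode equation is assumed.\<close>
  obtain k :: nat where k: "\<bar>t0\<bar> / T < real k" using reals_Archimedean2 by blast
  define a where "a = t0 + real k * T"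
  have "b a = b t0" unfolding a_def by (rule periodic_nat[OF per])
  with t0 nonneg have ba: "0 < b a" by (metis less_eq_real_def)
  have "\<bar>t0\<bar> < real k * T" using k T by (simp add: pos_divide_less_eq)
  then have a0: "0 \<le> a" unfolding a_def by linarith
  have "isCont b a" using cont by (simp add: continuous_on_eq_continuous_at)
  then obtain d where d: "d > 0" "\<And>t. dist t a < d \<Longrightarrow> dist (b t) (b a) < b a / 2"
    unfolding continuous_at_eps_delta using ba by (metis half_gt_zero)
  \<comment> \<open>Half of \<open>d\<close> stays strictly inside the continuity radius; the bound
    \<open>T\<close> keeps consecutive translates from overlapping.\<close>
  define c where "c = a + min (d / 2) T"
  have ac: "a < c" "c \<le> a + T" using d T by (auto simp: c_def)
  have low: "b a / 2 \<le> b t" if "a \<le> t" "t \<le> c" for t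
  proof -
    have "dist t a < d" using that d(1) by (auto simp: c_def dist_real_def)
    from d(2)[OF this] show ?thesis by (simp add: dist_real_def abs_if split: if_splits)
  qed
  have "{a..c} \<noteq> {}" using ac by simp
  then obtain x where "\<forall>t\<in>{a..c}. b t \<le> b x"
    using continuous_attains_sup[OF compact_Icc _ continuous_on_subset[OF cont subset_UNIV]] by blast
  then have "\<And>t. a \<le> t \<Longrightarrow> t \<le> c \<Longrightarrow> b a / 2 \<le> b t \<and> b t \<le> b x" using low by auto
  with a0 ac ba show thesis using that[of a c "b a / 2" "b x"] by simp
qed

theorem energy_decay:
  fixes b :: "real \<Rightarrow> real"
  assumes T: "T > 0" and cont: "continuous_on UNIV b" and nonneg: "\<forall>t. b t \<ge> 0"
    and per: "\<forall>t. b (t + T) = b t" and nz: "\<exists>t. b t \<noteq> 0" and \<mu>: "\<mu> > 0"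
  obtains \<delta> C where "\<delta> > 0" "C > 0"
    "\<And>L w w' t. L \<ge> \<mu> \<Longrightarrow> wave_mode b L w w' \<Longrightarrow> t \<ge> 0 \<Longrightarrow>
       energy L w w' t \<le> C * exp (- 2 * \<delta> * t) * energy L w w' 0"
proof -
  obtain a c \<beta> B where ac: "0 \<le> a" "a < c" "c \<le> a + T" and \<beta>: "0 < \<beta>"
    and bnd: "\<And>t. a \<le> t \<Longrightarrow> t \<le> c \<Longrightarrow> \<beta> \<le> b t \<and> b t \<le> B"
    using periodic_interval_pos[OF T cont nonneg per nz] by metis
  define l where "l = c - a"
  have l: "0 < l" using ac by (simp add: l_def)
  \<comment> \<open>Makes the condition on \<open>K\<close> in \<open>energy_contraction\<close> an
    equality. \<open>L\<close> does not enter, so \<open>q\<close> and \<open>\<delta>\<close> are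
    uniform in the frequency.\<close>
  define K where "K = (3 / 2 * l ^ 4 + (2 * l + 2 * B * l\<^sup>2)\<^sup>2 / (2 * \<mu>)) / (4 * \<beta>)"
  have K: "0 < K" unfolding K_def using l \<mu> \<beta> by (intro divide_pos_pos add_pos_nonneg) auto
  define q where "q = K / (K + l ^ 5 / 60)"
  have q: "0 < q" "q < 1" using K l by (simp_all add: q_def add_pos_pos)
  \<comment> \<open>Chosen so that \<open>q\<close> equals exp (-2 \<delta> T); the 2 is there
    because the energy is quadratic in the mode.\<close>
  define \<delta> where "\<delta> = - ln q / (2 * T)"
  have \<delta>: "\<delta> > 0" unfolding \<delta>_def using q T by (intro divide_pos_pos) auto
  have q_exp: "q ^ k = exp (- 2 * \<delta> * (real k * T))" for k
  proof -
    have "q ^ k = exp (ln q) ^ k" using q by simp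
    also have "\<dots> = exp (real k * ln q)" by (rule exp_of_nat_mult[symmetric])
    also have "real k * ln q = - 2 * \<delta> * (real k * T)" using T by (simp add: \<delta>_def)
    finally show ?thesis .
  qed
  have decay: "energy L w w' t \<le> exp (2 * \<delta> * (c + T)) * exp (- 2 * \<delta> * t) * energy L w w' 0"
    if L: "L \<ge> \<mu>" and w: "wave_mode b L w w'" and t: "t \<ge> 0" for L w w' t
  proof -
    let ?E = "energy L w w'"
    note anti = energy_antimono[OF w nonneg[rule_format]]
    have E0: "0 \<le> ?E s" for s using L \<mu> by (intro energy_nonneg) auto
    have step: "?E (c + real k * T) \<le> q * ?E (a + real k * T)" for k
    proof -
      have kT: "0 \<le> real k * T" using T by simp
      have "(K + l ^ 5 / 60) * ?E (c + real k * T) \<le> K * ?E (a + real k * T)"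
      proof (rule energy_contraction[OF w nonneg[rule_format], where \<beta> = \<beta> and B = B and \<mu> = \<mu>])
        fix s assume s: "a + real k * T \<le> s" "s \<le> c + real k * T"
        have "b s = b (s - real k * T)" using periodic_nat[OF per, of "s - real k * T" k] by simp
        then show "\<beta> \<le> b s" "b s \<le> B" using bnd[of "s - real k * T"] s by auto
      qed (use ac kT L \<mu> K \<beta> in \<open>auto simp: l_def K_def\<close>)
      then show ?thesis using K l by (simp add: q_def field_simps add_pos_pos)
    qed
    have iter: "?E (c + real k * T) \<le> q ^ k * ?E 0" for k
    proof (induction k)
      case 0
      then show ?case using anti[of 0 c] ac by simp
    next
      case (Suc k)
      have "?E (c + real (Suc k) * T) \<le> q * ?E (a + real (Suc k) * T)" by (rule step)
      \<comment> \<open>Between translates the energy does not increase;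
        \<open>c \<le> a + T\<close> places the next start after the previous end.\<close>
      also have "?E (a + real (Suc k) * T) \<le> ?E (c + real k * T)"
        using ac T by (intro anti) (auto simp: algebra_simps add_nonneg_nonneg)
      also have "\<dots> \<le> q ^ k * ?E 0" by (rule Suc)
      finally show ?case using q by (simp add: mult_ac)
    qed
    show ?thesis
    proof (cases "t < c")
      case True
      have "?E t \<le> 1 * ?E 0" using anti[of 0 t] t by simp
      also have "\<dots> \<le> exp (2 * \<delta> * (c + T)) * exp (- 2 * \<delta> * t) * ?E 0"
      proof (rule mult_right_mono[OF _ E0])
        have "0 \<le> \<delta> * (c + T - t)" using True T \<delta> by simp
        then show "1 \<le> exp (2 * \<delta> * (c + T)) * exp (- 2 * \<delta> * t)"
          unfolding exp_add[symmetric] by (simp add: algebra_simps)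
      qed
      finally show ?thesis .
    next
      case False
      \<comment> \<open>Number of whole periods between \<open>c\<close> and \<open>t\<close>.
        Rounding down loses at most one period, hence \<open>c + T\<close> in the prefactor.\<close>
      define k where "k = nat \<lfloor>(t - c) / T\<rfloor>"
      have k: "real k \<le> (t - c) / T" "(t - c) / T < real k + 1"
        using False T by (auto simp: k_def of_nat_nat)
      have k1: "c + real k * T \<le> t" using k(1) T by (simp add: pos_le_divide_eq)
      have k2: "t - c - T \<le> real k * T" using k(2) T by (simp add: pos_divide_less_eq algebra_simps)
      have "?E t \<le> ?E (c + real k * T)" using k1 ac T by (intro anti) auto
      also have "\<dots> \<le> q ^ k * ?E 0" by (rule iter)
      also have "\<dots> \<le> exp (2 * \<delta> * (c + T)) * exp (- 2 * \<delta> * t) * ?E 0"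
      proof (rule mult_right_mono[OF _ E0])
        have "\<delta> * (t - c - T) \<le> \<delta> * (real k * T)" using k2 \<delta> by (intro mult_left_mono) auto
        then show "q ^ k \<le> exp (2 * \<delta> * (c + T)) * exp (- 2 * \<delta> * t)"
          unfolding q_exp exp_add[symmetric] by (simp add: algebra_simps)
      qed
      finally show ?thesis .
    qed
  qed
  show thesis by (rule that[OF \<delta> exp_gt_zero decay])
qed

section \<open>Tempered distributions given by functions\<close>

lemma represents_unique:
  assumes f: "represents n f u" and g: "represents n g u"
  shows "AE x in lborel_n n. f x = g x"
proof -
  have [measurable]: "f \<in> borel_measurable (lborel_n n)" "g \<in> borel_measurable (lborel_n n)"
    using f g by (auto simp: represents_def)
  have int: "integrable (lborel_n n) (\<lambda>x. f x * \<phi> x)" "integrable (lborel_n n) (\<lambda>x. g x * \<phi> x)"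
    and eq: "(\<integral>x. f x * \<phi> x \<partial>lborel_n n) = (\<integral>x. g x * \<phi> x \<partial>lborel_n n)" if "\<phi> \<in> schwartz n" for \<phi>
    using f g that by (auto simp: represents_def)
  have "AE x in lborel_n n. f x - g x = 0"
    by (rule schwartz_separating) (use int eq in \<open>auto simp: left_diff_distrib\<close>)
  then show ?thesis by simp
qed

lemma L2_norm_eq:
  assumes "represents n g u"
  shows "L2_norm n u = sqrt (\<integral>x. (cmod (g x))\<^sup>2 \<partial>lborel_n n)"
proof -
  define h where "h = (SOME g. represents n g u)"
  have h: "represents n h u"
    unfolding h_def using assms by (rule someI[of "\<lambda>g. represents n g u"])
  have [measurable]: "g \<in> borel_measurable (lborel_n n)" "h \<in> borel_measurable (lborel_n n)"
    using assms h by (auto simp: represents_def)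
  have "(\<integral>x. (cmod (h x))\<^sup>2 \<partial>lborel_n n) = (\<integral>x. (cmod (g x))\<^sup>2 \<partial>lborel_n n)"
    using represents_unique[OF h assms] by (intro integral_cong_AE) auto
  then show ?thesis unfolding L2_norm_def Let_def h_def[symmetric] by simp
qed

lemma L2_norm_nonneg: "0 \<le> L2_norm n u"
  by (simp add: L2_norm_def Let_def)

lemma L2_set_measurable [measurable]: "(\<lambda>\<xi>. L2_set \<xi> {..<n}) \<in> borel_measurable (lborel_n n)"
  unfolding L2_set_def by measurable

lemma sobolev_norm_eq:
  assumes "represents n f (fourier_dist n u)"
  shows "sobolev_norm n s u = sqrt (\<integral>\<xi>. (1 + (L2_set \<xi> {..<n})\<^sup>2) powr s * (cmod (f \<xi>))\<^sup>2 \<partial>lborel_n n)"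
proof -
  define h where "h = (SOME f. represents n f (fourier_dist n u))"
  have h: "represents n h (fourier_dist n u)"
    unfolding h_def using assms by (rule someI[of "\<lambda>f. represents n f (fourier_dist n u)"])
  have [measurable]: "f \<in> borel_measurable (lborel_n n)" "h \<in> borel_measurable (lborel_n n)"
    using assms h by (auto simp: represents_def)
  have "(\<integral>\<xi>. (1 + (L2_set \<xi> {..<n})\<^sup>2) powr s * (cmod (h \<xi>))\<^sup>2 \<partial>lborel_n n)
      = (\<integral>\<xi>. (1 + (L2_set \<xi> {..<n})\<^sup>2) powr s * (cmod (f \<xi>))\<^sup>2 \<partial>lborel_n n)"
    using represents_unique[OF h assms] by (intro integral_cong_AE) auto
  then show ?thesis unfolding sobolev_norm_def Let_def h_def[symmetric] by simp
qed

lemma sobolev_norm_nonneg: "0 \<le> sobolev_norm n s u"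
  by (simp add: sobolev_norm_def Let_def)

text \<open>Membership provides some representative of the transform, whereas the solution carries
  its own; the two agree almost everywhere.\<close>

lemma sobolev_representative:
  assumes u: "u \<in> sobolev n s" and f: "represents n f (fourier_dist n u)"
  shows "integrable (lborel_n n) (\<lambda>\<xi>. (1 + (L2_set \<xi> {..<n})\<^sup>2) powr s * (cmod (f \<xi>))\<^sup>2)"
    and "(\<integral>\<xi>. (1 + (L2_set \<xi> {..<n})\<^sup>2) powr s * (cmod (f \<xi>))\<^sup>2 \<partial>lborel_n n) = (sobolev_norm n s u)\<^sup>2"
proof -
  obtain h where h: "represents n h (fourier_dist n u)"
    "integrable (lborel_n n) (\<lambda>\<xi>. (1 + (L2_set \<xi> {..<n})\<^sup>2) powr s * (cmod (h \<xi>))\<^sup>2)"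
    using u by (auto simp: sobolev_def)
  have [measurable]: "f \<in> borel_measurable (lborel_n n)" using f by (auto simp: represents_def)
  show "integrable (lborel_n n) (\<lambda>\<xi>. (1 + (L2_set \<xi> {..<n})\<^sup>2) powr s * (cmod (f \<xi>))\<^sup>2)"
    using represents_unique[OF h(1) f] by (intro integrable_cong_AE_imp[OF h(2)]) auto
  show "(\<integral>\<xi>. (1 + (L2_set \<xi> {..<n})\<^sup>2) powr s * (cmod (f \<xi>))\<^sup>2 \<partial>lborel_n n) = (sobolev_norm n s u)\<^sup>2"
    unfolding sobolev_norm_eq[OF f] by simp
qed

section \<open>Seminorm bounds and continuity of distributions\<close>

lemma foldr_partial_deriv_schwartz:
  assumes "\<phi> \<in> schwartz n" "is \<in> lists {..<n}"
  shows "foldr partial_deriv is \<phi> \<in> schwartz n"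
  using assms(2) by (induction "is" rule: lists.induct) (auto simp: assms(1) schwartz_partial_deriv)

text \<open>A real \<open>SUP\<close> dominates its terms only when they are bounded above; here
  finitely many derivative lists have length at most \<open>k\<close>, and each contributes a finite
  bound.\<close>

lemma schwartz_seminorm_upper:
  assumes \<phi>: "\<phi> \<in> schwartz n" and x: "x \<in> points n"
  shows "(1 + L2_set x {..<n}) ^ k * cmod (\<phi> x) \<le> schwartz_seminorm n k \<phi>"
proof -
  let ?I = "{is \<in> lists {..<n}. length is \<le> k}"
  have "finite ?I"
    using finite_lists_length_le[of "{..<n}" k] by (simp add: lists_eq_set conj_commute subset_iff)
  have "\<forall>is\<in>?I. \<exists>M. \<forall>x\<in>points n. (1 + L2_set x {..<n}) ^ k * cmod (foldr partial_deriv is \<phi> x) \<le> M"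
    using schwartz_decreasing[OF foldr_partial_deriv_schwartz[OF \<phi>]] unfolding rapidly_decreasing_def by auto
  from bchoice[OF this] obtain M where M: "\<And>is x. is \<in> ?I \<Longrightarrow> x \<in> points n \<Longrightarrow>
      (1 + L2_set x {..<n}) ^ k * cmod (foldr partial_deriv is \<phi> x) \<le> M is" by blast
  have "bdd_above ((\<lambda>(is, x). (1 + L2_set x {..<n}) ^ k * cmod (foldr partial_deriv is \<phi> x)) ` (?I \<times> points n))"
  proof (rule bdd_aboveI2)
    fix z assume "z \<in> ?I \<times> points n"
    then obtain "is" y where z: "z = (is, y)" "is \<in> ?I" "y \<in> points n" by blast
    have "M is \<le> \<bar>M is\<bar>" by simp
    also have "\<dots> \<le> (\<Sum>is\<in>?I. \<bar>M is\<bar>)" by (intro member_le_sum z \<open>finite ?I\<close>) auto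
    finally show "(case z of (is, x) \<Rightarrow> (1 + L2_set x {..<n}) ^ k * cmod (foldr partial_deriv is \<phi> x)) \<le> (\<Sum>is\<in>?I. \<bar>M is\<bar>)"
      using M[OF z(2,3)] z(1) by simp
  qed
  from cSUP_upper[OF _ this, of "([], x)"] x show ?thesis by (simp add: schwartz_seminorm_def)
qed

lemma schwartz_seminorm_nonneg:
  assumes "\<phi> \<in> schwartz n"
  shows "0 \<le> schwartz_seminorm n k \<phi>"
proof -
  obtain x where "x \<in> points n" using points_nonempty[of n] by blast
  moreover have "0 \<le> (1 + L2_set x {..<n}) ^ k * cmod (\<phi> x)"
    using L2_set_pos[of x "{..<n}"] by simp
  ultimately show ?thesis using schwartz_seminorm_upper[OF assms, of x k] by linarith
qed

text \<open>Order \<open>n\<close> suffices: squaring (1 + |x|)^n |\<phi>| produces the power 2n of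
  \<open>weight_ge\<close>.\<close>

lemma integral_square_le_seminorm:
  assumes \<phi>: "\<phi> \<in> schwartz n"
  shows "(\<integral>x. (cmod (\<phi> x))\<^sup>2 \<partial>lborel_n n) \<le> (schwartz_seminorm n n \<phi>)\<^sup>2 * (\<integral>x. weight n x \<partial>lborel_n n)"
proof -
  let ?s = "schwartz_seminorm n n \<phi>"
  have "(\<integral>x. (cmod (\<phi> x))\<^sup>2 \<partial>lborel_n n) \<le> (\<integral>x. ?s\<^sup>2 * weight n x \<partial>lborel_n n)"
  proof (rule Bochner_Integration.integral_mono)
    show "integrable (lborel_n n) (\<lambda>x. (cmod (\<phi> x))\<^sup>2)" by (rule schwartz_integrable_square[OF \<phi>])
    show "integrable (lborel_n n) (\<lambda>x. ?s\<^sup>2 * weight n x)" using integrable_weight by simp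
    fix x assume x: "x \<in> points n"
    let ?w = "1 + L2_set x {..<n}"
    have "(cmod (\<phi> x))\<^sup>2 * 1 \<le> (cmod (\<phi> x))\<^sup>2 * (?w ^ (2 * n) * weight n x)"
      by (intro mult_left_mono weight_ge) auto
    also have "\<dots> = (?w ^ n * cmod (\<phi> x))\<^sup>2 * weight n x"
      by (simp add: power_mult_distrib power_mult[symmetric] mult_ac)
    also have "\<dots> \<le> ?s\<^sup>2 * weight n x"
      using schwartz_seminorm_upper[OF \<phi> x, of n] L2_set_pos[of x "{..<n}"] weight_pos[of n x]
      by (intro mult_right_mono power_mono) auto
    finally show "(cmod (\<phi> x))\<^sup>2 \<le> ?s\<^sup>2 * weight n x" by simp
  qed
  then show ?thesis by simp
qed

lemma schwartz_square_integrable: "\<phi> \<in> schwartz n \<Longrightarrow> square_integrable (lborel_n n) \<phi>"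
  using schwartz_measurable[of \<phi> n] schwartz_integrable_square[of \<phi> n] by (simp add: square_integrable_def)

lemma square_integrable_tempered:
  assumes g: "square_integrable (lborel_n n) g"
    and w: "\<And>\<psi>. \<psi> \<in> schwartz n \<Longrightarrow> w \<psi> = (\<integral>x. g x * \<psi> x \<partial>lborel_n n)"
  shows "w \<in> tempered n" "represents n g w"
proof -
  note int = integrable_mult_square_integrable[OF g schwartz_square_integrable]
  show "represents n g w"
    using g int w by (simp add: represents_def square_integrable_measurable)
  show "w \<in> tempered n"
    unfolding tempered_def
  proof (intro CollectI conjI ballI allI exI)
    fix \<phi> \<psi> and a c :: complex assume \<phi>: "\<phi> \<in> schwartz n" and \<psi>: "\<psi> \<in> schwartz n"
    have "w (\<lambda>x. a * \<phi> x + c * \<psi> x) = (\<integral>x. a * (g x * \<phi> x) + c * (g x * \<psi> x) \<partial>lborel_n n)"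
      unfolding w[OF schwartz_lincomb[OF \<phi> \<psi>]] by (simp add: algebra_simps)
    then show "w (\<lambda>x. a * \<phi> x + c * \<psi> x) = a * w \<phi> + c * w \<psi>"
      using int[OF \<phi>] int[OF \<psi>] w \<phi> \<psi> by simp
  next
    fix \<phi> assume \<phi>: "\<phi> \<in> schwartz n"
    let ?A = "\<integral>x. (cmod (g x))\<^sup>2 \<partial>lborel_n n"
    let ?W = "\<integral>x. weight n x \<partial>lborel_n n"
    have "(cmod (w \<phi>))\<^sup>2 \<le> ?A * (\<integral>x. (cmod (\<phi> x))\<^sup>2 \<partial>lborel_n n)"
      unfolding w[OF \<phi>] by (rule integral_Cauchy_Schwarz[OF g schwartz_square_integrable[OF \<phi>]])
    also have "\<dots> \<le> ?A * ((schwartz_seminorm n n \<phi>)\<^sup>2 * ?W)"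
      by (intro mult_left_mono integral_square_le_seminorm \<phi>) auto
    finally have "cmod (w \<phi>) \<le> sqrt (?A * ((schwartz_seminorm n n \<phi>)\<^sup>2 * ?W))" by (rule real_le_rsqrt)
    also have "\<dots> = sqrt (?A * ?W) * schwartz_seminorm n n \<phi>"
      using schwartz_seminorm_nonneg[OF \<phi>, of n] by (simp add: real_sqrt_mult)
    finally show "cmod (w \<phi>) \<le> sqrt (?A * ?W) * schwartz_seminorm n n \<phi>" .
  qed
qed

text \<open>As functions on \<open>cfun\<close>, distributions could distinguish Schwartz functions
  that differ off \<open>points n\<close>. The seminorms evaluate derivatives on
  \<open>points n\<close> only, so the continuity bound forces \<open>u\<close> to vanish on the
  difference.\<close>

lemma tempered_cong:
  assumes u: "u \<in> tempered n" and \<phi>: "\<phi> \<in> schwartz n" and \<psi>: "\<psi> \<in> schwartz n"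
    and eq: "\<And>x. x \<in> points n \<Longrightarrow> \<phi> x = \<psi> x"
  shows "u \<phi> = u \<psi>"
proof -
  let ?d = "\<lambda>x. 1 * \<phi> x + (- 1) * \<psi> x"
  have d: "?d \<in> schwartz n" by (rule schwartz_lincomb[OF \<phi> \<psi>])
  have lin: "u ?d = 1 * u \<phi> + (- 1) * u \<psi>"
    using u \<phi> \<psi> unfolding tempered_def by blast
  obtain k M where M: "\<forall>\<phi> \<in> schwartz n. cmod (u \<phi>) \<le> M * schwartz_seminorm n k \<phi>"
    using u unfolding tempered_def by blast
  have zero: "\<forall>x\<in>points n. foldr partial_deriv is ?d x = 0" if "is \<in> lists {..<n}" for "is"
    using that
  proof (induction "is" rule: lists.induct)
    case Nil
    then show ?case using eq by simp
  next
    case (Cons i js)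
    have "has_partial n i (\<lambda>_. 0) (\<lambda>_. 0)" by (simp add: has_partial_def)
    then have "has_partial n i (foldr partial_deriv js ?d) (\<lambda>_. 0)"
      by (rule has_partial_cong) (use Cons in auto)
    from partial_deriv_eq[OF this] show ?case by simp
  qed
  let ?I = "{is \<in> lists {..<n}. length is \<le> k} \<times> points n"
  have "schwartz_seminorm n k ?d = (SUP z\<in>?I. 0)"
    unfolding schwartz_seminorm_def
  proof (intro SUP_cong refl)
    fix z assume "z \<in> ?I"
    then obtain "is" x where z: "z = (is, x)" "is \<in> lists {..<n}" "x \<in> points n" by blast
    show "(case z of (is, x) \<Rightarrow> (1 + L2_set x {..<n}) ^ k * cmod (foldr partial_deriv is ?d x)) = 0"
      using bspec[OF zero[OF z(2)] z(3)] unfolding z(1) by simp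
  qed
  also have "?I \<noteq> {}" using points_nonempty[of n] by (auto intro!: exI[of _ "[]"])
  then have "(SUP z\<in>?I. 0) = (0::real)" by (rule cSUP_const)
  finally have "cmod (u ?d) \<le> 0" using M d by force
  then show ?thesis using lin by simp
qed

text \<open>A Schwartz function is the Fourier transform of its inverse transform, which moves the
  evaluation of \<open>u\<close> to its transform. Inversion holds on \<open>points n\<close>, hence
  the appeal to \<open>tempered_cong\<close>.\<close>

lemma tempered_eq_integral_FT:
  assumes u: "u \<in> tempered n" and v: "represents n v (fourier_dist n u)" and \<psi>: "\<psi> \<in> schwartz n"
  shows "u \<psi> = (\<integral>\<xi>. v \<xi> * FT 1 n \<psi> \<xi> \<partial>lborel_n n)"
proof -
  have F: "FT 1 n \<psi> \<in> schwartz n" by (rule FT_schwartz[OF \<psi>]) simp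
  have "u \<psi> = u (fourier n (FT 1 n \<psi>))"
    unfolding fourier_eq_FT
    by (rule tempered_cong[OF u \<psi> FT_schwartz[OF F]]) (use FT_FT_minus[OF \<psi>, of 1] in auto)
  also have "\<dots> = (\<integral>\<xi>. v \<xi> * FT 1 n \<psi> \<xi> \<partial>lborel_n n)"
    using v F by (simp add: represents_def fourier_dist_def)
  finally show ?thesis .
qed

text \<open>Stated for an arbitrary \<open>w\<close> because it is applied to \<open>u t\<close>, to
  its partial derivatives and to its time derivative, each with its own \<open>f\<close>.\<close>

lemma L2_space_of_FT:
  assumes f: "square_integrable (lborel_n n) f"
    and w: "\<And>\<psi>. \<psi> \<in> schwartz n \<Longrightarrow> w \<psi> = (\<integral>\<xi>. f \<xi> * FT 1 n \<psi> \<xi> \<partial>lborel_n n)"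
  shows "w \<in> L2_space n" "L2_norm n w \<le> sqrt (\<integral>\<xi>. (cmod (f \<xi>))\<^sup>2 \<partial>lborel_n n)"
proof -
  obtain g where g: "square_integrable (lborel_n n) g"
    "(\<integral>x. (cmod (g x))\<^sup>2 \<partial>lborel_n n) \<le> (\<integral>x. (cmod (f x))\<^sup>2 \<partial>lborel_n n)"
    "\<And>\<psi>. \<psi> \<in> schwartz n \<Longrightarrow> (\<integral>x. g x * \<psi> x \<partial>lborel_n n) = (\<integral>\<xi>. f \<xi> * FT 1 n \<psi> \<xi> \<partial>lborel_n n)"
    using FT_square_integrable[OF f abs_one] by blast
  have "w \<psi> = (\<integral>x. g x * \<psi> x \<partial>lborel_n n)" if "\<psi> \<in> schwartz n" for \<psi>
    using w[OF that] g(3)[OF that] by simp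
  note t = square_integrable_tempered[OF g(1) this]
  show "w \<in> L2_space n" using t g(1) unfolding L2_space_def square_integrable_def by blast
  show "L2_norm n w \<le> sqrt (\<integral>\<xi>. (cmod (f \<xi>))\<^sup>2 \<partial>lborel_n n)"
    using L2_norm_eq[OF t(2)] g(2) by simp
qed

text \<open>The function that Riesz representation yields for the transform and the given
  \<open>v\<close> represent the same distribution, so \<open>v\<close> inherits the norm
  bound.\<close>

lemma L2_space_FT_representative:
  assumes u: "u \<in> L2_space n" and v: "represents n v (fourier_dist n u)"
  shows "square_integrable (lborel_n n) v" "(\<integral>\<xi>. (cmod (v \<xi>))\<^sup>2 \<partial>lborel_n n) \<le> (L2_norm n u)\<^sup>2"
proof -
  have [measurable]: "v \<in> borel_measurable (lborel_n n)" using v by (simp add: represents_def)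
  obtain g where g: "represents n g u" "integrable (lborel_n n) (\<lambda>x. (cmod (g x))\<^sup>2)"
    using u by (auto simp: L2_space_def)
  then have "square_integrable (lborel_n n) g" by (simp add: square_integrable_def represents_def)
  then obtain h where h: "square_integrable (lborel_n n) h"
    "(\<integral>x. (cmod (h x))\<^sup>2 \<partial>lborel_n n) \<le> (\<integral>x. (cmod (g x))\<^sup>2 \<partial>lborel_n n)"
    "\<And>\<psi>. \<psi> \<in> schwartz n \<Longrightarrow> (\<integral>x. h x * \<psi> x \<partial>lborel_n n) = (\<integral>\<xi>. g \<xi> * FT (- 1) n \<psi> \<xi> \<partial>lborel_n n)"
    using FT_square_integrable[of n g "- 1"] by fastforce
  have [measurable]: "h \<in> borel_measurable (lborel_n n)" by (rule square_integrable_measurable[OF h(1)])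
  have "fourier_dist n u \<psi> = (\<integral>x. h x * \<psi> x \<partial>lborel_n n)" if \<psi>: "\<psi> \<in> schwartz n" for \<psi>
  proof -
    have "FT (- 1) n \<psi> \<in> schwartz n" by (rule FT_schwartz[OF \<psi>]) simp
    then show ?thesis using g(1) h(3)[OF \<psi>] by (simp add: represents_def fourier_dist_def fourier_eq_FT)
  qed
  then have "represents n h (fourier_dist n u)" by (rule square_integrable_tempered(2)[OF h(1)])
  from represents_unique[OF this v] have ae: "AE x in lborel_n n. h x = v x" .
  have "integrable (lborel_n n) (\<lambda>x. (cmod (h x))\<^sup>2)" using h(1) by (simp add: square_integrable_def)
  then have "integrable (lborel_n n) (\<lambda>x. (cmod (v x))\<^sup>2)"
    by (rule integrable_cong_AE_imp) (use ae in auto)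
  then show "square_integrable (lborel_n n) v" by (simp add: square_integrable_def)
  have "(\<integral>\<xi>. (cmod (v \<xi>))\<^sup>2 \<partial>lborel_n n) = (\<integral>\<xi>. (cmod (h \<xi>))\<^sup>2 \<partial>lborel_n n)"
    using ae by (intro integral_cong_AE) auto
  also have "\<dots> \<le> (L2_norm n u)\<^sup>2" unfolding L2_norm_eq[OF g(1)] using h(2) by simp
  finally show "(\<integral>\<xi>. (cmod (v \<xi>))\<^sup>2 \<partial>lborel_n n) \<le> (L2_norm n u)\<^sup>2" .
qed

section \<open>The Cauchy problem\<close>

lemma square_integrable_of_bound:
  fixes p q :: "'a \<Rightarrow> real"
  assumes f: "f \<in> borel_measurable M" and bd: "\<And>x. x \<in> space M \<Longrightarrow> (cmod (f x))\<^sup>2 \<le> K * (p x + q x)"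
    and p: "integrable M p" "(\<integral>x. p x \<partial>M) \<le> A\<^sup>2" and q: "integrable M q" "(\<integral>x. q x \<partial>M) \<le> B\<^sup>2"
    and nonneg: "0 \<le> K" "0 \<le> A" "0 \<le> B"
  shows "square_integrable M f" "(\<integral>x. (cmod (f x))\<^sup>2 \<partial>M) \<le> K * (A + B)\<^sup>2"
proof -
  have int: "integrable M (\<lambda>x. K * (p x + q x))" using p q by simp
  have sq: "integrable M (\<lambda>x. (cmod (f x))\<^sup>2)"
  proof (rule Bochner_Integration.integrable_bound[OF int])
    show "(\<lambda>x. (cmod (f x))\<^sup>2) \<in> borel_measurable M" using f by measurable
    show "AE x in M. norm ((cmod (f x))\<^sup>2) \<le> norm (K * (p x + q x))"
      using bd by (intro AE_I2) (simp add: order_trans[OF _ abs_ge_self])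
  qed
  then show "square_integrable M f" using f by (simp add: square_integrable_def)
  have "(\<integral>x. (cmod (f x))\<^sup>2 \<partial>M) \<le> (\<integral>x. K * (p x + q x) \<partial>M)"
    using sq int bd by (rule Bochner_Integration.integral_mono)
  also have "\<dots> = K * ((\<integral>x. p x \<partial>M) + (\<integral>x. q x \<partial>M))" using p q by simp
  also have "\<dots> \<le> K * (A\<^sup>2 + B\<^sup>2)" using p q nonneg by (intro mult_left_mono add_mono) auto
  also have "\<dots> \<le> K * (A + B)\<^sup>2" using nonneg by (intro mult_left_mono) (auto simp: power2_sum)
  finally show "(\<integral>x. (cmod (f x))\<^sup>2 \<partial>M) \<le> K * (A + B)\<^sup>2" .
qed

text \<open>Makes vector derivatives within \<open>{0..}\<close> unique, also at the endpoint 0, so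
  that \<open>time_deriv\<close> has a determined value.\<close>

lemma at_within_atLeast_neq_bot: "t \<ge> 0 \<Longrightarrow> at t within {0..} \<noteq> (bot :: real filter)"
proof
  assume "t \<ge> 0" "at t within {0..} = bot"
  moreover have "at t within {t<..} \<le> at t within {0..}" using \<open>t \<ge> 0\<close> by (intro at_le) auto
  ultimately show False using trivial_limit_at_right_real[of t] by (simp add: bot_unique)
qed

section \<open>Estimates for a fixed solution, from the Fourier side\<close>

context
  fixes n :: nat and b :: "real \<Rightarrow> real" and m0 \<delta> C :: real
    and u :: "real \<Rightarrow> distribution" and v v' :: "real \<Rightarrow> cfun" and u0 u1 :: distribution
  assumes nonneg: "\<And>t. b t \<ge> 0" and m0: "m0 \<noteq> 0" and C: "C > 0"
    and decay: "\<And>L w w' t. L \<ge> m0\<^sup>2 \<Longrightarrow> wave_mode b L w w' \<Longrightarrow> t \<ge> 0 \<Longrightarrow>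
       energy L w w' t \<le> C * exp (- 2 * \<delta> * t) * energy L w w' 0"
    and u: "\<And>t. t \<ge> 0 \<Longrightarrow> u t \<in> tempered n"
    and v: "\<And>t. t \<ge> 0 \<Longrightarrow> represents n (v t) (fourier_dist n (u t))"
    and v0: "represents n (v 0) (fourier_dist n u0)"
    and v1: "represents n (v' 0) (fourier_dist n u1)"
    and mode: "\<And>\<xi>. \<xi> \<in> points n \<Longrightarrow> wave_mode b ((L2_set \<xi> {..<n})\<^sup>2 + m0\<^sup>2) (\<lambda>t. v t \<xi>) (\<lambda>t. v' t \<xi>)"
begin

private abbreviation freq :: "(nat \<Rightarrow> real) \<Rightarrow> real" where
  "freq \<xi> \<equiv> (L2_set \<xi> {..<n})\<^sup>2 + m0\<^sup>2"

private abbreviation energy0 :: "(nat \<Rightarrow> real) \<Rightarrow> real" where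
  "energy0 \<xi> \<equiv> (cmod (v' 0 \<xi>))\<^sup>2 + freq \<xi> * (cmod (v 0 \<xi>))\<^sup>2"

text \<open>A common upper bound for 1, 1 + m0^2 and 1 + 1/m0^2, the last two of which compare
  |\<xi>|^2 + m0^2 with 1 + |\<xi>|^2 from above and below.\<close>

private abbreviation m_const :: real where
  "m_const \<equiv> 1 + m0\<^sup>2 + 1 / m0\<^sup>2"

private lemma measurable_v: "t \<ge> 0 \<Longrightarrow> v t \<in> borel_measurable (lborel_n n)"
  using v by (simp add: represents_def)

text \<open>\<open>v'\<close> is given pointwise in \<xi> as a time derivative; measurability comes
  from difference quotients, taken from the right so that \<open>t = 0\<close> is included.\<close>

private lemma measurable_v':
  assumes t: "t \<ge> 0"
  shows "v' t \<in> borel_measurable (lborel_n n)"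
proof (rule borel_measurable_LIMSEQ_metric)
  let ?h = "\<lambda>k. 1 / real (Suc k)"
  show "(\<lambda>\<xi>. (v (t + ?h k) \<xi> - v t \<xi>) /\<^sub>R ?h k) \<in> borel_measurable (lborel_n n)" for k
  proof -
    have [measurable]: "v (t + ?h k) \<in> borel_measurable (lborel_n n)" "v t \<in> borel_measurable (lborel_n n)"
      using t by (auto intro!: measurable_v add_nonneg_nonneg)
    show ?thesis by measurable
  qed
  fix \<xi> assume \<xi>: "\<xi> \<in> points n"
  then have "((\<lambda>s. v s \<xi>) has_vector_derivative v' t \<xi>) (at t within {0..})"
    using mode t unfolding wave_mode_def by blast
  then have lim: "((\<lambda>s. ((v s \<xi> - v t \<xi>) - (s - t) *\<^sub>R v' t \<xi>) /\<^sub>R norm (s - t)) \<longlongrightarrow> 0) (at t within {0..})"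
    unfolding has_vector_derivative_def has_derivative_at_within by simp
  have "(\<lambda>k. t + ?h k) \<longlonglongrightarrow> t + 0" by (intro tendsto_intros LIMSEQ_Suc[OF lim_1_over_n])
  then have "(\<lambda>k. ((v (t + ?h k) \<xi> - v t \<xi>) - ?h k *\<^sub>R v' t \<xi>) /\<^sub>R norm (?h k)) \<longlonglongrightarrow> 0"
    using lim[unfolded tendsto_at_iff_sequentially, rule_format, of "\<lambda>k. t + ?h k"] t
    by (auto simp: comp_def)
  then have "(\<lambda>k. (v (t + ?h k) \<xi> - v t \<xi>) /\<^sub>R ?h k - v' t \<xi>) \<longlonglongrightarrow> 0"
    by (simp add: scaleR_diff_right)
  then show "(\<lambda>k. (v (t + ?h k) \<xi> - v t \<xi>) /\<^sub>R ?h k) \<longlonglongrightarrow> v' t \<xi>"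
    by (simp add: LIM_zero_iff)
qed

private lemma energy_bound:
  assumes "\<xi> \<in> points n" "t \<ge> 0"
  shows "(cmod (v' t \<xi>))\<^sup>2 + freq \<xi> * (cmod (v t \<xi>))\<^sup>2
    \<le> C * exp (- 2 * \<delta> * t) * energy0 \<xi>"
  using decay[OF _ mode[OF assms(1)] assms(2)] by (simp add: energy_def)

private lemma freq_pos: "freq \<xi> > 0"
  using m0 by (simp add: add_nonneg_pos)

private lemma freq_upper: "freq \<xi> \<le> (1 + m0\<^sup>2) * (1 + (L2_set \<xi> {..<n})\<^sup>2)"
  by (simp add: algebra_simps)

private lemma freq_lower: "1 / freq \<xi> \<le> (1 + 1 / m0\<^sup>2) * (1 / (1 + (L2_set \<xi> {..<n})\<^sup>2))"
proof -
  let ?r = "(L2_set \<xi> {..<n})\<^sup>2"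
  have m: "0 < m0\<^sup>2" using m0 by simp
  have "(1 + 1 / m0\<^sup>2) * freq \<xi> = 1 + ?r + m0\<^sup>2 + ?r / m0\<^sup>2"
    using m by (simp add: field_simps)
  also have "\<dots> \<ge> 1 + ?r" using m by simp
  finally have "1 + ?r \<le> (1 + 1 / m0\<^sup>2) * freq \<xi>" .
  moreover have "0 < 1 + ?r" by (simp add: add_pos_nonneg)
  ultimately show ?thesis using freq_pos[of \<xi>] by (simp add: divide_le_eq le_divide_eq mult_ac)
qed

private lemma sqrt_decay:
  assumes "A \<ge> 0"
  shows "sqrt (C * exp (- 2 * \<delta> * t) * D * A\<^sup>2) = sqrt (C * D) * exp (- \<delta> * t) * A"
proof -
  have "exp (- 2 * \<delta> * t) = (exp (- \<delta> * t))\<^sup>2" by (simp add: power2_eq_square exp_add[symmetric])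
  then show ?thesis using assms by (simp add: real_sqrt_mult)
qed

text \<open>The energy bound is divided by the squared frequency. This cancels the factor on the
  initial position and turns the one on the initial velocity into the H^-1 weight, up to a
  constant.\<close>

private lemma L2_estimate:
  assumes data: "u0 \<in> L2_space n" "u1 \<in> sobolev n (- 1)" and t: "t \<ge> 0"
  shows "u t \<in> L2_space n"
    and "L2_norm n (u t) \<le> sqrt (C * m_const) * exp (- \<delta> * t) * (L2_norm n u0 + sobolev_norm n (- 1) u1)"
proof -
  let ?K = "C * exp (- 2 * \<delta> * t) * m_const"
  let ?q = "\<lambda>\<xi>. (1 + (L2_set \<xi> {..<n})\<^sup>2) powr (- 1) * (cmod (v' 0 \<xi>))\<^sup>2"
  have m: "0 < m0\<^sup>2" using m0 by simp
  have bd: "(cmod (v t \<xi>))\<^sup>2 \<le> ?K * ((cmod (v 0 \<xi>))\<^sup>2 + ?q \<xi>)" if \<xi>: "\<xi> \<in> points n" for \<xi>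
  proof -
    let ?r = "1 + (L2_set \<xi> {..<n})\<^sup>2"
    have r: "?r powr (- 1) = 1 / ?r" by (simp add: powr_minus_divide add_pos_nonneg)
    have f: "freq \<xi> > 0" by (rule freq_pos)
    have "freq \<xi> * (cmod (v t \<xi>))\<^sup>2 \<le> C * exp (- 2 * \<delta> * t) * energy0 \<xi>"
      using energy_bound[OF \<xi> t] zero_le_power2[of "cmod (v' t \<xi>)"] by linarith
    then have "(cmod (v t \<xi>))\<^sup>2 \<le> C * exp (- 2 * \<delta> * t) * energy0 \<xi> / freq \<xi>"
      using f by (simp add: pos_le_divide_eq mult.commute)
    also have "\<dots> = C * exp (- 2 * \<delta> * t) * (1 / freq \<xi> * (cmod (v' 0 \<xi>))\<^sup>2 + (cmod (v 0 \<xi>))\<^sup>2)"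
    proof -
      have "k * (x + r * y) / r = k * (1 / r * x + y)" if "r > 0" for k x y r :: real
        using that by (simp add: field_simps)
      then show ?thesis using f by blast
    qed
    also have "\<dots> \<le> C * exp (- 2 * \<delta> * t) * (m_const * (1 / ?r) * (cmod (v' 0 \<xi>))\<^sup>2
        + m_const * (cmod (v 0 \<xi>))\<^sup>2)"
    proof (intro mult_left_mono add_mono mult_right_mono)
      have "1 / freq \<xi> \<le> (1 + 1 / m0\<^sup>2) * (1 / ?r)" by (rule freq_lower)
      also have "\<dots> \<le> m_const * (1 / ?r)"
        by (intro mult_right_mono) (auto simp: add_nonneg_nonneg)
      finally show "1 / freq \<xi> \<le> m_const * (1 / ?r)" .
      have "1 * (cmod (v 0 \<xi>))\<^sup>2 \<le> m_const * (cmod (v 0 \<xi>))\<^sup>2"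
        by (intro mult_right_mono) auto
      then show "(cmod (v 0 \<xi>))\<^sup>2 \<le> m_const * (cmod (v 0 \<xi>))\<^sup>2" by simp
    qed (use C in auto)
    finally show ?thesis unfolding r by (simp add: algebra_simps)
  qed
  note A = L2_space_FT_representative[OF data(1) v0]
  note B = sobolev_representative[OF data(2) v1]
  have K: "0 \<le> ?K" using C by simp
  have sq: "square_integrable (lborel_n n) (v t)"
    and le: "(\<integral>\<xi>. (cmod (v t \<xi>))\<^sup>2 \<partial>lborel_n n) \<le> ?K * (L2_norm n u0 + sobolev_norm n (- 1) u1)\<^sup>2"
    by (rule square_integrable_of_bound[OF measurable_v[OF t] bd _ A(2) B(1) eq_refl[OF B(2)] K L2_norm_nonneg sobolev_norm_nonneg];
        use A(1) in \<open>simp add: square_integrable_def\<close>)+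
  note F = L2_space_of_FT[OF sq tempered_eq_integral_FT[OF u[OF t] v[OF t]]]
  show "u t \<in> L2_space n" by (rule F(1))
  have "L2_norm n (u t) \<le> sqrt (?K * (L2_norm n u0 + sobolev_norm n (- 1) u1)\<^sup>2)"
    using F(2) real_sqrt_le_mono[OF le] by (rule order_trans)
  then show "L2_norm n (u t) \<le> sqrt (C * m_const) * exp (- \<delta> * t) * (L2_norm n u0 + sobolev_norm n (- 1) u1)"
    by (subst (asm) sqrt_decay) (auto simp: sobolev_norm_nonneg L2_norm_nonneg)
qed

text \<open>Shared by the gradient, with \<open>f\<close> equal to |\<xi>| v, and the time
  derivative, with \<open>f\<close> equal to \<open>v' t\<close>. With \<open>K = 1\<close> it also
  shows that the square root of the initial energy density is square integrable.\<close>

private lemma H1_energy_bound: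
  fixes f :: "(nat \<Rightarrow> real) \<Rightarrow> complex"
  assumes data: "u0 \<in> sobolev n 1" "u1 \<in> L2_space n"
    and f: "f \<in> borel_measurable (lborel_n n)" and K: "K \<ge> 0"
    and bd: "\<And>\<xi>. \<xi> \<in> points n \<Longrightarrow> (cmod (f \<xi>))\<^sup>2 \<le> K * energy0 \<xi>"
  shows "square_integrable (lborel_n n) f"
    and "(\<integral>\<xi>. (cmod (f \<xi>))\<^sup>2 \<partial>lborel_n n) \<le> K * m_const * (sobolev_norm n 1 u0 + L2_norm n u1)\<^sup>2"
proof -
  let ?p = "\<lambda>\<xi>. (1 + (L2_set \<xi> {..<n})\<^sup>2) powr 1 * (cmod (v 0 \<xi>))\<^sup>2"
  have bd': "(cmod (f \<xi>))\<^sup>2 \<le> K * m_const * (?p \<xi> + (cmod (v' 0 \<xi>))\<^sup>2)" if \<xi>: "\<xi> \<in> points n" for \<xi>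
  proof -
    let ?r = "1 + (L2_set \<xi> {..<n})\<^sup>2"
    let ?D = m_const
    have r: "?r powr 1 = ?r" by (simp add: add_nonneg_nonneg)
    have "freq \<xi> \<le> (1 + m0\<^sup>2) * ?r" by (rule freq_upper)
    also have "\<dots> \<le> ?D * ?r" by (intro mult_right_mono) (auto simp: add_nonneg_nonneg)
    finally have "freq \<xi> * (cmod (v 0 \<xi>))\<^sup>2 \<le> ?D * ?r * (cmod (v 0 \<xi>))\<^sup>2" by (intro mult_right_mono) auto
    moreover have "1 * (cmod (v' 0 \<xi>))\<^sup>2 \<le> ?D * (cmod (v' 0 \<xi>))\<^sup>2" by (intro mult_right_mono) auto
    ultimately have "energy0 \<xi> \<le> ?D * (?r * (cmod (v 0 \<xi>))\<^sup>2 + (cmod (v' 0 \<xi>))\<^sup>2)"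
      unfolding distrib_left[of ?D "?r * (cmod (v 0 \<xi>))\<^sup>2"] mult.assoc[of ?D ?r, symmetric] by linarith
    then have "K * energy0 \<xi> \<le> K * (?D * (?r * (cmod (v 0 \<xi>))\<^sup>2 + (cmod (v' 0 \<xi>))\<^sup>2))"
      using K by (rule mult_left_mono)
    with bd[OF \<xi>] show ?thesis unfolding r by (simp add: mult.assoc)
  qed
  note A = sobolev_representative[OF data(1) v0]
  note B = L2_space_FT_representative[OF data(2) v1]
  have K': "0 \<le> K * m_const" using K by simp
  show "square_integrable (lborel_n n) f"
    "(\<integral>\<xi>. (cmod (f \<xi>))\<^sup>2 \<partial>lborel_n n) \<le> K * m_const * (sobolev_norm n 1 u0 + L2_norm n u1)\<^sup>2"
    by (rule square_integrable_of_bound[OF f bd' A(1) eq_refl[OF A(2)] _ B(2) K' sobolev_norm_nonneg L2_norm_nonneg];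
        use B(1) in \<open>simp add: square_integrable_def\<close>)+
qed

text \<open>The derivatives have transforms \<open>\<i> * \<xi> i * v t \<xi>\<close>. Their squared
  norms are summed before estimating, so the |\<xi>_i|^2 recombine to |\<xi>|^2 and no factor
  depending on \<open>n\<close> appears.\<close>

private lemma gradient_estimate:
  assumes data: "u0 \<in> sobolev n 1" "u1 \<in> L2_space n" and t: "t \<ge> 0"
  shows "\<forall>i<n. partial_dist i (u t) \<in> L2_space n"
    and "gradient_L2_norm n (u t) \<le> sqrt (C * m_const) * exp (- \<delta> * t) * (sobolev_norm n 1 u0 + L2_norm n u1)"
proof -
  let ?K = "C * exp (- 2 * \<delta> * t)"
  have K: "0 \<le> ?K" using C by simp
  note [measurable] = measurable_v[OF t]
  have bd: "(cmod (of_real (L2_set \<xi> {..<n}) * v t \<xi>))\<^sup>2 \<le> ?K * energy0 \<xi>"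
    if \<xi>: "\<xi> \<in> points n" for \<xi>
  proof -
    have "(cmod (of_real (L2_set \<xi> {..<n}) * v t \<xi>))\<^sup>2 = (L2_set \<xi> {..<n})\<^sup>2 * (cmod (v t \<xi>))\<^sup>2"
      by (simp add: norm_mult power_mult_distrib)
    also have "\<dots> \<le> freq \<xi> * (cmod (v t \<xi>))\<^sup>2" by (intro mult_right_mono) auto
    also have "\<dots> \<le> ?K * energy0 \<xi>"
      using energy_bound[OF \<xi> t] zero_le_power2[of "cmod (v' t \<xi>)"] by linarith
    finally show ?thesis .
  qed
  have "(\<lambda>\<xi>. of_real (L2_set \<xi> {..<n}) * v t \<xi>) \<in> borel_measurable (lborel_n n)" by measurable
  note N = H1_energy_bound[OF data this K bd]
  have int: "square_integrable (lborel_n n) (\<lambda>\<xi>. \<i> * of_real (\<xi> i) * v t \<xi>)" if i: "i < n" for i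
    unfolding square_integrable_def
  proof
    show m: "(\<lambda>\<xi>. \<i> * of_real (\<xi> i) * v t \<xi>) \<in> borel_measurable (lborel_n n)"
    proof -
      have [measurable]: "(\<lambda>\<xi>. \<xi> i) \<in> borel_measurable (lborel_n n)" using i by simp
      show ?thesis by measurable
    qed
    show "integrable (lborel_n n) (\<lambda>\<xi>. (cmod (\<i> * of_real (\<xi> i) * v t \<xi>))\<^sup>2)"
    proof (rule Bochner_Integration.integrable_bound)
      show "integrable (lborel_n n) (\<lambda>\<xi>. (cmod (of_real (L2_set \<xi> {..<n}) * v t \<xi>))\<^sup>2)"
        using N(1) by (simp add: square_integrable_def)
      show "(\<lambda>\<xi>. (cmod (\<i> * of_real (\<xi> i) * v t \<xi>))\<^sup>2) \<in> borel_measurable (lborel_n n)" using m by measurable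
      show "AE \<xi> in lborel_n n. norm ((cmod (\<i> * of_real (\<xi> i) * v t \<xi>))\<^sup>2)
          \<le> norm ((cmod (of_real (L2_set \<xi> {..<n}) * v t \<xi>))\<^sup>2)"
        using abs_coord_le_L2_set[OF i] by (intro AE_I2) (auto simp: norm_mult intro!: power_mono mult_right_mono order_trans[OF _ abs_ge_self])
    qed
  qed
  have FT: "partial_dist i (u t) \<psi> = (\<integral>\<xi>. (\<i> * of_real (\<xi> i) * v t \<xi>) * FT 1 n \<psi> \<xi> \<partial>lborel_n n)"
    if i: "i < n" and \<psi>: "\<psi> \<in> schwartz n" for i \<psi>
  proof -
    have "partial_dist i (u t) \<psi> = - (\<integral>\<xi>. v t \<xi> * FT 1 n (partial_deriv i \<psi>) \<xi> \<partial>lborel_n n)"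
      unfolding partial_dist_def tempered_eq_integral_FT[OF u[OF t] v[OF t] schwartz_partial_deriv[OF \<psi> i]] ..
    also have "\<dots> = (\<integral>\<xi>. - (v t \<xi> * FT 1 n (partial_deriv i \<psi>) \<xi>) \<partial>lborel_n n)"
      by (rule Bochner_Integration.integral_minus[symmetric])
    also have "\<dots> = (\<integral>\<xi>. (\<i> * of_real (\<xi> i) * v t \<xi>) * FT 1 n \<psi> \<xi> \<partial>lborel_n n)"
      by (simp add: FT_partial_deriv[OF \<psi> i] mult_ac)
    finally show ?thesis .
  qed
  note P = L2_space_of_FT[OF int FT]
  show "\<forall>i<n. partial_dist i (u t) \<in> L2_space n" using P(1) by blast
  have "(\<Sum>i<n. (L2_norm n (partial_dist i (u t)))\<^sup>2)
      \<le> (\<Sum>i<n. \<integral>\<xi>. (cmod (\<i> * of_real (\<xi> i) * v t \<xi>))\<^sup>2 \<partial>lborel_n n)"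
  proof (rule sum_mono)
    fix i assume "i \<in> {..<n}"
    then have "L2_norm n (partial_dist i (u t)) \<le> sqrt (\<integral>\<xi>. (cmod (\<i> * of_real (\<xi> i) * v t \<xi>))\<^sup>2 \<partial>lborel_n n)"
      by (intro P(2)) auto
    from power_mono[OF this L2_norm_nonneg, of 2]
    show "(L2_norm n (partial_dist i (u t)))\<^sup>2 \<le> (\<integral>\<xi>. (cmod (\<i> * of_real (\<xi> i) * v t \<xi>))\<^sup>2 \<partial>lborel_n n)"
      by simp
  qed
  also have "\<dots> = (\<integral>\<xi>. (\<Sum>i<n. (cmod (\<i> * of_real (\<xi> i) * v t \<xi>))\<^sup>2) \<partial>lborel_n n)"
    using int by (intro Bochner_Integration.integral_sum[symmetric]) (auto simp: square_integrable_def)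
  also have "\<dots> = (\<integral>\<xi>. (cmod (of_real (L2_set \<xi> {..<n}) * v t \<xi>))\<^sup>2 \<partial>lborel_n n)"
    by (simp add: norm_mult power_mult_distrib L2_set_def sum_nonneg sum_distrib_right)
  also have "\<dots> \<le> ?K * m_const * (sobolev_norm n 1 u0 + L2_norm n u1)\<^sup>2" by (rule N(2))
  finally have "gradient_L2_norm n (u t) \<le> sqrt (?K * m_const * (sobolev_norm n 1 u0 + L2_norm n u1)\<^sup>2)"
    unfolding gradient_L2_norm_def by (rule real_sqrt_le_mono)
  then show "gradient_L2_norm n (u t) \<le> sqrt (C * m_const) * exp (- \<delta> * t) * (sobolev_norm n 1 u0 + L2_norm n u1)"
    by (subst (asm) sqrt_decay) (auto simp: sobolev_norm_nonneg L2_norm_nonneg)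
qed

text \<open>\<open>time_deriv\<close> is a weak derivative, so the frequency integral is
  differentiated. Energy monotonicity bounds \<open>v' s\<close> for all \<open>s \<ge> 0\<close> by
  the square root of the initial energy density; times a Schwartz function this is the integrable
  majorant.\<close>

private lemma time_deriv_estimate:
  assumes data: "u0 \<in> sobolev n 1" "u1 \<in> L2_space n" and t: "t \<ge> 0"
  shows "time_deriv u t \<in> L2_space n"
    and "L2_norm n (time_deriv u t) \<le> sqrt (C * m_const) * exp (- \<delta> * t) * (sobolev_norm n 1 u0 + L2_norm n u1)"
proof -
  let ?M = "lborel_n n"
  let ?K = "C * exp (- 2 * \<delta> * t)"
  define e where "e = energy0"
  have e0: "0 \<le> e \<xi>" for \<xi> unfolding e_def using freq_pos[of \<xi>] by simp
  have [measurable]: "e \<in> borel_measurable ?M"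
    unfolding e_def [abs_def] using measurable_v[of 0] measurable_v'[of 0] by measurable
  have "square_integrable ?M (\<lambda>\<xi>. of_real (sqrt (e \<xi>)))"
  proof (rule H1_energy_bound[OF data, of _ 1])
    show "(\<lambda>\<xi>. complex_of_real (sqrt (e \<xi>))) \<in> borel_measurable ?M" by measurable
    show "(cmod (of_real (sqrt (e \<xi>))))\<^sup>2 \<le> 1 * energy0 \<xi>" for \<xi>
      using e0[of \<xi>] by (simp add: e_def)
  qed simp
  note sq_e = this
  have v'_le: "cmod (v' s \<xi>) \<le> sqrt (e \<xi>)" if "s \<ge> 0" "\<xi> \<in> points n" for s \<xi>
  proof (rule real_le_rsqrt)
    have "energy (freq \<xi>) (\<lambda>t. v t \<xi>) (\<lambda>t. v' t \<xi>) s \<le> energy (freq \<xi>) (\<lambda>t. v t \<xi>) (\<lambda>t. v' t \<xi>) 0"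
      using that by (intro energy_antimono[OF mode nonneg]) auto
    moreover have "0 \<le> freq \<xi> * (cmod (v s \<xi>))\<^sup>2" using freq_pos[of \<xi>] by simp
    ultimately show "(cmod (v' s \<xi>))\<^sup>2 \<le> e \<xi>" unfolding energy_def e_def by linarith
  qed
  have FT: "time_deriv u t \<psi> = (\<integral>\<xi>. v' t \<xi> * FT 1 n \<psi> \<xi> \<partial>?M)" if \<psi>: "\<psi> \<in> schwartz n" for \<psi>
  proof -
    let ?\<phi> = "FT 1 n \<psi>"
    have \<phi>: "?\<phi> \<in> schwartz n" by (rule FT_schwartz[OF \<psi>]) simp
    have "((\<lambda>s. \<integral>\<xi>. v s \<xi> * ?\<phi> \<xi> \<partial>?M) has_vector_derivative (\<integral>\<xi>. v' t \<xi> * ?\<phi> \<xi> \<partial>?M)) (at t within {0..})"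
    proof (rule has_vector_derivative_integral[where w = "\<lambda>\<xi>. cmod (of_real (sqrt (e \<xi>)) * ?\<phi> \<xi>)"])
      show "integrable ?M (\<lambda>\<xi>. v s \<xi> * ?\<phi> \<xi>)" if "s \<in> {0..}" for s
        using v[of s] that \<phi> by (simp add: represents_def)
      show "((\<lambda>s. v s \<xi> * ?\<phi> \<xi>) has_vector_derivative v' s \<xi> * ?\<phi> \<xi>) (at s within {0..})"
        if "s \<in> {0..}" "\<xi> \<in> points n" for s \<xi>
        using mode[OF that(2)] that(1) unfolding wave_mode_def by (intro has_vector_derivative_mult_left) auto
      show "norm (v' s \<xi> * ?\<phi> \<xi>) \<le> cmod (of_real (sqrt (e \<xi>)) * ?\<phi> \<xi>)" if "s \<in> {0..}" "\<xi> \<in> points n" for s \<xi>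
        using v'_le[of s \<xi>] that e0[of \<xi>] by (simp add: norm_mult mult_right_mono)
      show "integrable ?M (\<lambda>\<xi>. cmod (of_real (sqrt (e \<xi>)) * ?\<phi> \<xi>))"
        by (intro integrable_norm integrable_mult_square_integrable sq_e schwartz_square_integrable \<phi>)
      show "(\<lambda>\<xi>. v' t \<xi> * ?\<phi> \<xi>) \<in> borel_measurable ?M"
        using measurable_v'[OF t] schwartz_measurable[OF \<phi>] by measurable
    qed (use t in auto)
    then have "((\<lambda>s. u s \<psi>) has_vector_derivative (\<integral>\<xi>. v' t \<xi> * ?\<phi> \<xi> \<partial>?M)) (at t within {0..})"
      by (rule has_vector_derivative_transform[rotated 2])
        (use t tempered_eq_integral_FT[OF u v \<psi>] in auto)
    then show ?thesis
      unfolding time_deriv_def by (rule vector_derivative_within[OF at_within_atLeast_neq_bot[OF t]])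
  qed
  have bd: "(cmod (v' t \<xi>))\<^sup>2 \<le> ?K * energy0 \<xi>" if \<xi>: "\<xi> \<in> points n" for \<xi>
  proof -
    have "0 \<le> freq \<xi> * (cmod (v t \<xi>))\<^sup>2" using freq_pos[of \<xi>] by simp
    then show ?thesis using energy_bound[OF \<xi> t] by linarith
  qed
  have K: "0 \<le> ?K" using C by simp
  note N = H1_energy_bound[OF data measurable_v'[OF t] K bd]
  note F = L2_space_of_FT[OF N(1) FT]
  show "time_deriv u t \<in> L2_space n" by (rule F(1))
  have "L2_norm n (time_deriv u t) \<le> sqrt (?K * m_const * (sobolev_norm n 1 u0 + L2_norm n u1)\<^sup>2)"
    using F(2) real_sqrt_le_mono[OF N(2)] by (rule order_trans)
  then show "L2_norm n (time_deriv u t) \<le> sqrt (C * m_const) * exp (- \<delta> * t) * (sobolev_norm n 1 u0 + L2_norm n u1)"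
    by (subst (asm) sqrt_decay) (auto simp: sobolev_norm_nonneg L2_norm_nonneg)
qed

lemmas wave_estimates = L2_estimate gradient_estimate time_deriv_estimate

end

theorem theorem1:
  fixes b :: "real \<Rightarrow> real" and T m0 :: real
  assumes "T > 0"
    and "continuous_on UNIV b"
    and "\<forall>t. b t \<ge> 0"
    and "\<forall>t. b (t + T) = b t"
    and "\<exists>t. b t \<noteq> 0"
    and "\<exists>b'. weak_derivative b b' \<and> b' \<in> L_infinity"
    and "m0 \<noteq> 0"
  shows "\<exists>\<delta>>0. \<exists>C>0. \<forall>n\<ge>1. \<forall>u0 \<in> tempered n. \<forall>u1 \<in> tempered n. \<forall>u.
    cauchy_solution n b m0 u0 u1 u \<longrightarrow>
      (u0 \<in> L2_space n \<and> u1 \<in> sobolev n (-1) \<longrightarrow>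
        (\<forall>t\<ge>0. u t \<in> L2_space n \<and>
          L2_norm n (u t) \<le> C * exp (- \<delta> * t) * (L2_norm n u0 + sobolev_norm n (-1) u1))) \<and>
      (u0 \<in> sobolev n 1 \<and> u1 \<in> L2_space n \<longrightarrow>
        (\<forall>t\<ge>0. (\<forall>i<n. partial_dist i (u t) \<in> L2_space n) \<and>
          gradient_L2_norm n (u t) \<le> C * exp (- \<delta> * t) * (sobolev_norm n 1 u0 + L2_norm n u1))) \<and>
      (u0 \<in> sobolev n 1 \<and> u1 \<in> L2_space n \<longrightarrow>
        (\<forall>t\<ge>0. time_deriv u t \<in> L2_space n \<and>
          L2_norm n (time_deriv u t) \<le> C * exp (- \<delta> * t) * (sobolev_norm n 1 u0 + L2_norm n u1)))"
proof -
  \<comment> \<open>The floor \<open>m0\<^sup>2\<close> for the squared frequency is the same in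
    every dimension, so \<open>\<delta>\<close> and \<open>C\<close> are obtained before
    \<open>n\<close> is fixed.\<close>
  have "m0\<^sup>2 > 0" using assms(7) by simp
  from energy_decay[OF assms(1-5) this] obtain \<delta> C where \<delta>: "\<delta> > 0" and C: "C > 0"
    and decay: "\<And>L w w' t. L \<ge> m0\<^sup>2 \<Longrightarrow> wave_mode b L w w' \<Longrightarrow> t \<ge> 0 \<Longrightarrow>
       energy L w w' t \<le> C * exp (- 2 * \<delta> * t) * energy L w w' 0"
    by blast
  show ?thesis
  proof (rule exI[of _ \<delta>], rule conjI[OF \<delta>], rule exI[of _ "sqrt (C * (1 + m0\<^sup>2 + 1 / m0\<^sup>2))"],
      rule conjI, goal_cases)
    case 1
    show ?case using C by (simp add: add_pos_nonneg)
  next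
    case 2
    show ?case
    proof (intro allI ballI impI, goal_cases)
      case (1 n u0 u1 u)
      from 1(4) obtain v v' v'' where u: "\<And>t. t \<ge> 0 \<Longrightarrow> u t \<in> tempered n"
        and v: "\<And>t. t \<ge> 0 \<Longrightarrow> represents n (v t) (fourier_dist n (u t))"
        and v0: "represents n (v 0) (fourier_dist n u0)"
        and v1: "represents n (v' 0) (fourier_dist n u1)"
        and ode: "\<And>\<xi> t. \<xi> \<in> points n \<Longrightarrow> t \<ge> 0 \<Longrightarrow>
           ((\<lambda>s. v s \<xi>) has_vector_derivative v' t \<xi>) (at t within {0..}) \<and>
           ((\<lambda>s. v' s \<xi>) has_vector_derivative v'' t \<xi>) (at t within {0..}) \<and>
           v'' t \<xi> + of_real ((L2_set \<xi> {..<n})\<^sup>2) * v t \<xi> + of_real (2 * b t) * v' t \<xi>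
             + of_real (m0\<^sup>2) * v t \<xi> = 0"
        unfolding cauchy_solution_def by blast
      have mode: "wave_mode b ((L2_set \<xi> {..<n})\<^sup>2 + m0\<^sup>2) (\<lambda>t. v t \<xi>) (\<lambda>t. v' t \<xi>)" if \<xi>: "\<xi> \<in> points n" for \<xi>
        unfolding wave_mode_def
      proof (intro allI impI)
        fix t :: real assume t: "t \<ge> 0"
        have "v'' t \<xi> = - (of_real ((L2_set \<xi> {..<n})\<^sup>2 + m0\<^sup>2) * v t \<xi> + of_real (2 * b t) * v' t \<xi>)"
          using ode[OF \<xi> t] by (simp add: algebra_simps eq_neg_iff_add_eq_0)
        with ode[OF \<xi> t]
        show "((\<lambda>t. v t \<xi>) has_vector_derivative v' t \<xi>) (at t within {0..}) \<and>
          ((\<lambda>t. v' t \<xi>) has_vector_derivative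
            - (of_real ((L2_set \<xi> {..<n})\<^sup>2 + m0\<^sup>2) * v t \<xi> + of_real (2 * b t) * v' t \<xi>)) (at t within {0..})"
          by metis
      qed
      note est = wave_estimates[OF assms(3)[rule_format] assms(7) C decay u v v0 v1 mode]
      show ?case
        using est by blast
    qed
  qed
qed

end
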